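(* Let $A$ and $B$ be monoids in a locally presentable braided monoidal closed category $\mathcal{V}$. There is an isomorphism between the category of dualizable right $P(A,B)$-comodules and the category of dualizable objects of ${}^{A}\mathcal{V}_B$; furthermore, the isomorphism commutes with the respective forgetful functors into $\mathcal{V}$.
   Context: The category ${}^{A}\mathcal{V}_B$ has as objects pairs $(X,\psi)$, where $X\in\mathcal{V}$ and $\psi\colon A\otimes X\to X\otimes B$ is a morphism satisfying $$(X\otimes\mu_B)\cdot(\psi\otimes B)\cdot(A\otimes\psi)=\psi\cdot(\mu_A\otimes X)\quad\text{and}\quad\psi\cdot(\iota_A\otimes X)=X\otimes\iota_B,$$ where $\mu,\iota$ denote multiplications and units. A morphism $(X,\psi)\to(X',\psi')$ is a morphism $f\colon X\to X'$ in $\mathcal{V}$ with $(f\otimes B)\cdot\psi=\psi'\cdot(A\otimes f)$. The forgetful functor sends $(X,\psi)$ to $X$. An object of a category over $\mathcal{V}$ (here: right $P(A,B)$-comodules, or ${}^{A}\mathcal{V}_B$, with their forgetful functors) is dualizable if its underlying object in $\mathcal{V}$ has a dual; the categories of dualizable objects are the corresponding full subcategories. For a comonoid $C$ and a monoid $B$, the internal hom $[C,B]$ has the convolution monoid structure. $P(A,B)$, the universal measuring comonoid, is the comonoid with natural bijections $\mathbf{Mon}(\mathcal{V})(A,[C,B])\cong\mathbf{Comon}(\mathcal{V})(C,P(A,B))$ for comonoids $C$; it exists under the stated hypotheses. *)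

theory Defs
  imports Main
begin

unbundle cardinal_syntax

section \<open>Categories\<close>

record ('o, 'm) cat =
  Obj :: "'o set"
  Arr :: "'m set"
  Dom :: "'m \<Rightarrow> 'o"
  Cod :: "'m \<Rightarrow> 'o"
  id_arr :: "'o \<Rightarrow> 'm" ("\<i>\<index>")
  Comp :: "'m \<Rightarrow> 'm \<Rightarrow> 'm" (infixr "\<cdot>\<index>" 55)

definition hom :: "('o, 'm, 'z) cat_scheme \<Rightarrow> 'o \<Rightarrow> 'o \<Rightarrow> 'm set"
  where "hom C X Y = {f \<in> Arr C. Dom C f = X \<and> Cod C f = Y}"

locale category =
  fixes C :: "('o, 'm, 'z) cat_scheme" (structure)
  assumes Dom_Obj: "f \<in> Arr C \<Longrightarrow> Dom C f \<in> Obj C"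
    and Cod_Obj: "f \<in> Arr C \<Longrightarrow> Cod C f \<in> Obj C"
    and id_hom: "X \<in> Obj C \<Longrightarrow> \<i> X \<in> hom C X X"
    and Comp_hom: "f \<in> hom C X Y \<Longrightarrow> g \<in> hom C Y Z \<Longrightarrow> g \<cdot> f \<in> hom C X Z"
    and Comp_id_left: "f \<in> hom C X Y \<Longrightarrow> \<i> Y \<cdot> f = f"
    and Comp_id_right: "f \<in> hom C X Y \<Longrightarrow> f \<cdot> \<i> X = f"
    and Comp_assoc: "f \<in> hom C W X \<Longrightarrow> g \<in> hom C X Y \<Longrightarrow> h \<in> hom C Y Z
      \<Longrightarrow> (h \<cdot> g) \<cdot> f = h \<cdot> (g \<cdot> f)"

definition inverse_arrows :: "('o, 'm, 'z) cat_scheme \<Rightarrow> 'm \<Rightarrow> 'm \<Rightarrow> bool"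
  where "inverse_arrows C f g \<longleftrightarrow>
    f \<in> Arr C \<and> g \<in> hom C (Cod C f) (Dom C f) \<and>
    g \<cdot>\<^bsub>C\<^esub> f = \<i>\<^bsub>C\<^esub> (Dom C f) \<and> f \<cdot>\<^bsub>C\<^esub> g = \<i>\<^bsub>C\<^esub> (Cod C f)"

definition is_iso :: "('o, 'm, 'z) cat_scheme \<Rightarrow> 'm \<Rightarrow> bool"
  where "is_iso C f \<longleftrightarrow> (\<exists>g. inverse_arrows C f g)"

definition inv_arr :: "('o, 'm, 'z) cat_scheme \<Rightarrow> 'm \<Rightarrow> 'm" ("\<i>\<n>\<v>\<index>")
  where "inv_arr C f = (THE g. inverse_arrows C f g)"

record ('o1, 'm1, 'o2, 'm2) functr =
  fobj :: "'o1 \<Rightarrow> 'o2"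
  farr :: "'m1 \<Rightarrow> 'm2"

definition is_functor ::
    "('o1, 'm1, 'z1) cat_scheme \<Rightarrow> ('o2, 'm2, 'z2) cat_scheme \<Rightarrow> ('o1, 'm1, 'o2, 'm2) functr \<Rightarrow> bool"
  where "is_functor C D F \<longleftrightarrow> category C \<and> category D \<and>
    (\<forall>X \<in> Obj C. fobj F X \<in> Obj D) \<and>
    (\<forall>f \<in> Arr C. farr F f \<in> hom D (fobj F (Dom C f)) (fobj F (Cod C f))) \<and>
    (\<forall>X \<in> Obj C. farr F (\<i>\<^bsub>C\<^esub> X) = \<i>\<^bsub>D\<^esub> (fobj F X)) \<and>
    (\<forall>f \<in> Arr C. \<forall>g \<in> Arr C. Cod C f = Dom C g \<longrightarrow>
       farr F (g \<cdot>\<^bsub>C\<^esub> f) = farr F g \<cdot>\<^bsub>D\<^esub> farr F f)"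

definition id_functor :: "('o, 'm, 'o, 'm) functr"
  where "id_functor = \<lparr>fobj = (\<lambda>X. X), farr = (\<lambda>f. f)\<rparr>"

definition comp_functor ::
    "('o2, 'm2, 'o3, 'm3) functr \<Rightarrow> ('o1, 'm1, 'o2, 'm2) functr \<Rightarrow> ('o1, 'm1, 'o3, 'm3) functr"
  where "comp_functor G F = \<lparr>fobj = fobj G \<circ> fobj F, farr = farr G \<circ> farr F\<rparr>"

text \<open>Functors are total functions, so equality of functors is only meaningful on the
  objects and arrows of the source category.\<close>

definition functor_eq ::
    "('o1, 'm1, 'z1) cat_scheme \<Rightarrow> ('o1, 'm1, 'o2, 'm2) functr \<Rightarrow> ('o1, 'm1, 'o2, 'm2) functr \<Rightarrow> bool"
  where "functor_eq C F G \<longleftrightarrow>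
    (\<forall>X \<in> Obj C. fobj F X = fobj G X) \<and> (\<forall>f \<in> Arr C. farr F f = farr G f)"

definition isomorphism_of_categories ::
    "('o1, 'm1, 'z1) cat_scheme \<Rightarrow> ('o2, 'm2, 'z2) cat_scheme \<Rightarrow> ('o1, 'm1, 'o2, 'm2) functr \<Rightarrow> bool"
  where "isomorphism_of_categories C D F \<longleftrightarrow> is_functor C D F \<and>
    (\<exists>G. is_functor D C G \<and>
      functor_eq C (comp_functor G F) id_functor \<and>
      functor_eq D (comp_functor F G) id_functor)"

definition full_subcategory ::
    "('o, 'm, 'z) cat_scheme \<Rightarrow> ('o \<Rightarrow> bool) \<Rightarrow> ('o, 'm, 'z) cat_scheme"
  where "full_subcategory C Q = C\<lparr>
    Obj := {X \<in> Obj C. Q X},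
    Arr := {f \<in> Arr C. Q (Dom C f) \<and> Q (Cod C f)}\<rparr>"


section \<open>Locally presentable categories\<close>

text \<open>The type \<open>'u\<close> fixes the universe: a set, of whatever type, is small if its cardinality
  is strictly below that of \<open>'u\<close>. For \<open>'u\<close> of inaccessible cardinality this is smallness with
  respect to a Grothendieck universe. Inaccessibility is not imposed, so that statements
  about locally presentable categories hold for every choice of size bound. Every small category
  is isomorphic to one whose objects and arrows are elements of \<open>'u\<close>, so index categories
  are taken of type \<open>('u, 'u) cat\<close>.\<close>

definition small :: "'u itself \<Rightarrow> 'a set \<Rightarrow> bool"
  where "small U S \<longleftrightarrow> |S| <o |UNIV :: 'u set|"

definition small_category :: "('u, 'u) cat \<Rightarrow> bool"
  where "small_category J \<longleftrightarrow>
    category J \<and> small TYPE('u) (Obj J) \<and> small TYPE('u) (Arr J)"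

definition locally_small :: "'u itself \<Rightarrow> ('o, 'm, 'z) cat_scheme \<Rightarrow> bool"
  where "locally_small U C \<longleftrightarrow> (\<forall>X \<in> Obj C. \<forall>Y \<in> Obj C. small U (hom C X Y))"

definition cocone ::
    "('i, 'j, 'y) cat_scheme \<Rightarrow> ('o, 'm, 'z) cat_scheme \<Rightarrow> ('i, 'j, 'o, 'm) functr
      \<Rightarrow> 'o \<Rightarrow> ('i \<Rightarrow> 'm) \<Rightarrow> bool"
  where "cocone J C D L \<kappa> \<longleftrightarrow> L \<in> Obj C \<and>
    (\<forall>i \<in> Obj J. \<kappa> i \<in> hom C (fobj D i) L) \<and>
    (\<forall>u \<in> Arr J. \<kappa> (Cod J u) \<cdot>\<^bsub>C\<^esub> farr D u = \<kappa> (Dom J u))"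

definition colimit ::
    "('i, 'j, 'y) cat_scheme \<Rightarrow> ('o, 'm, 'z) cat_scheme \<Rightarrow> ('i, 'j, 'o, 'm) functr
      \<Rightarrow> 'o \<Rightarrow> ('i \<Rightarrow> 'm) \<Rightarrow> bool"
  where "colimit J C D L \<kappa> \<longleftrightarrow> cocone J C D L \<kappa> \<and>
    (\<forall>M \<tau>. cocone J C D M \<tau> \<longrightarrow>
      (\<exists>!h. h \<in> hom C L M \<and> (\<forall>i \<in> Obj J. h \<cdot>\<^bsub>C\<^esub> \<kappa> i = \<tau> i)))"

definition cocomplete :: "'u itself \<Rightarrow> ('o, 'm, 'z) cat_scheme \<Rightarrow> bool"
  where "cocomplete U C \<longleftrightarrow>
    (\<forall>(J :: ('u, 'u) cat) D. small_category J \<and> is_functor J C D \<longrightarrow> (\<exists>L \<kappa>. colimit J C D L \<kappa>))"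

definition small_regular_cardinal :: "'u rel \<Rightarrow> bool"
  where "small_regular_cardinal r \<longleftrightarrow> Cinfinite r \<and> regularCard r \<and> r <o |UNIV :: 'u set|"

text \<open>A category is \<open>r\<close>-filtered if every diagram in it with fewer than \<open>r\<close> arrows has a cocone.\<close>

definition filtered :: "'u rel \<Rightarrow> ('u, 'u) cat \<Rightarrow> bool"
  where "filtered r J \<longleftrightarrow> category J \<and>
    (\<forall>(K :: ('u, 'u) cat) D. is_functor K J D \<and> |Arr K| <o r \<longrightarrow> (\<exists>L \<kappa>. cocone K J D L \<kappa>))"

text \<open>\<open>hom C X -\<close> preserves the colimit \<open>\<kappa>\<close>: the colimit in sets of \<open>i \<mapsto> hom C X (D i)\<close> is the
  disjoint union \<open>S\<close> modulo the equivalence relation generated by \<open>R\<close>, and its comparison map to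
  \<open>hom C X L\<close> is required to be bijective.\<close>

definition hom_preserves_colimit ::
    "('i, 'j, 'y) cat_scheme \<Rightarrow> ('o, 'm, 'z) cat_scheme \<Rightarrow> 'o \<Rightarrow> ('i, 'j, 'o, 'm) functr
      \<Rightarrow> 'o \<Rightarrow> ('i \<Rightarrow> 'm) \<Rightarrow> bool"
  where "hom_preserves_colimit J C X D L \<kappa> \<longleftrightarrow>
    (let S = Sigma (Obj J) (\<lambda>i. hom C X (fobj D i));
         R = {((Dom J u, g), (Cod J u, farr D u \<cdot>\<^bsub>C\<^esub> g)) | u g.
                u \<in> Arr J \<and> g \<in> hom C X (fobj D (Dom J u))};
         \<phi> = (\<lambda>(i, g). \<kappa> i \<cdot>\<^bsub>C\<^esub> g)
     in \<phi> ` S = hom C X L \<and> (\<forall>s \<in> S. \<forall>t \<in> S. \<phi> s = \<phi> t \<longrightarrow> (s, t) \<in> (R \<union> R\<inverse>)\<^sup>*))"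

definition presentable :: "'u rel \<Rightarrow> ('o, 'm, 'z) cat_scheme \<Rightarrow> 'o \<Rightarrow> bool"
  where "presentable r C X \<longleftrightarrow> X \<in> Obj C \<and>
    (\<forall>(J :: ('u, 'u) cat) D L \<kappa>.
       small_category J \<and> filtered r J \<and> is_functor J C D \<and> colimit J C D L \<kappa> \<longrightarrow>
       hom_preserves_colimit J C X D L \<kappa>)"

definition locally_presentable :: "'u itself \<Rightarrow> ('o, 'm, 'z) cat_scheme \<Rightarrow> bool"
  where "locally_presentable U C \<longleftrightarrow> category C \<and> locally_small U C \<and> cocomplete U C \<and>
    (\<exists>r :: 'u rel. small_regular_cardinal r \<and>
      (\<exists>\<G> \<subseteq> Obj C. small U \<G> \<and> (\<forall>X \<in> \<G>. presentable r C X) \<and>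
        (\<forall>X \<in> Obj C. \<exists>(J :: ('u, 'u) cat) D \<kappa>.
           small_category J \<and> filtered r J \<and> is_functor J C D \<and>
           fobj D ` Obj J \<subseteq> \<G> \<and> colimit J C D X \<kappa>)))"


section \<open>Braided monoidal closed categories\<close>

text \<open>Arrows \<open>\<a> X Y Z : (X \<otimes> Y) \<otimes> Z \<rightarrow> X \<otimes> (Y \<otimes> Z)\<close>, \<open>\<l> X : I \<otimes> X \<rightarrow> X\<close>, \<open>\<r> X : X \<otimes> I \<rightarrow> X\<close>,
  \<open>\<c> X Y : X \<otimes> Y \<rightarrow> Y \<otimes> X\<close> and \<open>ev X Y : [X, Y] \<otimes> X \<rightarrow> Y\<close>. The tensor product of arrows
  is written \<open>\<otimes>\<^sub>a\<close>.\<close>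

record ('o, 'm) monoidal_cat = "('o, 'm) cat" +
  tens_obj :: "'o \<Rightarrow> 'o \<Rightarrow> 'o" (infixr "\<otimes>\<index>" 60)
  tens_arr :: "'m \<Rightarrow> 'm \<Rightarrow> 'm" (infixr "\<otimes>\<^sub>a\<index>" 60)
  unit_obj :: 'o ("\<I>\<index>")
  assoc :: "'o \<Rightarrow> 'o \<Rightarrow> 'o \<Rightarrow> 'm" ("\<a>\<index>")
  lunit :: "'o \<Rightarrow> 'm" ("\<l>\<index>")
  runit :: "'o \<Rightarrow> 'm" ("\<r>\<index>")

record ('o, 'm) braided_closed_cat = "('o, 'm) monoidal_cat" +
  braid :: "'o \<Rightarrow> 'o \<Rightarrow> 'm" ("\<c>\<index>")
  ihom :: "'o \<Rightarrow> 'o \<Rightarrow> 'o"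
  ev :: "'o \<Rightarrow> 'o \<Rightarrow> 'm"

locale monoidal_category = category V
  for V :: "('o, 'm, 'z) monoidal_cat_scheme" (structure) +
  assumes unit_Obj: "\<I> \<in> Obj V"
    and tens_Obj: "X \<in> Obj V \<Longrightarrow> Y \<in> Obj V \<Longrightarrow> X \<otimes> Y \<in> Obj V"
    and tens_hom: "f \<in> hom V X X' \<Longrightarrow> g \<in> hom V Y Y' \<Longrightarrow> f \<otimes>\<^sub>a g \<in> hom V (X \<otimes> Y) (X' \<otimes> Y')"
    and tens_id: "X \<in> Obj V \<Longrightarrow> Y \<in> Obj V \<Longrightarrow> \<i> X \<otimes>\<^sub>a \<i> Y = \<i> (X \<otimes> Y)"
    and tens_Comp: "f \<in> hom V X X' \<Longrightarrow> f' \<in> hom V X' X'' \<Longrightarrow> g \<in> hom V Y Y' \<Longrightarrow> g' \<in> hom V Y' Y''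
      \<Longrightarrow> (f' \<cdot> f) \<otimes>\<^sub>a (g' \<cdot> g) = (f' \<otimes>\<^sub>a g') \<cdot> (f \<otimes>\<^sub>a g)"
    and assoc_hom: "X \<in> Obj V \<Longrightarrow> Y \<in> Obj V \<Longrightarrow> Z \<in> Obj V
      \<Longrightarrow> \<a> X Y Z \<in> hom V ((X \<otimes> Y) \<otimes> Z) (X \<otimes> (Y \<otimes> Z))"
    and assoc_iso: "X \<in> Obj V \<Longrightarrow> Y \<in> Obj V \<Longrightarrow> Z \<in> Obj V \<Longrightarrow> is_iso V (\<a> X Y Z)"
    and assoc_natural: "f \<in> hom V X X' \<Longrightarrow> g \<in> hom V Y Y' \<Longrightarrow> h \<in> hom V Z Z'
      \<Longrightarrow> \<a> X' Y' Z' \<cdot> ((f \<otimes>\<^sub>a g) \<otimes>\<^sub>a h) = (f \<otimes>\<^sub>a (g \<otimes>\<^sub>a h)) \<cdot> \<a> X Y Z"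
    and lunit_hom: "X \<in> Obj V \<Longrightarrow> \<l> X \<in> hom V (\<I> \<otimes> X) X"
    and lunit_iso: "X \<in> Obj V \<Longrightarrow> is_iso V (\<l> X)"
    and lunit_natural: "f \<in> hom V X X' \<Longrightarrow> \<l> X' \<cdot> (\<i> \<I> \<otimes>\<^sub>a f) = f \<cdot> \<l> X"
    and runit_hom: "X \<in> Obj V \<Longrightarrow> \<r> X \<in> hom V (X \<otimes> \<I>) X"
    and runit_iso: "X \<in> Obj V \<Longrightarrow> is_iso V (\<r> X)"
    and runit_natural: "f \<in> hom V X X' \<Longrightarrow> \<r> X' \<cdot> (f \<otimes>\<^sub>a \<i> \<I>) = f \<cdot> \<r> X"
    and pentagon: "W \<in> Obj V \<Longrightarrow> X \<in> Obj V \<Longrightarrow> Y \<in> Obj V \<Longrightarrow> Z \<in> Obj V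
      \<Longrightarrow> (\<i> W \<otimes>\<^sub>a \<a> X Y Z) \<cdot> \<a> W (X \<otimes> Y) Z \<cdot> (\<a> W X Y \<otimes>\<^sub>a \<i> Z)
        = \<a> W X (Y \<otimes> Z) \<cdot> \<a> (W \<otimes> X) Y Z"
    and triangle: "X \<in> Obj V \<Longrightarrow> Y \<in> Obj V
      \<Longrightarrow> (\<i> X \<otimes>\<^sub>a \<l> Y) \<cdot> \<a> X \<I> Y = \<r> X \<otimes>\<^sub>a \<i> Y"

locale braided_monoidal_category = monoidal_category V
  for V :: "('o, 'm, 'z) braided_closed_cat_scheme" (structure) +
  assumes braid_hom: "X \<in> Obj V \<Longrightarrow> Y \<in> Obj V \<Longrightarrow> \<c> X Y \<in> hom V (X \<otimes> Y) (Y \<otimes> X)"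
    and braid_iso: "X \<in> Obj V \<Longrightarrow> Y \<in> Obj V \<Longrightarrow> is_iso V (\<c> X Y)"
    and braid_natural: "f \<in> hom V X X' \<Longrightarrow> g \<in> hom V Y Y'
      \<Longrightarrow> \<c> X' Y' \<cdot> (f \<otimes>\<^sub>a g) = (g \<otimes>\<^sub>a f) \<cdot> \<c> X Y"
    and hexagon1: "X \<in> Obj V \<Longrightarrow> Y \<in> Obj V \<Longrightarrow> Z \<in> Obj V
      \<Longrightarrow> \<a> Y Z X \<cdot> \<c> X (Y \<otimes> Z) \<cdot> \<a> X Y Z
        = (\<i> Y \<otimes>\<^sub>a \<c> X Z) \<cdot> \<a> Y X Z \<cdot> (\<c> X Y \<otimes>\<^sub>a \<i> Z)"
    and hexagon2: "X \<in> Obj V \<Longrightarrow> Y \<in> Obj V \<Longrightarrow> Z \<in> Obj V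
      \<Longrightarrow> \<i>\<n>\<v> (\<a> Z X Y) \<cdot> \<c> (X \<otimes> Y) Z \<cdot> \<i>\<n>\<v> (\<a> X Y Z)
        = (\<c> X Z \<otimes>\<^sub>a \<i> Y) \<cdot> \<i>\<n>\<v> (\<a> X Z Y) \<cdot> (\<i> X \<otimes>\<^sub>a \<c> Y Z)"

text \<open>\<open>ihom V X -\<close> is right adjoint to \<open>- \<otimes> X\<close>, with counit \<open>ev V X\<close>.\<close>

locale braided_monoidal_closed_category = braided_monoidal_category V
  for V :: "('o, 'm, 'z) braided_closed_cat_scheme" (structure) +
  assumes ihom_Obj: "X \<in> Obj V \<Longrightarrow> Y \<in> Obj V \<Longrightarrow> ihom V X Y \<in> Obj V"
    and ev_hom: "X \<in> Obj V \<Longrightarrow> Y \<in> Obj V \<Longrightarrow> ev V X Y \<in> hom V (ihom V X Y \<otimes> X) Y"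
    and ev_universal: "X \<in> Obj V \<Longrightarrow> Y \<in> Obj V \<Longrightarrow> Z \<in> Obj V \<Longrightarrow> f \<in> hom V (Z \<otimes> X) Y
      \<Longrightarrow> \<exists>!g. g \<in> hom V Z (ihom V X Y) \<and> ev V X Y \<cdot> (g \<otimes>\<^sub>a \<i> X) = f"

definition curry_arr ::
    "('o, 'm, 'z) braided_closed_cat_scheme \<Rightarrow> 'o \<Rightarrow> 'o \<Rightarrow> 'o \<Rightarrow> 'm \<Rightarrow> 'm"
  where "curry_arr V Z X Y f =
    (THE g. g \<in> hom V Z (ihom V X Y) \<and> ev V X Y \<cdot>\<^bsub>V\<^esub> (g \<otimes>\<^sub>a\<^bsub>V\<^esub> \<i>\<^bsub>V\<^esub> X) = f)"

text \<open>\<open>[f, B]\<close> for \<open>f : X \<rightarrow> Y\<close>, an arrow \<open>[Y, B] \<rightarrow> [X, B]\<close>.\<close>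

definition ihom_precomp ::
    "('o, 'm, 'z) braided_closed_cat_scheme \<Rightarrow> 'o \<Rightarrow> 'm \<Rightarrow> 'm"
  where "ihom_precomp V B f = (let X = Dom V f; Y = Cod V f in
    curry_arr V (ihom V Y B) X B (ev V Y B \<cdot>\<^bsub>V\<^esub> (\<i>\<^bsub>V\<^esub> (ihom V Y B) \<otimes>\<^sub>a\<^bsub>V\<^esub> f)))"

text \<open>The interchange \<open>(W \<otimes> X) \<otimes> (Y \<otimes> Z) \<rightarrow> (W \<otimes> Y) \<otimes> (X \<otimes> Z)\<close>, via \<open>\<c> X Y\<close>.\<close>

definition interchange ::
    "('o, 'm, 'z) braided_closed_cat_scheme \<Rightarrow> 'o \<Rightarrow> 'o \<Rightarrow> 'o \<Rightarrow> 'o \<Rightarrow> 'm"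
  where "interchange V W X Y Z =
    \<i>\<n>\<v> (\<a> W Y (X \<otimes> Z)) \<cdot>
    (\<i> W \<otimes>\<^sub>a (\<a> Y X Z \<cdot> (\<c> X Y \<otimes>\<^sub>a \<i> Z) \<cdot> \<i>\<n>\<v> (\<a> X Y Z))) \<cdot>
    \<a> W X (Y \<otimes> Z)" for V (structure)

text \<open>\<open>Y\<close> is a left dual of \<open>X\<close>, with evaluation \<open>e\<close> and coevaluation \<open>n\<close>. When \<open>V\<close> is braided,
  left duals are also right duals, so there is no choice of side.\<close>

definition has_dual :: "('o, 'm, 'z) monoidal_cat_scheme \<Rightarrow> 'o \<Rightarrow> bool"
  where "has_dual V X \<longleftrightarrow> X \<in> Obj V \<and>
    (\<exists>Y \<in> Obj V. \<exists>e \<in> hom V (Y \<otimes> X) \<I>. \<exists>n \<in> hom V \<I> (X \<otimes> Y).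
      \<r> X \<cdot> (\<i> X \<otimes>\<^sub>a e) \<cdot> \<a> X Y X \<cdot> (n \<otimes>\<^sub>a \<i> X) \<cdot> \<i>\<n>\<v> (\<l> X) = \<i> X \<and>
      \<l> Y \<cdot> (e \<otimes>\<^sub>a \<i> Y) \<cdot> \<i>\<n>\<v> (\<a> Y X Y) \<cdot> (\<i> Y \<otimes>\<^sub>a n) \<cdot> \<i>\<n>\<v> (\<r> Y) = \<i> Y)"
    for V (structure)


section \<open>Monoids and comonoids\<close>

record ('o, 'm) mon =
  mon_obj :: 'o
  mon_mult :: 'm
  mon_unit :: 'm

record ('o, 'm) comon =
  comon_obj :: 'o
  comon_comult :: 'm
  comon_counit :: 'm

definition is_mon :: "('o, 'm, 'z) monoidal_cat_scheme \<Rightarrow> ('o, 'm) mon \<Rightarrow> bool"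
  where "is_mon V A \<longleftrightarrow> (let X = mon_obj A; \<mu> = mon_mult A; \<iota> = mon_unit A in
    X \<in> Obj V \<and> \<mu> \<in> hom V (X \<otimes> X) X \<and> \<iota> \<in> hom V \<I> X \<and>
    \<mu> \<cdot> (\<mu> \<otimes>\<^sub>a \<i> X) = \<mu> \<cdot> (\<i> X \<otimes>\<^sub>a \<mu>) \<cdot> \<a> X X X \<and>
    \<mu> \<cdot> (\<iota> \<otimes>\<^sub>a \<i> X) = \<l> X \<and>
    \<mu> \<cdot> (\<i> X \<otimes>\<^sub>a \<iota>) = \<r> X)" for V (structure)

definition mon_hom ::
    "('o, 'm, 'z) monoidal_cat_scheme \<Rightarrow> ('o, 'm) mon \<Rightarrow> ('o, 'm) mon \<Rightarrow> 'm set"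
  where "mon_hom V A B = {f \<in> hom V (mon_obj A) (mon_obj B).
    f \<cdot> mon_mult A = mon_mult B \<cdot> (f \<otimes>\<^sub>a f) \<and>
    f \<cdot> mon_unit A = mon_unit B}" for V (structure)

definition is_comon :: "('o, 'm, 'z) monoidal_cat_scheme \<Rightarrow> ('o, 'm) comon \<Rightarrow> bool"
  where "is_comon V C \<longleftrightarrow> (let X = comon_obj C; \<delta> = comon_comult C; \<epsilon> = comon_counit C in
    X \<in> Obj V \<and> \<delta> \<in> hom V X (X \<otimes> X) \<and> \<epsilon> \<in> hom V X \<I> \<and>
    \<a> X X X \<cdot> (\<delta> \<otimes>\<^sub>a \<i> X) \<cdot> \<delta> = (\<i> X \<otimes>\<^sub>a \<delta>) \<cdot> \<delta> \<and>
    \<l> X \<cdot> (\<epsilon> \<otimes>\<^sub>a \<i> X) \<cdot> \<delta> = \<i> X \<and>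
    \<r> X \<cdot> (\<i> X \<otimes>\<^sub>a \<epsilon>) \<cdot> \<delta> = \<i> X)" for V (structure)

definition comon_hom ::
    "('o, 'm, 'z) monoidal_cat_scheme \<Rightarrow> ('o, 'm) comon \<Rightarrow> ('o, 'm) comon \<Rightarrow> 'm set"
  where "comon_hom V C D = {f \<in> hom V (comon_obj C) (comon_obj D).
    comon_comult D \<cdot> f = (f \<otimes>\<^sub>a f) \<cdot> comon_comult C \<and>
    comon_counit D \<cdot> f = comon_counit C}" for V (structure)

text \<open>The convolution monoid \<open>[C, B]\<close>. Its multiplication is the transpose of
  \<open>([C,B] \<otimes> [C,B]) \<otimes> C \<rightarrow> ([C,B] \<otimes> [C,B]) \<otimes> (C \<otimes> C) \<rightarrow> ([C,B] \<otimes> C) \<otimes> ([C,B] \<otimes> C) \<rightarrow> B \<otimes> B \<rightarrow> B\<close>,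
  its unit the transpose of \<open>I \<otimes> C \<rightarrow> C \<rightarrow> I \<rightarrow> B\<close>.\<close>

definition convolution_mon ::
    "('o, 'm, 'z) braided_closed_cat_scheme \<Rightarrow> ('o, 'm) comon \<Rightarrow> ('o, 'm) mon \<Rightarrow> ('o, 'm) mon"
  where "convolution_mon V C B =
    (let X = comon_obj C; Y = mon_obj B; H = ihom V X Y in
     \<lparr>mon_obj = H,
      mon_mult = curry_arr V (H \<otimes> H) X Y
        (mon_mult B \<cdot> (ev V X Y \<otimes>\<^sub>a ev V X Y) \<cdot> interchange V H H X X \<cdot>
         (\<i> (H \<otimes> H) \<otimes>\<^sub>a comon_comult C)),
      mon_unit = curry_arr V \<I> X Y (mon_unit B \<cdot> comon_counit C \<cdot> \<l> X)\<rparr>)" for V (structure)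

text \<open>\<open>P\<close> is a universal measuring comonoid \<open>P(A,B)\<close>: there are bijections
  \<open>\<Theta> C : Mon(V)(A, [C, B]) \<cong> Comon(V)(C, P)\<close>, natural in the comonoid \<open>C\<close>. This determines
  \<open>P\<close> up to isomorphism.\<close>

definition universal_measuring_comon ::
    "('o, 'm, 'z) braided_closed_cat_scheme \<Rightarrow> ('o, 'm) mon \<Rightarrow> ('o, 'm) mon \<Rightarrow> ('o, 'm) comon \<Rightarrow> bool"
  where "universal_measuring_comon V A B P \<longleftrightarrow> is_comon V P \<and>
    (\<exists>\<Theta>. (\<forall>C. is_comon V C \<longrightarrow>
            bij_betw (\<Theta> C) (mon_hom V A (convolution_mon V C B)) (comon_hom V C P)) \<and>
         (\<forall>C C' g f. is_comon V C \<and> is_comon V C' \<and> g \<in> comon_hom V C' C \<and>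
            f \<in> mon_hom V A (convolution_mon V C B) \<longrightarrow>
            \<Theta> C' (ihom_precomp V (mon_obj B) g \<cdot> f) = \<Theta> C f \<cdot> g))" for V (structure)


section \<open>Categories over V\<close>

text \<open>The category whose objects are the pairs \<open>(X, s)\<close> in \<open>S\<close>, an object of \<open>V\<close> with a structure
  arrow, and whose arrows \<open>x \<rightarrow> y\<close> are the arrows \<open>f\<close> of \<open>V\<close> between the underlying objects
  with \<open>M x f y\<close>. An arrow is stored together with its source and target.\<close>

definition category_over ::
    "('o, 'm, 'z) cat_scheme \<Rightarrow> ('o \<times> 'm) set \<Rightarrow> ('o \<times> 'm \<Rightarrow> 'm \<Rightarrow> 'o \<times> 'm \<Rightarrow> bool)
      \<Rightarrow> ('o \<times> 'm, ('o \<times> 'm) \<times> 'm \<times> ('o \<times> 'm)) cat"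
  where "category_over V S M = \<lparr>
    Obj = S,
    Arr = {(x, f, y). x \<in> S \<and> y \<in> S \<and> f \<in> hom V (fst x) (fst y) \<and> M x f y},
    Dom = (\<lambda>(x, f, y). x),
    Cod = (\<lambda>(x, f, y). y),
    id_arr = (\<lambda>x. (x, \<i>\<^bsub>V\<^esub> (fst x), x)),
    Comp = (\<lambda>(y, g, z) (x, f, y'). (x, g \<cdot>\<^bsub>V\<^esub> f, z))\<rparr>"

definition forgetful :: "('o \<times> 'm, ('o \<times> 'm) \<times> 'm \<times> ('o \<times> 'm), 'o, 'm) functr"
  where "forgetful = \<lparr>fobj = fst, farr = (\<lambda>(x, f, y). f)\<rparr>"

definition dualizable_objects ::
    "('o, 'm, 'z) monoidal_cat_scheme \<Rightarrow> ('o \<times> 'm, ('o \<times> 'm) \<times> 'm \<times> ('o \<times> 'm)) cat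
      \<Rightarrow> ('o \<times> 'm, ('o \<times> 'm) \<times> 'm \<times> ('o \<times> 'm)) cat"
  where "dualizable_objects V C = full_subcategory C (\<lambda>x. has_dual V (fobj forgetful x))"

definition right_comodules ::
    "('o, 'm, 'z) monoidal_cat_scheme \<Rightarrow> ('o, 'm) comon
      \<Rightarrow> ('o \<times> 'm, ('o \<times> 'm) \<times> 'm \<times> ('o \<times> 'm)) cat"
  where "right_comodules V C = (let P = comon_obj C; \<delta> = comon_comult C; \<epsilon> = comon_counit C in
    category_over V
      {(X, \<rho>). X \<in> Obj V \<and> \<rho> \<in> hom V X (X \<otimes> P) \<and>
         \<a> X P P \<cdot> (\<rho> \<otimes>\<^sub>a \<i> P) \<cdot> \<rho> = (\<i> X \<otimes>\<^sub>a \<delta>) \<cdot> \<rho> \<and>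
         \<r> X \<cdot> (\<i> X \<otimes>\<^sub>a \<epsilon>) \<cdot> \<rho> = \<i> X}
      (\<lambda>(X, \<rho>) f (X', \<rho>'). (f \<otimes>\<^sub>a \<i> P) \<cdot> \<rho> = \<rho>' \<cdot> f))" for V (structure)

text \<open>\<open>\<^sup>AV\<^sub>B\<close>, with the structure arrows \<open>\<psi> : A \<otimes> X \<rightarrow> X \<otimes> B\<close>; the associators and unitors suppressed in
  the strict notation are written out.\<close>

definition AV_B ::
    "('o, 'm, 'z) monoidal_cat_scheme \<Rightarrow> ('o, 'm) mon \<Rightarrow> ('o, 'm) mon
      \<Rightarrow> ('o \<times> 'm, ('o \<times> 'm) \<times> 'm \<times> ('o \<times> 'm)) cat"
  where "AV_B V A B = (let a = mon_obj A; b = mon_obj B in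
    category_over V
      {(X, \<psi>). X \<in> Obj V \<and> \<psi> \<in> hom V (a \<otimes> X) (X \<otimes> b) \<and>
         (\<i> X \<otimes>\<^sub>a mon_mult B) \<cdot> \<a> X b b \<cdot> (\<psi> \<otimes>\<^sub>a \<i> b) \<cdot> \<i>\<n>\<v> (\<a> a X b) \<cdot> (\<i> a \<otimes>\<^sub>a \<psi>) \<cdot> \<a> a a X
           = \<psi> \<cdot> (mon_mult A \<otimes>\<^sub>a \<i> X) \<and>
         \<psi> \<cdot> (mon_unit A \<otimes>\<^sub>a \<i> X) \<cdot> \<i>\<n>\<v> (\<l> X) = (\<i> X \<otimes>\<^sub>a mon_unit B) \<cdot> \<i>\<n>\<v> (\<r> X)}
      (\<lambda>(X, \<psi>) f (X', \<psi>'). (f \<otimes>\<^sub>a \<i> b) \<cdot> \<psi> = \<psi>' \<cdot> (\<i> a \<otimes>\<^sub>a f)))" for V (structure)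

end

theory Submission
  imports Defs
begin


text \<open>
  For a comodule \<open>(X, \<rho>)\<close> over \<open>P = P(A,B)\<close>, with universal measuring \<open>t : A \<otimes> P \<rightarrow> B\<close>, let
  \<open>\<psi> : A \<otimes> X \<rightarrow> X \<otimes> B\<close> be \<open>\<rho>\<close> followed by the braiding of \<open>A\<close> past \<open>X\<close> and by \<open>t\<close>. The axioms of a
  measuring are exactly what makes \<open>\<psi>\<close> an object of \<open>\<^sup>AV\<^sub>B\<close>. To go back, let \<open>f : X \<rightarrow> X'\<close> be an arrow
  between dualizable objects and let \<open>D\<close> be the pushout of \<open>X\<^sup>* \<otimes> X\<close> and \<open>X'\<^sup>* \<otimes> X'\<close> under
  \<open>X'\<^sup>* \<otimes> X\<close>, that is, the coend over \<open>f\<close> of \<open>X\<^sup>* \<otimes> X\<close>. It carries universal coactions on \<open>X\<close> and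
  \<open>X'\<close> for which \<open>f\<close> is a comodule map. By Tannaka reconstruction \<open>D\<close> is a comonoid, its comonoid maps
  to \<open>P\<close> are the pairs of \<open>P\<close>-coactions compatible with \<open>f\<close>, and its measurings \<open>A \<otimes> D \<rightarrow> B\<close> are the
  pairs of \<open>\<^sup>AV\<^sub>B\<close>-structures compatible with \<open>f\<close>; the universal property of \<open>P\<close> identifies the two.
  Taking \<open>f = id\<close> gives the bijection on objects, and arbitrary \<open>f\<close> gives fullness, for which
  the comonoids \<open>X\<^sup>* \<otimes> X\<close> alone would not suffice.
\<close>

text \<open>Compatibility of \<open>f\<close> with two coactions is an equality of arrows
  \<open>X \<rightarrow> X' \<otimes> P\<close>, that is, of two arrows into \<open>P\<close> from
  the dual of \<open>X'\<close> tensored with \<open>X\<close>. That object is not a comonoid, so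
  the universal property of \<open>P\<close> says nothing about such arrows. Gluing the two
  comonoids along it repairs this: a single comonoid map out of \<open>D\<close> encodes both
  coactions together with their compatibility. Since the structures \<open>\<psi>\<close> involve
  \<open>A\<close> as well, the coactions of \<open>D\<close> must be universal with a parameter
  \<open>R\<close> tensored on the right: \<open>R\<close> is the unit object for the comonoid
  structure and for comonoid maps, \<open>A\<close> for the existence and uniqueness of a measuring,
  and \<open>A \<otimes> A\<close> for its multiplicativity. The pushout \<open>D\<close> has this
  parametrised property because \<open>- \<otimes> R\<close> has the right adjoint
  \<open>[R, -]\<close>. Local presentability supplies the pushout. In all these comparisons the
  braiding moves copies of \<open>A\<close> behind \<open>X\<close> and behind
  \<open>D\<close>.\<close>

lemma in_hom_iff [simp]: "f \<in> hom C X Y \<longleftrightarrow> f \<in> Arr C \<and> Dom C f = X \<and> Cod C f = Y"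
  by (auto simp: hom_def)

section \<open>Coherence in monoidal categories\<close>

context category
begin

lemma id_typing [simp]:
  assumes "X \<in> Obj C"
  shows "\<i> X \<in> Arr C" "Dom C (\<i> X) = X" "Cod C (\<i> X) = X"
  using id_hom[OF assms] by auto

lemma Dom_Cod_Obj [simp]: "f \<in> Arr C \<Longrightarrow> Dom C f \<in> Obj C" "f \<in> Arr C \<Longrightarrow> Cod C f \<in> Obj C"
  by (auto intro: Dom_Obj Cod_Obj)

lemma Comp_typing [simp]:
  assumes "f \<in> Arr C" "g \<in> Arr C" "Cod C f = Dom C g"
  shows "g \<cdot> f \<in> Arr C" "Dom C (g \<cdot> f) = Dom C f" "Cod C (g \<cdot> f) = Cod C g"
  using Comp_hom[of f "Dom C f" "Dom C g" g "Cod C g"] assms by auto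

text \<open>As a simp rule this makes right-nested composites the normal form. Proofs that need
  another bracketing state it in an explicit step or delete this rule.\<close>

lemma Comp_assoc' [simp]:
  assumes "f \<in> Arr C" "g \<in> Arr C" "h \<in> Arr C" "Cod C f = Dom C g" "Cod C g = Dom C h"
  shows "(h \<cdot> g) \<cdot> f = h \<cdot> (g \<cdot> f)"
  using Comp_assoc[of f "Dom C f" "Dom C g" g "Dom C h" h "Cod C h"] assms by auto

lemma Comp_id' [simp]:
  "f \<in> Arr C \<Longrightarrow> Cod C f = Y \<Longrightarrow> \<i> Y \<cdot> f = f"
  "f \<in> Arr C \<Longrightarrow> Dom C f = X \<Longrightarrow> f \<cdot> \<i> X = f"
  using Comp_id_left[of f "Dom C f" Y] Comp_id_right[of f X "Cod C f"] by auto

text \<open>\<open>inv_arr\<close> is a definite description, so inverses must first be shown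
  unique: \<open>g' = g' \<cdot> (f \<cdot> g) = (g' \<cdot> f) \<cdot> g = g\<close>.\<close>

lemma inv_arr_inverse:
  assumes "is_iso C f"
  shows "inverse_arrows C f (\<i>\<n>\<v> f)"
proof -
  obtain g where g: "inverse_arrows C f g" using assms by (auto simp: is_iso_def)
  have "g' = g" if g': "inverse_arrows C f g'" for g'
  proof -
    have "g' = g' \<cdot> (f \<cdot> g)"
      using g g' by (simp add: inverse_arrows_def)
    also have "\<dots> = (g' \<cdot> f) \<cdot> g"
      using g g' by (intro Comp_assoc'[symmetric]) (auto simp: inverse_arrows_def)
    also have "\<dots> = g"
      using g g' by (simp add: inverse_arrows_def)
    finally show ?thesis .
  qed
  then show ?thesis unfolding inv_arr_def using g by (metis theI)
qed

lemma is_iso_Arr: "is_iso C f \<Longrightarrow> f \<in> Arr C"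
  by (auto simp: is_iso_def inverse_arrows_def)

lemma inv_typing [simp]:
  assumes "is_iso C f"
  shows "\<i>\<n>\<v> f \<in> Arr C" "Dom C (\<i>\<n>\<v> f) = Cod C f" "Cod C (\<i>\<n>\<v> f) = Dom C f"
  using inv_arr_inverse[OF assms] by (auto simp: inverse_arrows_def)

lemma inv_cancel [simp]:
  assumes "is_iso C f"
  shows "\<i>\<n>\<v> f \<cdot> f = \<i> (Dom C f)" "f \<cdot> \<i>\<n>\<v> f = \<i> (Cod C f)"
  using inv_arr_inverse[OF assms] by (auto simp: inverse_arrows_def)

lemma inv_cancel_left [simp]:
  assumes "is_iso C f" "g \<in> Arr C"
  shows "Cod C g = Dom C f \<Longrightarrow> \<i>\<n>\<v> f \<cdot> (f \<cdot> g) = g"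
    and "Cod C g = Cod C f \<Longrightarrow> f \<cdot> (\<i>\<n>\<v> f \<cdot> g) = g"
proof -
  note [simp] = is_iso_Arr[OF assms(1)] assms
  show "\<i>\<n>\<v> f \<cdot> (f \<cdot> g) = g" if "Cod C g = Dom C f"
    using that Comp_assoc'[of g f "\<i>\<n>\<v> f"] by (simp del: Comp_assoc')
  show "f \<cdot> (\<i>\<n>\<v> f \<cdot> g) = g" if "Cod C g = Cod C f"
    using that Comp_assoc'[of g "\<i>\<n>\<v> f" f] by (simp del: Comp_assoc')
qed

text \<open>In right-nested form a redex \<open>h \<cdot> g\<close> is hidden inside
  \<open>h \<cdot> (g \<cdot> m)\<close>. Feeding an equation to this lemma by \<open>THEN\<close>
  gives the variant that still matches there.\<close>

lemma extend:
  assumes "h \<cdot> g = h'" "h \<in> Arr C" "g \<in> Arr C" "m \<in> Arr C" "Cod C g = Dom C h" "Cod C m = Dom C g"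
  shows "h \<cdot> (g \<cdot> m) = h' \<cdot> m"
  using assms Comp_assoc'[of m g h] by (simp del: Comp_assoc')

lemma iso_right_cancel:
  assumes "is_iso C k" "f \<in> Arr C" "g \<in> Arr C" "Dom C f = Cod C k" "Dom C g = Cod C k"
    and "f \<cdot> k = g \<cdot> k"
  shows "f = g"
proof -
  note [simp] = is_iso_Arr[OF assms(1)]
  have "(f \<cdot> k) \<cdot> \<i>\<n>\<v> k = (g \<cdot> k) \<cdot> \<i>\<n>\<v> k" using assms(6) by simp
  then show ?thesis using assms(1-5) by simp
qed

lemma iso_left_cancel:
  assumes "is_iso C k" "f \<in> Arr C" "g \<in> Arr C" "Cod C f = Dom C k" "Cod C g = Dom C k"
    and "k \<cdot> f = k \<cdot> g"
  shows "f = g"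
proof -
  have "\<i>\<n>\<v> k \<cdot> (k \<cdot> f) = \<i>\<n>\<v> k \<cdot> (k \<cdot> g)" using assms(6) by simp
  then show ?thesis using assms(1-5) by simp
qed

lemma is_isoI:
  assumes "f \<in> Arr C" "g \<in> Arr C" "Dom C g = Cod C f" "Cod C g = Dom C f"
    and "g \<cdot> f = \<i> (Dom C f)" "f \<cdot> g = \<i> (Cod C f)"
  shows "is_iso C f"
  using assms by (auto simp: is_iso_def inverse_arrows_def)

lemma is_iso_id [simp]: "X \<in> Obj C \<Longrightarrow> is_iso C (\<i> X)"
  by (rule is_isoI[of _ "\<i> X"]) auto

lemma is_iso_inv [simp]:
  assumes "is_iso C f"
  shows "is_iso C (\<i>\<n>\<v> f)"
  using assms is_iso_Arr[OF assms] by (intro is_isoI[of _ f]) auto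

lemma is_iso_Comp [simp]:
  assumes "is_iso C f" "is_iso C g" "Cod C f = Dom C g"
  shows "is_iso C (g \<cdot> f)"
proof -
  note [simp] = assms is_iso_Arr[OF assms(1)] is_iso_Arr[OF assms(2)]
  show ?thesis by (intro is_isoI[of _ "\<i>\<n>\<v> f \<cdot> \<i>\<n>\<v> g"]) auto
qed

end

section \<open>Unit coherence and a rewrite system for associators\<close>

context monoidal_category
begin

lemmas [simp] = unit_Obj tens_Obj tens_id assoc_iso lunit_iso runit_iso

lemma tens_typing [simp]:
  assumes "f \<in> Arr V" "g \<in> Arr V"
  shows "f \<otimes>\<^sub>a g \<in> Arr V" "Dom V (f \<otimes>\<^sub>a g) = Dom V f \<otimes> Dom V g"
    "Cod V (f \<otimes>\<^sub>a g) = Cod V f \<otimes> Cod V g"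
  using tens_hom[of f "Dom V f" "Cod V f" g "Dom V g" "Cod V g"] assms by auto

lemma assoc_typing [simp]:
  assumes "X \<in> Obj V" "Y \<in> Obj V" "Z \<in> Obj V"
  shows "\<a> X Y Z \<in> Arr V" "Dom V (\<a> X Y Z) = (X \<otimes> Y) \<otimes> Z" "Cod V (\<a> X Y Z) = X \<otimes> (Y \<otimes> Z)"
  using assoc_hom[OF assms] by auto

lemma unit_typing [simp]:
  assumes "X \<in> Obj V"
  shows "\<l> X \<in> Arr V" "Dom V (\<l> X) = \<I> \<otimes> X" "Cod V (\<l> X) = X"
    "\<r> X \<in> Arr V" "Dom V (\<r> X) = X \<otimes> \<I>" "Cod V (\<r> X) = X"
  using lunit_hom[OF assms] runit_hom[OF assms] by auto

lemma tens_merge [simp]: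
  assumes "f \<in> Arr V" "f' \<in> Arr V" "g \<in> Arr V" "g' \<in> Arr V"
    and "Cod V f = Dom V f'" "Cod V g = Dom V g'"
  shows "(f' \<otimes>\<^sub>a g') \<cdot> (f \<otimes>\<^sub>a g) = (f' \<cdot> f) \<otimes>\<^sub>a (g' \<cdot> g)"
  using tens_Comp[of f "Dom V f" "Dom V f'" f' "Cod V f'" g "Dom V g" "Dom V g'" g' "Cod V g'"]
    assms by simp

lemma tens_merge_left [simp]:
  assumes "f \<in> Arr V" "f' \<in> Arr V" "g \<in> Arr V" "g' \<in> Arr V" "k \<in> Arr V"
    and "Cod V f = Dom V f'" "Cod V g = Dom V g'" "Cod V k = Dom V f \<otimes> Dom V g"
  shows "(f' \<otimes>\<^sub>a g') \<cdot> ((f \<otimes>\<^sub>a g) \<cdot> k) = ((f' \<cdot> f) \<otimes>\<^sub>a (g' \<cdot> g)) \<cdot> k"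
  using assms Comp_assoc'[of k "f \<otimes>\<^sub>a g" "f' \<otimes>\<^sub>a g'"] by (simp del: Comp_assoc')

lemma assoc_nat:
  assumes "f \<in> Arr V" "g \<in> Arr V" "h \<in> Arr V"
    and "Cod V f = X" "Cod V g = Y" "Cod V h = Z"
  shows "\<a> X Y Z \<cdot> ((f \<otimes>\<^sub>a g) \<otimes>\<^sub>a h) = (f \<otimes>\<^sub>a (g \<otimes>\<^sub>a h)) \<cdot> \<a> (Dom V f) (Dom V g) (Dom V h)"
  using assoc_natural[of f "Dom V f" X g "Dom V g" Y h "Dom V h" Z] assms by simp

lemma assoc_inv_nat:
  assumes "f \<in> Arr V" "g \<in> Arr V" "h \<in> Arr V"
    and "Cod V f = X" "Cod V g = Y" "Cod V h = Z"
  shows "\<i>\<n>\<v> (\<a> X Y Z) \<cdot> (f \<otimes>\<^sub>a (g \<otimes>\<^sub>a h))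
    = ((f \<otimes>\<^sub>a g) \<otimes>\<^sub>a h) \<cdot> \<i>\<n>\<v> (\<a> (Dom V f) (Dom V g) (Dom V h))"
proof -
  have [simp]: "X \<in> Obj V" "Y \<in> Obj V" "Z \<in> Obj V" using assms by auto
  have "\<i>\<n>\<v> (\<a> X Y Z) \<cdot> (f \<otimes>\<^sub>a (g \<otimes>\<^sub>a h)) = \<i>\<n>\<v> (\<a> X Y Z) \<cdot>
      ((f \<otimes>\<^sub>a (g \<otimes>\<^sub>a h)) \<cdot> \<a> (Dom V f) (Dom V g) (Dom V h)) \<cdot>
      \<i>\<n>\<v> (\<a> (Dom V f) (Dom V g) (Dom V h))"
    using assms by simp
  also have "\<dots> = ((f \<otimes>\<^sub>a g) \<otimes>\<^sub>a h) \<cdot> \<i>\<n>\<v> (\<a> (Dom V f) (Dom V g) (Dom V h))"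
    unfolding assoc_nat[OF assms, symmetric] using assms by simp
  finally show ?thesis .
qed

lemma lunit_nat: "f \<in> Arr V \<Longrightarrow> Cod V f = Y \<Longrightarrow> \<l> Y \<cdot> (\<i> \<I> \<otimes>\<^sub>a f) = f \<cdot> \<l> (Dom V f)"
  using lunit_natural[of f "Dom V f" Y] by simp

lemma runit_nat: "f \<in> Arr V \<Longrightarrow> Cod V f = Y \<Longrightarrow> \<r> Y \<cdot> (f \<otimes>\<^sub>a \<i> \<I>) = f \<cdot> \<r> (Dom V f)"
  using runit_natural[of f "Dom V f" Y] by simp

lemma lunit_inv_nat:
  assumes "f \<in> Arr V" "Cod V f = Y"
  shows "\<i>\<n>\<v> (\<l> Y) \<cdot> f = (\<i> \<I> \<otimes>\<^sub>a f) \<cdot> \<i>\<n>\<v> (\<l> (Dom V f))"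
proof -
  have [simp]: "Y \<in> Obj V" using assms by auto
  have "\<i>\<n>\<v> (\<l> Y) \<cdot> f = \<i>\<n>\<v> (\<l> Y) \<cdot> (f \<cdot> \<l> (Dom V f)) \<cdot> \<i>\<n>\<v> (\<l> (Dom V f))" using assms by simp
  also have "\<dots> = (\<i> \<I> \<otimes>\<^sub>a f) \<cdot> \<i>\<n>\<v> (\<l> (Dom V f))"
    unfolding lunit_nat[OF assms, symmetric] using assms by simp
  finally show ?thesis .
qed

text \<open>Naturality of the left unitor identifies \<open>\<i> \<I> \<otimes>\<^sub>a f\<close>
  with \<open>f\<close> up to invertible arrows. This lemma and the next allow an identity to be
  proved after tensoring with the unit, where pentagon and triangle apply.\<close>

lemma unit_left_faithful:
  assumes "f \<in> Arr V" "g \<in> Arr V" "Dom V f = Dom V g" "Cod V f = Cod V g"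
    and "\<i> \<I> \<otimes>\<^sub>a f = \<i> \<I> \<otimes>\<^sub>a g"
  shows "f = g"
  by (rule iso_right_cancel[of "\<l> (Dom V f)"])
    (use assms lunit_nat[of f "Cod V f"] lunit_nat[of g "Cod V g"] in auto)

lemma unit_right_faithful:
  assumes "f \<in> Arr V" "g \<in> Arr V" "Dom V f = Dom V g" "Cod V f = Cod V g"
    and "f \<otimes>\<^sub>a \<i> \<I> = g \<otimes>\<^sub>a \<i> \<I>"
  shows "f = g"
  by (rule iso_right_cancel[of "\<r> (Dom V f)"])
    (use assms runit_nat[of f "Cod V f"] runit_nat[of g "Cod V g"] in auto)

lemma is_iso_tens [simp]:
  assumes "is_iso V f" "is_iso V g"
  shows "is_iso V (f \<otimes>\<^sub>a g)"
proof -
  note [simp] = assms is_iso_Arr[OF assms(1)] is_iso_Arr[OF assms(2)]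
  show ?thesis by (intro is_isoI[of _ "\<i>\<n>\<v> f \<otimes>\<^sub>a \<i>\<n>\<v> g"]) auto
qed

text \<open>Kelly's argument: tensored with the unit on the left, the claim becomes one face of the
  pentagon for \<open>\<I>\<close>, \<open>\<I>\<close>, \<open>X\<close>, \<open>Y\<close>, whose
  other faces are triangles and naturality squares.\<close>

lemma lunit_tens:
  assumes [simp]: "X \<in> Obj V" "Y \<in> Obj V"
  shows "\<l> (X \<otimes> Y) \<cdot> \<a> \<I> X Y = \<l> X \<otimes>\<^sub>a \<i> Y"
proof (rule unit_left_faithful)
  \<comment> \<open>\<open>?k\<close> consists of two sides of that pentagon; being invertible, it
    can be cancelled at the end.\<close>
  let ?k = "\<a> \<I> (\<I> \<otimes> X) Y \<cdot> (\<a> \<I> \<I> X \<otimes>\<^sub>a \<i> Y)"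
  have "(\<i> \<I> \<otimes>\<^sub>a (\<l> (X \<otimes> Y) \<cdot> \<a> \<I> X Y)) \<cdot> ?k
      = (\<i> \<I> \<otimes>\<^sub>a \<l> (X \<otimes> Y)) \<cdot> ((\<i> \<I> \<otimes>\<^sub>a \<a> \<I> X Y) \<cdot> ?k)"
    by simp
  also have "\<dots> = ((\<i> \<I> \<otimes>\<^sub>a \<l> (X \<otimes> Y)) \<cdot> \<a> \<I> \<I> (X \<otimes> Y)) \<cdot> \<a> (\<I> \<otimes> \<I>) X Y"
    using pentagon[of \<I> \<I> X Y] by simp
  also have "\<dots> = (\<r> \<I> \<otimes>\<^sub>a (\<i> X \<otimes>\<^sub>a \<i> Y)) \<cdot> \<a> (\<I> \<otimes> \<I>) X Y"
    using triangle[of \<I> "X \<otimes> Y"] by simp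
  also have "\<dots> = \<a> \<I> X Y \<cdot> ((\<r> \<I> \<otimes>\<^sub>a \<i> X) \<otimes>\<^sub>a \<i> Y)"
    using assoc_nat[of "\<r> \<I>" "\<i> X" "\<i> Y" \<I> X Y] by simp
  also have "\<dots> = (\<a> \<I> X Y \<cdot> ((\<i> \<I> \<otimes>\<^sub>a \<l> X) \<otimes>\<^sub>a \<i> Y)) \<cdot> (\<a> \<I> \<I> X \<otimes>\<^sub>a \<i> Y)"
    using triangle[of \<I> X] by simp
  also have "\<dots> = (\<i> \<I> \<otimes>\<^sub>a (\<l> X \<otimes>\<^sub>a \<i> Y)) \<cdot> ?k"
    by (subst assoc_nat) simp_all
  finally show "\<i> \<I> \<otimes>\<^sub>a (\<l> (X \<otimes> Y) \<cdot> \<a> \<I> X Y) = \<i> \<I> \<otimes>\<^sub>a (\<l> X \<otimes>\<^sub>a \<i> Y)"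
    by (rule iso_right_cancel[of ?k, rotated -1]) simp_all
qed simp_all

lemma lunit_inv_tens:
  assumes [simp]: "X \<in> Obj V" "Y \<in> Obj V"
  shows "\<a> \<I> X Y \<cdot> (\<i>\<n>\<v> (\<l> X) \<otimes>\<^sub>a \<i> Y) = \<i>\<n>\<v> (\<l> (X \<otimes> Y))"
proof (rule iso_left_cancel[of "\<l> (X \<otimes> Y)", rotated -1])
  have "\<l> (X \<otimes> Y) \<cdot> (\<a> \<I> X Y \<cdot> (\<i>\<n>\<v> (\<l> X) \<otimes>\<^sub>a \<i> Y)) = (\<l> (X \<otimes> Y) \<cdot> \<a> \<I> X Y) \<cdot> (\<i>\<n>\<v> (\<l> X) \<otimes>\<^sub>a \<i> Y)"
    by simp
  also have "\<dots> = \<l> (X \<otimes> Y) \<cdot> \<i>\<n>\<v> (\<l> (X \<otimes> Y))"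
    unfolding lunit_tens[OF assms] by simp
  finally show "\<l> (X \<otimes> Y) \<cdot> (\<a> \<I> X Y \<cdot> (\<i>\<n>\<v> (\<l> X) \<otimes>\<^sub>a \<i> Y)) = \<l> (X \<otimes> Y) \<cdot> \<i>\<n>\<v> (\<l> (X \<otimes> Y))" .
qed simp_all

lemma triangle_inv:
  assumes [simp]: "X \<in> Obj V" "Y \<in> Obj V"
  shows "\<a> X \<I> Y \<cdot> (\<i>\<n>\<v> (\<r> X) \<otimes>\<^sub>a \<i> Y) = \<i> X \<otimes>\<^sub>a \<i>\<n>\<v> (\<l> Y)"
proof (rule iso_left_cancel[of "\<i> X \<otimes>\<^sub>a \<l> Y", rotated -1])
  have "(\<i> X \<otimes>\<^sub>a \<l> Y) \<cdot> (\<a> X \<I> Y \<cdot> (\<i>\<n>\<v> (\<r> X) \<otimes>\<^sub>a \<i> Y)) = ((\<i> X \<otimes>\<^sub>a \<l> Y) \<cdot> \<a> X \<I> Y) \<cdot> (\<i>\<n>\<v> (\<r> X) \<otimes>\<^sub>a \<i> Y)"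
    by simp
  also have "\<dots> = (\<i> X \<otimes>\<^sub>a \<l> Y) \<cdot> (\<i> X \<otimes>\<^sub>a \<i>\<n>\<v> (\<l> Y))"
    unfolding triangle[OF assms] by simp
  finally show "(\<i> X \<otimes>\<^sub>a \<l> Y) \<cdot> (\<a> X \<I> Y \<cdot> (\<i>\<n>\<v> (\<r> X) \<otimes>\<^sub>a \<i> Y)) = (\<i> X \<otimes>\<^sub>a \<l> Y) \<cdot> (\<i> X \<otimes>\<^sub>a \<i>\<n>\<v> (\<l> Y))" .
qed simp_all

text \<open>The pentagon is solved so that the associator whiskered on the right disappears and one
  whiskered on the left appears, the orientation that \<open>push\<close> uses.\<close>

lemma pentagon_assoc:
  assumes [simp]: "W \<in> Obj V" "X \<in> Obj V" "Y \<in> Obj V" "Z \<in> Obj V"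
  shows "\<a> W (X \<otimes> Y) Z \<cdot> (\<a> W X Y \<otimes>\<^sub>a \<i> Z)
    = (\<i> W \<otimes>\<^sub>a \<i>\<n>\<v> (\<a> X Y Z)) \<cdot> \<a> W X (Y \<otimes> Z) \<cdot> \<a> (W \<otimes> X) Y Z"
  unfolding pentagon[OF assms, symmetric] by simp

lemma pentagon_assoc_inv:
  assumes [simp]: "W \<in> Obj V" "X \<in> Obj V" "Y \<in> Obj V" "Z \<in> Obj V"
  shows "\<a> (W \<otimes> X) Y Z \<cdot> (\<i>\<n>\<v> (\<a> W X Y) \<otimes>\<^sub>a \<i> Z)
    = \<i>\<n>\<v> (\<a> W X (Y \<otimes> Z)) \<cdot> (\<i> W \<otimes>\<^sub>a \<a> X Y Z) \<cdot> \<a> W (X \<otimes> Y) Z"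
proof (rule iso_left_cancel[of "\<a> W X (Y \<otimes> Z)", rotated -1])
  have "\<a> W X (Y \<otimes> Z) \<cdot> (\<a> (W \<otimes> X) Y Z \<cdot> (\<i>\<n>\<v> (\<a> W X Y) \<otimes>\<^sub>a \<i> Z))
      = (\<a> W X (Y \<otimes> Z) \<cdot> \<a> (W \<otimes> X) Y Z) \<cdot> (\<i>\<n>\<v> (\<a> W X Y) \<otimes>\<^sub>a \<i> Z)"
    by simp
  then show "\<a> W X (Y \<otimes> Z) \<cdot> (\<a> (W \<otimes> X) Y Z \<cdot> (\<i>\<n>\<v> (\<a> W X Y) \<otimes>\<^sub>a \<i> Z))
      = \<a> W X (Y \<otimes> Z) \<cdot> \<i>\<n>\<v> (\<a> W X (Y \<otimes> Z)) \<cdot> (\<i> W \<otimes>\<^sub>a \<a> X Y Z) \<cdot> \<a> W (X \<otimes> Y) Z"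
    unfolding pentagon[OF assms, symmetric] by simp
qed simp_all

text \<open>\<open>tens_merge\<close> fuses everything in the left factor into one arrow, which
  blocks \<open>assoc_nat\<close>. Splitting the leading \<open>f \<otimes>\<^sub>a g\<close> off
  the rest \<open>k\<close> restores the naturality square; the next two lemmas do the same for the
  pentagon.\<close>

lemma assoc_push:
  assumes [simp]: "f \<in> Arr V" "g \<in> Arr V" "h \<in> Arr V" "k \<in> Arr V" "Cod V k = Dom V f \<otimes> Dom V g"
    "Cod V f = X" "Cod V g = Y" "Cod V h = Z"
  shows "\<a> X Y Z \<cdot> (((f \<otimes>\<^sub>a g) \<cdot> k) \<otimes>\<^sub>a h)
    = (f \<otimes>\<^sub>a (g \<otimes>\<^sub>a h)) \<cdot> \<a> (Dom V f) (Dom V g) (Dom V h) \<cdot> (k \<otimes>\<^sub>a \<i> (Dom V h))"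
proof -
  have [simp]: "X \<in> Obj V" "Y \<in> Obj V" "Z \<in> Obj V"
    using assms Dom_Cod_Obj(2)[of f] Dom_Cod_Obj(2)[of g] Dom_Cod_Obj(2)[of h] by argo+
  have "\<a> X Y Z \<cdot> (((f \<otimes>\<^sub>a g) \<cdot> k) \<otimes>\<^sub>a h)
      = (\<a> X Y Z \<cdot> ((f \<otimes>\<^sub>a g) \<otimes>\<^sub>a h)) \<cdot> (k \<otimes>\<^sub>a \<i> (Dom V h))"
    by simp
  then show ?thesis by (simp add: assoc_nat)
qed

lemma assoc_push_assoc:
  assumes [simp]: "W \<in> Obj V" "X \<in> Obj V" "Y \<in> Obj V" "Z \<in> Obj V"
    "k \<in> Arr V" "Cod V k = (W \<otimes> X) \<otimes> Y"
  shows "\<a> W (X \<otimes> Y) Z \<cdot> ((\<a> W X Y \<cdot> k) \<otimes>\<^sub>a \<i> Z)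
    = (\<i> W \<otimes>\<^sub>a \<i>\<n>\<v> (\<a> X Y Z)) \<cdot> \<a> W X (Y \<otimes> Z) \<cdot> \<a> (W \<otimes> X) Y Z \<cdot> (k \<otimes>\<^sub>a \<i> Z)"
proof -
  have "\<a> W (X \<otimes> Y) Z \<cdot> ((\<a> W X Y \<cdot> k) \<otimes>\<^sub>a \<i> Z)
      = (\<a> W (X \<otimes> Y) Z \<cdot> (\<a> W X Y \<otimes>\<^sub>a \<i> Z)) \<cdot> (k \<otimes>\<^sub>a \<i> Z)"
    by simp
  then show ?thesis by (simp add: pentagon_assoc)
qed

lemma assoc_push_assoc_inv:
  assumes [simp]: "W \<in> Obj V" "X \<in> Obj V" "Y \<in> Obj V" "Z \<in> Obj V"
    "k \<in> Arr V" "Cod V k = W \<otimes> (X \<otimes> Y)"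
  shows "\<a> (W \<otimes> X) Y Z \<cdot> ((\<i>\<n>\<v> (\<a> W X Y) \<cdot> k) \<otimes>\<^sub>a \<i> Z)
    = \<i>\<n>\<v> (\<a> W X (Y \<otimes> Z)) \<cdot> (\<i> W \<otimes>\<^sub>a \<a> X Y Z) \<cdot> \<a> W (X \<otimes> Y) Z \<cdot> (k \<otimes>\<^sub>a \<i> Z)"
proof -
  have "\<a> (W \<otimes> X) Y Z \<cdot> ((\<i>\<n>\<v> (\<a> W X Y) \<cdot> k) \<otimes>\<^sub>a \<i> Z)
      = (\<a> (W \<otimes> X) Y Z \<cdot> (\<i>\<n>\<v> (\<a> W X Y) \<otimes>\<^sub>a \<i> Z)) \<cdot> (k \<otimes>\<^sub>a \<i> Z)"
    by simp
  then show ?thesis by (simp add: pentagon_assoc_inv)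
qed

text \<open>Carries associators towards the source, past arrows by naturality and past whiskered
  associators by the pentagon. Every rule is repeated in \<open>extend\<close> form for use in the
  middle of a composite.\<close>

lemmas push = assoc_nat assoc_push assoc_push_assoc assoc_push_assoc_inv
  assoc_nat[THEN extend] assoc_push[THEN extend] assoc_push_assoc[THEN extend]
  assoc_push_assoc_inv[THEN extend]
  pentagon_assoc pentagon_assoc_inv pentagon_assoc[THEN extend] pentagon_assoc_inv[THEN extend]

lemmas pull_inv = assoc_inv_nat assoc_inv_nat[THEN extend]

text \<open>The subscripts count the tensor factors of source and target. Tensoring with \<open>R\<close> on the right and
  rebracketing everything to the right turns an arrow into a family indexed by \<open>R\<close>; such families
  compose and whisker strictly, so that the associators disappear from diagrams.\<close>

definition ext12 :: "'o \<Rightarrow> 'o \<Rightarrow> 'm \<Rightarrow> 'o \<Rightarrow> 'm"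
  where "ext12 Y Z f R = \<a> Y Z R \<cdot> (f \<otimes>\<^sub>a \<i> R)"

definition ext21 :: "'o \<Rightarrow> 'o \<Rightarrow> 'm \<Rightarrow> 'o \<Rightarrow> 'm"
  where "ext21 W X f R = (f \<otimes>\<^sub>a \<i> R) \<cdot> \<i>\<n>\<v> (\<a> W X R)"

definition ext22 :: "'o \<Rightarrow> 'o \<Rightarrow> 'o \<Rightarrow> 'o \<Rightarrow> 'm \<Rightarrow> 'o \<Rightarrow> 'm"
  where "ext22 W X Y Z f R = \<a> Y Z R \<cdot> (f \<otimes>\<^sub>a \<i> R) \<cdot> \<i>\<n>\<v> (\<a> W X R)"

text \<open>The arrow inside \<open>ext22\<close> has the shape of the later \<open>act\<close>;
  extending it by \<open>R\<close> extends its three factors one by one. The multiplicativity axiom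
  of \<open>AV_B\<close> needs the case where \<open>R\<close> carries \<open>B\<close>.\<close>

lemma ext22_comp:
  assumes [simp]: "t \<in> Arr V" "c \<in> Arr V" "\<rho> \<in> Arr V"
    "A \<in> Obj V" "B \<in> Obj V" "C \<in> Obj V" "X \<in> Obj V" "R \<in> Obj V"
    "Dom V t = A \<otimes> C" "Cod V t = B" "Dom V c = A \<otimes> X" "Cod V c = X \<otimes> A"
    "Dom V \<rho> = X" "Cod V \<rho> = X \<otimes> C"
  shows "ext22 A X X B ((\<i> X \<otimes>\<^sub>a t) \<cdot> ext22 A X X A c C \<cdot> (\<i> A \<otimes>\<^sub>a \<rho>)) R
    = (\<i> X \<otimes>\<^sub>a ext21 A C t R) \<cdot> ext22 A X X A c (C \<otimes> R) \<cdot> (\<i> A \<otimes>\<^sub>a ext12 X C \<rho> R)"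
  unfolding ext22_def ext21_def ext12_def by (simp add: push)


lemma ext12_typing [simp]:
  assumes [simp]: "f \<in> Arr V" "Y \<in> Obj V" "Z \<in> Obj V" "R \<in> Obj V" "Cod V f = Y \<otimes> Z"
  shows "ext12 Y Z f R \<in> Arr V" "Dom V (ext12 Y Z f R) = Dom V f \<otimes> R"
    "Cod V (ext12 Y Z f R) = Y \<otimes> (Z \<otimes> R)"
  unfolding ext12_def by simp_all

lemma ext21_typing [simp]:
  assumes [simp]: "f \<in> Arr V" "W \<in> Obj V" "X \<in> Obj V" "R \<in> Obj V" "Dom V f = W \<otimes> X"
  shows "ext21 W X f R \<in> Arr V" "Dom V (ext21 W X f R) = W \<otimes> (X \<otimes> R)"
    "Cod V (ext21 W X f R) = Cod V f \<otimes> R"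
  unfolding ext21_def by simp_all

lemma ext22_typing [simp]:
  assumes [simp]: "f \<in> Arr V" "W \<in> Obj V" "X \<in> Obj V" "Y \<in> Obj V" "Z \<in> Obj V" "R \<in> Obj V"
    "Dom V f = W \<otimes> X" "Cod V f = Y \<otimes> Z"
  shows "ext22 W X Y Z f R \<in> Arr V" "Dom V (ext22 W X Y Z f R) = W \<otimes> (X \<otimes> R)"
    "Cod V (ext22 W X Y Z f R) = Y \<otimes> (Z \<otimes> R)"
  unfolding ext22_def by simp_all

text \<open>\<open>f\<close> does not touch the factor \<open>R\<close>, so the family is natural in
  it. This and its analogues for \<open>ext21\<close> and \<open>ext22\<close> move arrows through
  the parameter.\<close>

lemma ext12_nat:
  assumes "f \<in> Arr V" "g \<in> Arr V" "Y \<in> Obj V" "Z \<in> Obj V" "Cod V f = Y \<otimes> Z" "Dom V f = X" "Cod V g = R"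
  shows "ext12 Y Z f R \<cdot> (\<i> X \<otimes>\<^sub>a g) = (\<i> Y \<otimes>\<^sub>a (\<i> Z \<otimes>\<^sub>a g)) \<cdot> ext12 Y Z f (Dom V g)"
proof -
  have [simp]: "R \<in> Obj V" "X \<in> Obj V" using assms Dom_Cod_Obj by blast+
  have n: "\<a> Y Z R \<cdot> (\<i> (Y \<otimes> Z) \<otimes>\<^sub>a g) = (\<i> Y \<otimes>\<^sub>a (\<i> Z \<otimes>\<^sub>a g)) \<cdot> \<a> Y Z (Dom V g)"
    using assms assoc_nat[of "\<i> Y" "\<i> Z" g Y Z R] by simp
  have "ext12 Y Z f R \<cdot> (\<i> X \<otimes>\<^sub>a g) = (\<a> Y Z R \<cdot> (\<i> (Y \<otimes> Z) \<otimes>\<^sub>a g)) \<cdot> (f \<otimes>\<^sub>a \<i> (Dom V g))"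
    unfolding ext12_def using assms by simp
  also have "\<dots> = (\<i> Y \<otimes>\<^sub>a (\<i> Z \<otimes>\<^sub>a g)) \<cdot> ext12 Y Z f (Dom V g)"
    unfolding n ext12_def using assms by simp
  finally show ?thesis .
qed

lemma ext21_nat:
  assumes "f \<in> Arr V" "g \<in> Arr V" "W \<in> Obj V" "X \<in> Obj V" "Dom V f = W \<otimes> X" "Cod V g = R"
  shows "ext21 W X f R \<cdot> (\<i> W \<otimes>\<^sub>a (\<i> X \<otimes>\<^sub>a g)) = (\<i> (Cod V f) \<otimes>\<^sub>a g) \<cdot> ext21 W X f (Dom V g)"
proof -
  have [simp]: "R \<in> Obj V" using assms Dom_Cod_Obj by blast
  show ?thesis
    unfolding ext21_def using assms by (simp add: pull_inv)
qed

lemma ext22_ext12: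
  assumes "f \<in> Arr V" "R \<in> Obj V" "W \<in> Obj V" "X \<in> Obj V" "Y \<in> Obj V" "Z \<in> Obj V"
    "Dom V f = W \<otimes> X" "Cod V f = Y \<otimes> Z"
  shows "ext22 W X Y Z f R = ext12 Y Z f R \<cdot> \<i>\<n>\<v> (\<a> W X R)"
  unfolding ext22_def ext12_def using assms by simp

lemma ext22_nat:
  assumes "f \<in> Arr V" "g \<in> Arr V" "W \<in> Obj V" "X \<in> Obj V" "Y \<in> Obj V" "Z \<in> Obj V"
    "Dom V f = W \<otimes> X" "Cod V f = Y \<otimes> Z" "Cod V g = R"
  shows "ext22 W X Y Z f R \<cdot> (\<i> W \<otimes>\<^sub>a (\<i> X \<otimes>\<^sub>a g))
    = (\<i> Y \<otimes>\<^sub>a (\<i> Z \<otimes>\<^sub>a g)) \<cdot> ext22 W X Y Z f (Dom V g)"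
proof -
  have [simp]: "R \<in> Obj V" using assms Dom_Cod_Obj by blast
  have "ext22 W X Y Z f R \<cdot> (\<i> W \<otimes>\<^sub>a (\<i> X \<otimes>\<^sub>a g))
      = (ext12 Y Z f R \<cdot> (\<i> (W \<otimes> X) \<otimes>\<^sub>a g)) \<cdot> \<i>\<n>\<v> (\<a> W X (Dom V g))"
    using assms by (simp add: ext22_ext12 pull_inv)
  also have "\<dots> = (\<i> Y \<otimes>\<^sub>a (\<i> Z \<otimes>\<^sub>a g)) \<cdot> ext22 W X Y Z f (Dom V g)"
    using assms ext12_nat[of f g Y Z "W \<otimes> X" R] by (simp add: ext22_ext12)
  finally show ?thesis .
qed

lemma is_iso_ext22 [simp]:
  assumes "is_iso V f" "R \<in> Obj V" "W \<in> Obj V" "X \<in> Obj V" "Y \<in> Obj V" "Z \<in> Obj V"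
    "Dom V f = W \<otimes> X" "Cod V f = Y \<otimes> Z"
  shows "is_iso V (ext22 W X Y Z f R)"
  unfolding ext22_def using assms is_iso_Arr[OF assms(1)] by simp

end

section \<open>Braidings\<close>

context braided_monoidal_category
begin

lemmas [simp] = braid_iso

lemma braid_typing [simp]:
  assumes "X \<in> Obj V" "Y \<in> Obj V"
  shows "\<c> X Y \<in> Arr V" "Dom V (\<c> X Y) = X \<otimes> Y" "Cod V (\<c> X Y) = Y \<otimes> X"
  using braid_hom[OF assms] by auto

lemma braid_nat:
  assumes "f \<in> Arr V" "g \<in> Arr V" "Cod V f = X" "Cod V g = Y"
  shows "\<c> X Y \<cdot> (f \<otimes>\<^sub>a g) = (g \<otimes>\<^sub>a f) \<cdot> \<c> (Dom V f) (Dom V g)"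
  using braid_natural[of f "Dom V f" X g "Dom V g" Y] assms by simp

abbreviation braid_ext :: "'o \<Rightarrow> 'o \<Rightarrow> 'o \<Rightarrow> 'm"
  where "braid_ext W X R \<equiv> ext22 W X X W (\<c> W X) R"

text \<open>The first hexagon with its associators gathered into \<open>braid_ext\<close>: a strand
  crosses \<open>Y \<otimes> Z\<close> by crossing \<open>Y\<close> and then
  \<open>Z\<close>.\<close>

lemma braid_tens_right:
  assumes [simp]: "X \<in> Obj V" "Y \<in> Obj V" "Z \<in> Obj V"
  shows "(\<i> Y \<otimes>\<^sub>a \<c> X Z) \<cdot> braid_ext X Y Z = \<a> Y Z X \<cdot> \<c> X (Y \<otimes> Z)"
proof -
  have "(\<i> Y \<otimes>\<^sub>a \<c> X Z) \<cdot> braid_ext X Y Z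
      = ((\<i> Y \<otimes>\<^sub>a \<c> X Z) \<cdot> \<a> Y X Z \<cdot> (\<c> X Y \<otimes>\<^sub>a \<i> Z)) \<cdot> \<i>\<n>\<v> (\<a> X Y Z)"
    by (simp add: ext22_def)
  also have "\<dots> = \<a> Y Z X \<cdot> \<c> X (Y \<otimes> Z)"
    unfolding hexagon1[OF assms, symmetric] by simp
  finally show ?thesis .
qed

text \<open>The second hexagon in the same style: two strands cross \<open>Z\<close> one after the
  other, the inner one first.\<close>

lemma braid_tens_left:
  assumes [simp]: "X \<in> Obj V" "Y \<in> Obj V" "Z \<in> Obj V"
  shows "\<c> (X \<otimes> Y) Z \<cdot> \<i>\<n>\<v> (\<a> X Y Z) = braid_ext X Z Y \<cdot> (\<i> X \<otimes>\<^sub>a \<c> Y Z)"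
proof -
  have "\<c> (X \<otimes> Y) Z \<cdot> \<i>\<n>\<v> (\<a> X Y Z)
      = \<a> Z X Y \<cdot> (\<i>\<n>\<v> (\<a> Z X Y) \<cdot> \<c> (X \<otimes> Y) Z \<cdot> \<i>\<n>\<v> (\<a> X Y Z))"
    by simp
  also have "\<dots> = braid_ext X Z Y \<cdot> (\<i> X \<otimes>\<^sub>a \<c> Y Z)"
    unfolding hexagon2[OF assms] by (simp add: ext22_def)
  finally show ?thesis .
qed

text \<open>Naturality of the braiding in \<open>\<rho>\<close>, read through the first hexagon: the
  strand \<open>W\<close> may cross before or after the coaction.\<close>

lemma braid_ext12:
  assumes [simp]: "\<rho> \<in> Arr V" "W \<in> Obj V" "X \<in> Obj V" "C \<in> Obj V" "Cod V \<rho> = X \<otimes> C" "Dom V \<rho> = U"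
  shows "(\<i> X \<otimes>\<^sub>a \<c> W C) \<cdot> braid_ext W X C \<cdot> (\<i> W \<otimes>\<^sub>a \<rho>) = ext12 X C \<rho> W \<cdot> \<c> W U"
proof -
  have [simp]: "U \<in> Obj V" using Dom_Cod_Obj(1)[of \<rho>] by simp
  have "(\<i> X \<otimes>\<^sub>a \<c> W C) \<cdot> braid_ext W X C \<cdot> (\<i> W \<otimes>\<^sub>a \<rho>)
      = ((\<i> X \<otimes>\<^sub>a \<c> W C) \<cdot> braid_ext W X C) \<cdot> (\<i> W \<otimes>\<^sub>a \<rho>)"
    by simp
  also have "\<dots> = ext12 X C \<rho> W \<cdot> \<c> W U"
    unfolding braid_tens_right[OF \<open>W \<in> Obj V\<close> \<open>X \<in> Obj V\<close> \<open>C \<in> Obj V\<close>]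
    by (simp add: ext12_def braid_tens_right braid_nat)
  finally show ?thesis .
qed

text \<open>The preceding identity with a spectator \<open>R\<close>; \<open>push\<close> reduces it
  to that identity tensored with \<open>R\<close>.\<close>

lemma braid_ext12_ext:
  assumes [simp]: "\<rho> \<in> Arr V" "W \<in> Obj V" "X \<in> Obj V" "C \<in> Obj V" "R \<in> Obj V"
    "Cod V \<rho> = X \<otimes> C" "Dom V \<rho> = U"
  shows "(\<i> X \<otimes>\<^sub>a braid_ext W C R) \<cdot> braid_ext W X (C \<otimes> R) \<cdot> (\<i> W \<otimes>\<^sub>a ext12 X C \<rho> R)
    = ext12 X C \<rho> (W \<otimes> R) \<cdot> braid_ext W U R"
proof -
  have [simp]: "U \<in> Obj V" using Dom_Cod_Obj(1)[of \<rho>] by simp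
  have "(\<i> X \<otimes>\<^sub>a braid_ext W C R) \<cdot> braid_ext W X (C \<otimes> R) \<cdot> (\<i> W \<otimes>\<^sub>a ext12 X C \<rho> R)
     = (\<i> X \<otimes>\<^sub>a \<a> C W R) \<cdot> \<a> X (C \<otimes> W) R \<cdot>
       (((\<i> X \<otimes>\<^sub>a \<c> W C) \<cdot> braid_ext W X C \<cdot> (\<i> W \<otimes>\<^sub>a \<rho>)) \<otimes>\<^sub>a \<i> R) \<cdot> \<i>\<n>\<v> (\<a> W U R)"
    by (simp add: ext22_def ext12_def push)
  also have "\<dots> = ext12 X C \<rho> (W \<otimes> R) \<cdot> braid_ext W U R"
    unfolding braid_ext12[OF assms(1-4,6,7)] by (simp add: ext22_def ext12_def push)
  finally show ?thesis .
qed

lemma braid_ext21: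
  assumes [simp]: "\<mu> \<in> Arr V" "W \<in> Obj V" "W' \<in> Obj V" "X \<in> Obj V" "Dom V \<mu> = W \<otimes> W'" "Cod V \<mu> = U"
  shows "\<c> U X \<cdot> ext21 W W' \<mu> X
    = (\<i> X \<otimes>\<^sub>a \<mu>) \<cdot> braid_ext W X W' \<cdot> (\<i> W \<otimes>\<^sub>a \<c> W' X)"
proof -
  have [simp]: "U \<in> Obj V" using Dom_Cod_Obj(2)[of \<mu>] by simp
  have "\<c> U X \<cdot> ext21 W W' \<mu> X = (\<c> U X \<cdot> (\<mu> \<otimes>\<^sub>a \<i> X)) \<cdot> \<i>\<n>\<v> (\<a> W W' X)"
    by (simp add: ext21_def)
  also have "\<dots> = (\<i> X \<otimes>\<^sub>a \<mu>) \<cdot> braid_ext W X W' \<cdot> (\<i> W \<otimes>\<^sub>a \<c> W' X)"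
    by (simp add: braid_nat braid_tens_left)
  finally show ?thesis .
qed

text \<open>The parametrised form of \<open>braid_ext21\<close>. The domain is bracketed to the
  right, while \<open>braid_ext21\<close> tensored with \<open>R\<close> lives on another
  bracketing, so an invertible rebracketing is inserted and cancelled at the end.\<close>

lemma braid_ext21_ext:
  assumes [simp]: "\<mu> \<in> Arr V" "W \<in> Obj V" "W' \<in> Obj V" "X \<in> Obj V" "R \<in> Obj V"
    "Dom V \<mu> = W \<otimes> W'" "Cod V \<mu> = U"
  shows "braid_ext U X R \<cdot> ext21 W W' \<mu> (X \<otimes> R)
    = (\<i> X \<otimes>\<^sub>a ext21 W W' \<mu> R) \<cdot> braid_ext W X (W' \<otimes> R) \<cdot> (\<i> W \<otimes>\<^sub>a braid_ext W' X R)"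
proof -
  have [simp]: "U \<in> Obj V" using Dom_Cod_Obj(2)[of \<mu>] by simp
  have "(braid_ext U X R \<cdot> ext21 W W' \<mu> (X \<otimes> R)) \<cdot> (\<i> W \<otimes>\<^sub>a \<a> W' X R) \<cdot> \<a> W (W' \<otimes> X) R
      = braid_ext U X R \<cdot> (\<a> U X R \<cdot> (ext21 W W' \<mu> X \<otimes>\<^sub>a \<i> R))"
    by (simp add: ext21_def push)
  also have "\<dots> = \<a> X U R \<cdot> ((\<c> U X \<cdot> ext21 W W' \<mu> X) \<otimes>\<^sub>a \<i> R)"
    by (simp add: ext22_def)
  also have "\<dots> = ((\<i> X \<otimes>\<^sub>a ext21 W W' \<mu> R) \<cdot> braid_ext W X (W' \<otimes> R) \<cdot> (\<i> W \<otimes>\<^sub>a braid_ext W' X R))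
       \<cdot> (\<i> W \<otimes>\<^sub>a \<a> W' X R) \<cdot> \<a> W (W' \<otimes> X) R"
    unfolding braid_ext21[OF assms(1-4,6,7)] by (simp add: ext22_def ext21_def push)
  finally show ?thesis
    by (rule iso_right_cancel[of "(\<i> W \<otimes>\<^sub>a \<a> W' X R) \<cdot> \<a> W (W' \<otimes> X) R", rotated -1]) simp_all
qed

text \<open>The axioms of a braiding do not mention the unitors. Tensored with \<open>\<I>\<close>
  on the right, the claim follows from the second hexagon for \<open>\<I>\<close>,
  \<open>\<I>\<close>, \<open>X\<close>, the triangle, and cancellation of the invertible
  \<open>\<c> \<I> X\<close>.\<close>

lemma braid_unit_left:
  assumes [simp]: "X \<in> Obj V"
  shows "\<r> X \<cdot> \<c> \<I> X = \<l> X"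
proof (rule unit_right_faithful)
  have "((\<r> X \<cdot> \<c> \<I> X) \<otimes>\<^sub>a \<i> \<I>) \<cdot> \<i>\<n>\<v> (\<a> \<I> X \<I>) \<cdot> (\<i> \<I> \<otimes>\<^sub>a \<c> \<I> X)
      = (\<r> X \<otimes>\<^sub>a \<i> \<I>) \<cdot> \<i>\<n>\<v> (\<a> X \<I> \<I>) \<cdot> (braid_ext \<I> X \<I> \<cdot> (\<i> \<I> \<otimes>\<^sub>a \<c> \<I> X))"
    by (simp add: ext22_def)
  also have "\<dots> = (((\<i> X \<otimes>\<^sub>a \<l> \<I>) \<cdot> \<a> X \<I> \<I>) \<cdot> \<i>\<n>\<v> (\<a> X \<I> \<I>)) \<cdot> \<c> (\<I> \<otimes> \<I>) X \<cdot> \<i>\<n>\<v> (\<a> \<I> \<I> X)"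
    unfolding braid_tens_left[OF unit_Obj unit_Obj assms, symmetric] triangle[OF assms unit_Obj] by simp
  also have "\<dots> = (\<c> \<I> X \<cdot> (\<l> \<I> \<otimes>\<^sub>a \<i> X)) \<cdot> \<i>\<n>\<v> (\<a> \<I> \<I> X)"
    by (simp add: braid_nat)
  also have "\<dots> = \<c> \<I> X \<cdot> \<l> (\<I> \<otimes> X)"
    unfolding lunit_tens[OF unit_Obj assms, symmetric] by simp
  also have "\<dots> = \<l> (X \<otimes> \<I>) \<cdot> (\<i> \<I> \<otimes>\<^sub>a \<c> \<I> X)"
    by (simp add: lunit_nat)
  finally have "((\<r> X \<cdot> \<c> \<I> X) \<otimes>\<^sub>a \<i> \<I>) \<cdot> \<i>\<n>\<v> (\<a> \<I> X \<I>) = \<l> (X \<otimes> \<I>)"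
    by (intro iso_right_cancel[of "\<i> \<I> \<otimes>\<^sub>a \<c> \<I> X" "((\<r> X \<cdot> \<c> \<I> X) \<otimes>\<^sub>a \<i> \<I>) \<cdot> \<i>\<n>\<v> (\<a> \<I> X \<I>)"]) simp_all
  then have "(((\<r> X \<cdot> \<c> \<I> X) \<otimes>\<^sub>a \<i> \<I>) \<cdot> \<i>\<n>\<v> (\<a> \<I> X \<I>)) \<cdot> \<a> \<I> X \<I> = \<l> (X \<otimes> \<I>) \<cdot> \<a> \<I> X \<I>"
    by simp
  then show "(\<r> X \<cdot> \<c> \<I> X) \<otimes>\<^sub>a \<i> \<I> = \<l> X \<otimes>\<^sub>a \<i> \<I>"
    unfolding lunit_tens[OF assms unit_Obj] by simp
qed simp_all

end

section \<open>Comodules and measurings\<close>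

context monoidal_category
begin

definition is_comodule :: "('o, 'm) comon \<Rightarrow> 'o \<Rightarrow> 'm \<Rightarrow> bool"
  where "is_comodule C X \<rho> \<longleftrightarrow> X \<in> Obj V \<and> \<rho> \<in> hom V X (X \<otimes> comon_obj C) \<and>
    ext12 X (comon_obj C) \<rho> (comon_obj C) \<cdot> \<rho> = (\<i> X \<otimes>\<^sub>a comon_comult C) \<cdot> \<rho> \<and>
    \<r> X \<cdot> (\<i> X \<otimes>\<^sub>a comon_counit C) \<cdot> \<rho> = \<i> X"

text \<open>The object condition of \<open>AV_B\<close> with one associator moved across, so that
  both sides of multiplicativity start at \<open>A \<otimes> (A \<otimes> X)\<close> and the
  remaining associators are absorbed by \<open>ext22\<close> and \<open>ext21\<close>.\<close>

definition is_AV_B :: "('o, 'm) mon \<Rightarrow> ('o, 'm) mon \<Rightarrow> 'o \<Rightarrow> 'm \<Rightarrow> bool"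
  where "is_AV_B A B X \<psi> \<longleftrightarrow> X \<in> Obj V \<and> \<psi> \<in> hom V (mon_obj A \<otimes> X) (X \<otimes> mon_obj B) \<and>
    (\<i> X \<otimes>\<^sub>a mon_mult B) \<cdot> ext22 (mon_obj A) X X (mon_obj B) \<psi> (mon_obj B) \<cdot> (\<i> (mon_obj A) \<otimes>\<^sub>a \<psi>)
      = \<psi> \<cdot> ext21 (mon_obj A) (mon_obj A) (mon_mult A) X \<and>
    \<psi> \<cdot> (mon_unit A \<otimes>\<^sub>a \<i> X) \<cdot> \<i>\<n>\<v> (\<l> X) = (\<i> X \<otimes>\<^sub>a mon_unit B) \<cdot> \<i>\<n>\<v> (\<r> X)"

lemma mon_typing:
  assumes "is_mon V A"
  shows "mon_obj A \<in> Obj V" "mon_mult A \<in> Arr V" "mon_unit A \<in> Arr V"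
    "Dom V (mon_mult A) = mon_obj A \<otimes> mon_obj A" "Cod V (mon_mult A) = mon_obj A"
    "Dom V (mon_unit A) = \<I>" "Cod V (mon_unit A) = mon_obj A"
  using assms by (auto simp: is_mon_def Let_def)

lemma comon_typing:
  assumes "is_comon V C"
  shows "comon_obj C \<in> Obj V" "comon_comult C \<in> Arr V" "comon_counit C \<in> Arr V"
    "Dom V (comon_comult C) = comon_obj C" "Cod V (comon_comult C) = comon_obj C \<otimes> comon_obj C"
    "Dom V (comon_counit C) = comon_obj C" "Cod V (comon_counit C) = \<I>"
  using assms by (auto simp: is_comon_def Let_def)

lemma Obj_right_comodules:
  assumes "is_comon V C"
  shows "(X, \<rho>) \<in> Obj (right_comodules V C) \<longleftrightarrow> is_comodule C X \<rho>"
  using comon_typing[OF assms]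
  by (auto simp: right_comodules_def category_over_def Let_def is_comodule_def ext12_def)

lemma Obj_AV_B:
  assumes "is_mon V A" "is_mon V B"
  shows "(X, \<psi>) \<in> Obj (AV_B V A B) \<longleftrightarrow> is_AV_B A B X \<psi>"
proof -
  note [simp] = mon_typing[OF assms(1)] mon_typing[OF assms(2)]
  let ?a = "mon_obj A" and ?b = "mon_obj B"
  have "(\<i> X \<otimes>\<^sub>a mon_mult B) \<cdot> \<a> X ?b ?b \<cdot> (\<psi> \<otimes>\<^sub>a \<i> ?b) \<cdot> \<i>\<n>\<v> (\<a> ?a X ?b) \<cdot> (\<i> ?a \<otimes>\<^sub>a \<psi>) \<cdot> \<a> ?a ?a X
      = \<psi> \<cdot> (mon_mult A \<otimes>\<^sub>a \<i> X) \<longleftrightarrow>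
    (\<i> X \<otimes>\<^sub>a mon_mult B) \<cdot> ext22 ?a X X ?b \<psi> ?b \<cdot> (\<i> ?a \<otimes>\<^sub>a \<psi>) = \<psi> \<cdot> ext21 ?a ?a (mon_mult A) X"
    (is "?L = ?R \<longleftrightarrow> ?L' = ?R'")
    if [simp]: "X \<in> Obj V" "\<psi> \<in> Arr V" "Dom V \<psi> = ?a \<otimes> X" "Cod V \<psi> = X \<otimes> ?b"
  proof -
    have 1: "?L = ?L' \<cdot> \<a> ?a ?a X" "?R = ?R' \<cdot> \<a> ?a ?a X"
      by (simp_all add: ext22_def ext21_def)
    show ?thesis
      unfolding 1 by (rule iffI, erule iso_right_cancel[rotated -1]) simp_all
  qed
  then show ?thesis
    by (auto simp: AV_B_def category_over_def Let_def is_AV_B_def)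
qed

end

section \<open>From coactions and measurings to structures over \<open>A\<close> and
  \<open>B\<close>\<close>

context braided_monoidal_category
begin

text \<open>This is \<open>\<psi>\<close> of the overview for any \<open>t\<close> and
  \<open>\<rho>\<close> of the right type. No axioms are built in, because \<open>t\<close> is later
  found from prescribed values of \<open>act\<close> before it is known to be a measuring.\<close>

definition act :: "'o \<Rightarrow> 'o \<Rightarrow> 'o \<Rightarrow> 'm \<Rightarrow> 'm \<Rightarrow> 'm"
  where "act a X c t \<rho> = (\<i> X \<otimes>\<^sub>a t) \<cdot> braid_ext a X c \<cdot> (\<i> a \<otimes>\<^sub>a \<rho>)"

text \<open>The part common to both sides of the multiplicativity axiom for \<open>act a X c t \<rho>\<close>: that axiom
  holds if and only if the two sides of the multiplicativity axiom for \<open>t\<close>, tensored with \<open>X\<close>,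
  agree after precomposition with \<open>act2 a X c \<rho>\<close>.\<close>

definition act2 :: "'o \<Rightarrow> 'o \<Rightarrow> 'o \<Rightarrow> 'm \<Rightarrow> 'm"
  where "act2 a X c \<rho> = braid_ext a X (a \<otimes> c) \<cdot> (\<i> a \<otimes>\<^sub>a braid_ext a X c) \<cdot> (\<i> a \<otimes>\<^sub>a (\<i> a \<otimes>\<^sub>a \<rho>))"

text \<open>In Sweedler notation: \<open>t(xy, c) = t(x, c1) t(y, c2)\<close> and
  \<open>t(1, c) = \<epsilon>(c) 1\<close>, the braiding taking \<open>y\<close> past
  \<open>c1\<close>. These are the transposed conditions for an arrow
  \<open>A \<rightarrow> [C, B]\<close> to be a monoid map.\<close>

definition is_measuring :: "('o, 'm) mon \<Rightarrow> ('o, 'm) mon \<Rightarrow> ('o, 'm) comon \<Rightarrow> 'm \<Rightarrow> bool"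
  where "is_measuring A B C t \<longleftrightarrow> (let a = mon_obj A; b = mon_obj B; c = comon_obj C in
    t \<in> hom V (a \<otimes> c) b \<and>
    t \<cdot> ext21 a a (mon_mult A) c = mon_mult B \<cdot> ext21 a c t b \<cdot>
      (\<i> a \<otimes>\<^sub>a ((\<i> c \<otimes>\<^sub>a t) \<cdot> braid_ext a c c \<cdot> (\<i> a \<otimes>\<^sub>a comon_comult C))) \<and>
    t \<cdot> (mon_unit A \<otimes>\<^sub>a \<i> c) \<cdot> \<i>\<n>\<v> (\<l> c) = mon_unit B \<cdot> comon_counit C)"

lemma act_typing [simp]:
  assumes [simp]: "a \<in> Obj V" "X \<in> Obj V" "c \<in> Obj V" "t \<in> Arr V" "\<rho> \<in> Arr V"
    "Dom V t = a \<otimes> c" "Dom V \<rho> = X" "Cod V \<rho> = X \<otimes> c"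
  shows "act a X c t \<rho> \<in> Arr V" "Dom V (act a X c t \<rho>) = a \<otimes> X" "Cod V (act a X c t \<rho>) = X \<otimes> Cod V t"
  unfolding act_def by simp_all

lemma act2_typing [simp]:
  assumes [simp]: "a \<in> Obj V" "X \<in> Obj V" "c \<in> Obj V" "\<rho> \<in> Arr V"
    "Dom V \<rho> = X" "Cod V \<rho> = X \<otimes> c"
  shows "act2 a X c \<rho> \<in> Arr V" "Dom V (act2 a X c \<rho>) = a \<otimes> (a \<otimes> X)"
    "Cod V (act2 a X c \<rho>) = X \<otimes> (a \<otimes> (a \<otimes> c))"
  unfolding act2_def by simp_all

text \<open>Coassociativity enters here: the outer \<open>\<rho>\<close> slides past
  \<open>a\<close> by \<open>braid_ext12_ext\<close>, meets the inner one, and the pair becomes a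
  single \<open>\<rho>\<close> followed by \<open>\<delta>\<close>.\<close>

lemma ext12_act:
  assumes [simp]: "a \<in> Obj V" "b \<in> Obj V" "X \<in> Obj V" "c \<in> Obj V" "t \<in> Arr V" "\<rho> \<in> Arr V" "\<delta> \<in> Arr V"
    "Dom V t = a \<otimes> c" "Cod V t = b" "Dom V \<rho> = X" "Cod V \<rho> = X \<otimes> c"
    "Dom V \<delta> = c" "Cod V \<delta> = c \<otimes> c"
    and coassoc: "ext12 X c \<rho> c \<cdot> \<rho> = (\<i> X \<otimes>\<^sub>a \<delta>) \<cdot> \<rho>"
  shows "ext12 X c \<rho> b \<cdot> act a X c t \<rho>
    = (\<i> X \<otimes>\<^sub>a ((\<i> c \<otimes>\<^sub>a t) \<cdot> braid_ext a c c \<cdot> (\<i> a \<otimes>\<^sub>a \<delta>))) \<cdot> braid_ext a X c \<cdot> (\<i> a \<otimes>\<^sub>a \<rho>)"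
proof -
  have "ext12 X c \<rho> b \<cdot> act a X c t \<rho>
      = (ext12 X c \<rho> b \<cdot> (\<i> X \<otimes>\<^sub>a t)) \<cdot> braid_ext a X c \<cdot> (\<i> a \<otimes>\<^sub>a \<rho>)"
    by (simp add: act_def)
  also have "\<dots> = (\<i> X \<otimes>\<^sub>a (\<i> c \<otimes>\<^sub>a t)) \<cdot> (ext12 X c \<rho> (a \<otimes> c) \<cdot> braid_ext a X c) \<cdot> (\<i> a \<otimes>\<^sub>a \<rho>)"
    by (simp add: ext12_nat)
  also have "\<dots> = (\<i> X \<otimes>\<^sub>a (\<i> c \<otimes>\<^sub>a t)) \<cdot> (\<i> X \<otimes>\<^sub>a braid_ext a c c) \<cdot>
      braid_ext a X (c \<otimes> c) \<cdot> (\<i> a \<otimes>\<^sub>a (ext12 X c \<rho> c \<cdot> \<rho>))"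
    unfolding braid_ext12_ext[of \<rho> a X c c X, simplified, symmetric] by simp
  also have "\<dots> = (\<i> X \<otimes>\<^sub>a ((\<i> c \<otimes>\<^sub>a t) \<cdot> braid_ext a c c)) \<cdot>
      (braid_ext a X (c \<otimes> c) \<cdot> (\<i> a \<otimes>\<^sub>a (\<i> X \<otimes>\<^sub>a \<delta>))) \<cdot> (\<i> a \<otimes>\<^sub>a \<rho>)"
    unfolding coassoc by simp
  also have "\<dots> = (\<i> X \<otimes>\<^sub>a ((\<i> c \<otimes>\<^sub>a t) \<cdot> braid_ext a c c \<cdot> (\<i> a \<otimes>\<^sub>a \<delta>))) \<cdot> braid_ext a X c \<cdot> (\<i> a \<otimes>\<^sub>a \<rho>)"
    by (simp add: ext22_nat)
  finally show ?thesis .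
qed

text \<open>\<open>ext12_act\<close> merges the two coactions; for \<open>\<nu>\<close> the
  multiplication of \<open>B\<close>, what remains after \<open>act2\<close> is the right-hand side
  of the measuring axiom.\<close>

lemma act_mult_right:
  assumes [simp]: "a \<in> Obj V" "b \<in> Obj V" "X \<in> Obj V" "c \<in> Obj V" "t \<in> Arr V" "\<rho> \<in> Arr V" "\<delta> \<in> Arr V"
    "Dom V t = a \<otimes> c" "Cod V t = b" "Dom V \<rho> = X" "Cod V \<rho> = X \<otimes> c"
    "Dom V \<delta> = c" "Cod V \<delta> = c \<otimes> c" "\<nu> \<in> Arr V" "Dom V \<nu> = b \<otimes> b"
    and coassoc: "ext12 X c \<rho> c \<cdot> \<rho> = (\<i> X \<otimes>\<^sub>a \<delta>) \<cdot> \<rho>"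
  shows "(\<i> X \<otimes>\<^sub>a \<nu>) \<cdot> ext22 a X X b (act a X c t \<rho>) b \<cdot> (\<i> a \<otimes>\<^sub>a act a X c t \<rho>)
    = (\<i> X \<otimes>\<^sub>a (\<nu> \<cdot> ext21 a c t b \<cdot>
        (\<i> a \<otimes>\<^sub>a ((\<i> c \<otimes>\<^sub>a t) \<cdot> braid_ext a c c \<cdot> (\<i> a \<otimes>\<^sub>a \<delta>))))) \<cdot> act2 a X c \<rho>"
proof -
  let ?g = "(\<i> c \<otimes>\<^sub>a t) \<cdot> braid_ext a c c \<cdot> (\<i> a \<otimes>\<^sub>a \<delta>)"
  have e: "ext22 a X X b (act a X c t \<rho>) b
      = (\<i> X \<otimes>\<^sub>a ext21 a c t b) \<cdot> braid_ext a X (c \<otimes> b) \<cdot> (\<i> a \<otimes>\<^sub>a ext12 X c \<rho> b)"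
    unfolding act_def by (rule ext22_comp) simp_all
  have "(\<i> X \<otimes>\<^sub>a \<nu>) \<cdot> ext22 a X X b (act a X c t \<rho>) b \<cdot> (\<i> a \<otimes>\<^sub>a act a X c t \<rho>)
      = (\<i> X \<otimes>\<^sub>a (\<nu> \<cdot> ext21 a c t b)) \<cdot> braid_ext a X (c \<otimes> b) \<cdot> (\<i> a \<otimes>\<^sub>a (ext12 X c \<rho> b \<cdot> act a X c t \<rho>))"
    unfolding e by simp
  also have "\<dots> = (\<i> X \<otimes>\<^sub>a (\<nu> \<cdot> ext21 a c t b)) \<cdot> (braid_ext a X (c \<otimes> b) \<cdot> (\<i> a \<otimes>\<^sub>a (\<i> X \<otimes>\<^sub>a ?g))) \<cdot>
      (\<i> a \<otimes>\<^sub>a braid_ext a X c) \<cdot> (\<i> a \<otimes>\<^sub>a (\<i> a \<otimes>\<^sub>a \<rho>))"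
    by (simp add: ext12_act[where \<delta> = \<delta>] coassoc)
  also have "\<dots> = (\<i> X \<otimes>\<^sub>a (\<nu> \<cdot> ext21 a c t b \<cdot> (\<i> a \<otimes>\<^sub>a ?g))) \<cdot> act2 a X c \<rho>"
    by (subst ext22_nat) (simp_all add: act2_def)
  finally show ?thesis .
qed

text \<open>A product crosses \<open>X\<close> as its factors do (\<open>braid_ext21_ext\<close>),
  so the multiplication can be postponed until after \<open>act2\<close>.\<close>

lemma act_mult_left:
  assumes [simp]: "a \<in> Obj V" "X \<in> Obj V" "c \<in> Obj V" "t \<in> Arr V" "\<rho> \<in> Arr V"
    "Dom V t = a \<otimes> c" "Dom V \<rho> = X" "Cod V \<rho> = X \<otimes> c"
    "\<mu> \<in> Arr V" "Dom V \<mu> = a \<otimes> a" "Cod V \<mu> = a"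
  shows "act a X c t \<rho> \<cdot> ext21 a a \<mu> X = (\<i> X \<otimes>\<^sub>a (t \<cdot> ext21 a a \<mu> c)) \<cdot> act2 a X c \<rho>"
proof -
  have "(\<i> a \<otimes>\<^sub>a \<rho>) \<cdot> ext21 a a \<mu> X = ext21 a a \<mu> (X \<otimes> c) \<cdot> (\<i> a \<otimes>\<^sub>a (\<i> a \<otimes>\<^sub>a \<rho>))"
    by (simp add: ext21_nat)
  then have "act a X c t \<rho> \<cdot> ext21 a a \<mu> X
      = (\<i> X \<otimes>\<^sub>a t) \<cdot> (braid_ext a X c \<cdot> ext21 a a \<mu> (X \<otimes> c)) \<cdot> (\<i> a \<otimes>\<^sub>a (\<i> a \<otimes>\<^sub>a \<rho>))"
    by (simp add: act_def)
  also have "\<dots> = (\<i> X \<otimes>\<^sub>a (t \<cdot> ext21 a a \<mu> c)) \<cdot> act2 a X c \<rho>"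
    by (simp add: braid_ext21_ext act2_def)
  finally show ?thesis .
qed

text \<open>By \<open>braid_unit_left\<close> the crossing of the unit object with \<open>X\<close>
  reduces to unitors, so \<open>\<iota>\<close> passes directly to \<open>t\<close>.\<close>

lemma act_unit:
  assumes [simp]: "a \<in> Obj V" "X \<in> Obj V" "c \<in> Obj V" "t \<in> Arr V" "\<rho> \<in> Arr V"
    "Dom V t = a \<otimes> c" "Dom V \<rho> = X" "Cod V \<rho> = X \<otimes> c"
    "\<iota> \<in> Arr V" "Dom V \<iota> = \<I>" "Cod V \<iota> = a"
  shows "act a X c t \<rho> \<cdot> (\<iota> \<otimes>\<^sub>a \<i> X) \<cdot> \<i>\<n>\<v> (\<l> X) = (\<i> X \<otimes>\<^sub>a (t \<cdot> (\<iota> \<otimes>\<^sub>a \<i> c) \<cdot> \<i>\<n>\<v> (\<l> c))) \<cdot> \<rho>"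
proof -
  have l: "\<i>\<n>\<v> (\<l> (X \<otimes> c)) \<cdot> \<rho> = (\<i> \<I> \<otimes>\<^sub>a \<rho>) \<cdot> \<i>\<n>\<v> (\<l> X)"
    by (simp add: lunit_inv_nat)
  have cr: "\<c> \<I> X = \<i>\<n>\<v> (\<r> X) \<cdot> \<l> X"
    unfolding braid_unit_left[OF \<open>X \<in> Obj V\<close>, symmetric] by simp
  have "act a X c t \<rho> \<cdot> (\<iota> \<otimes>\<^sub>a \<i> X) \<cdot> \<i>\<n>\<v> (\<l> X)
      = (\<i> X \<otimes>\<^sub>a t) \<cdot> braid_ext a X c \<cdot> (\<iota> \<otimes>\<^sub>a \<i> (X \<otimes> c)) \<cdot> ((\<i> \<I> \<otimes>\<^sub>a \<rho>) \<cdot> \<i>\<n>\<v> (\<l> X))"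
    by (simp add: act_def)
  also have "\<dots> = (\<i> X \<otimes>\<^sub>a t) \<cdot> \<a> X a c \<cdot> (\<c> a X \<otimes>\<^sub>a \<i> c) \<cdot>
      (\<i>\<n>\<v> (\<a> a X c) \<cdot> (\<iota> \<otimes>\<^sub>a (\<i> X \<otimes>\<^sub>a \<i> c))) \<cdot> \<i>\<n>\<v> (\<l> (X \<otimes> c)) \<cdot> \<rho>"
    unfolding l[symmetric] by (simp add: ext22_def)
  also have "\<dots> = (\<i> X \<otimes>\<^sub>a t) \<cdot> \<a> X a c \<cdot> ((\<c> a X \<cdot> (\<iota> \<otimes>\<^sub>a \<i> X)) \<otimes>\<^sub>a \<i> c) \<cdot>
      (\<i>\<n>\<v> (\<a> \<I> X c) \<cdot> \<i>\<n>\<v> (\<l> (X \<otimes> c))) \<cdot> \<rho>"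
    by (subst assoc_inv_nat) simp_all
  also have "\<dots> = (\<i> X \<otimes>\<^sub>a t) \<cdot> \<a> X a c \<cdot> ((\<c> a X \<cdot> (\<iota> \<otimes>\<^sub>a \<i> X)) \<otimes>\<^sub>a \<i> c) \<cdot>
      (\<i>\<n>\<v> (\<l> X) \<otimes>\<^sub>a \<i> c) \<cdot> \<rho>"
    unfolding lunit_inv_tens[OF \<open>X \<in> Obj V\<close> \<open>c \<in> Obj V\<close>, symmetric] by simp
  also have "\<dots> = (\<i> X \<otimes>\<^sub>a t) \<cdot> \<a> X a c \<cdot> (((\<i> X \<otimes>\<^sub>a \<iota>) \<cdot> \<i>\<n>\<v> (\<r> X)) \<otimes>\<^sub>a \<i> c) \<cdot> \<rho>"
    by (simp add: braid_nat cr)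
  also have "\<dots> = (\<i> X \<otimes>\<^sub>a t) \<cdot> (\<i> X \<otimes>\<^sub>a (\<iota> \<otimes>\<^sub>a \<i> c)) \<cdot> (\<a> X \<I> c \<cdot> (\<i>\<n>\<v> (\<r> X) \<otimes>\<^sub>a \<i> c)) \<cdot> \<rho>"
    by (simp add: push)
  also have "\<dots> = (\<i> X \<otimes>\<^sub>a (t \<cdot> (\<iota> \<otimes>\<^sub>a \<i> c) \<cdot> \<i>\<n>\<v> (\<l> c))) \<cdot> \<rho>"
    by (simp add: triangle_inv)
  finally show ?thesis .
qed

lemma braid_ext_nat:
  assumes [simp]: "a \<in> Obj V" "c \<in> Obj V" "f \<in> Arr V" "Dom V f = X" "Cod V f = X'"
  shows "braid_ext a X' c \<cdot> (\<i> a \<otimes>\<^sub>a (f \<otimes>\<^sub>a \<i> c)) = (f \<otimes>\<^sub>a \<i> (a \<otimes> c)) \<cdot> braid_ext a X c"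
proof -
  have [simp]: "X \<in> Obj V" "X' \<in> Obj V" using Dom_Cod_Obj[of f] by simp_all
  have n: "(f \<otimes>\<^sub>a \<i> (a \<otimes> c)) \<cdot> \<a> X a c = \<a> X' a c \<cdot> ((f \<otimes>\<^sub>a \<i> a) \<otimes>\<^sub>a \<i> c)"
    by (simp add: assoc_nat)
  have "braid_ext a X' c \<cdot> (\<i> a \<otimes>\<^sub>a (f \<otimes>\<^sub>a \<i> c)) = (\<a> X' a c \<cdot> ((f \<otimes>\<^sub>a \<i> a) \<otimes>\<^sub>a \<i> c)) \<cdot> (\<c> a X \<otimes>\<^sub>a \<i> c) \<cdot> \<i>\<n>\<v> (\<a> a X c)"
    by (simp add: ext22_def pull_inv braid_nat)
  then show ?thesis unfolding n[symmetric] by (simp add: ext22_def)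
qed

text \<open>The easy half of the comparison of morphisms: \<open>f\<close> acts on the strand
  \<open>X\<close>, which \<open>a\<close> crosses naturally, and never meets
  \<open>t\<close>.\<close>

lemma act_morphism:
  assumes [simp]: "a \<in> Obj V" "b \<in> Obj V" "X \<in> Obj V" "X' \<in> Obj V" "c \<in> Obj V" "t \<in> Arr V" "\<rho> \<in> Arr V" "\<rho>' \<in> Arr V"
    "Dom V t = a \<otimes> c" "Cod V t = b" "Dom V \<rho> = X" "Cod V \<rho> = X \<otimes> c" "Dom V \<rho>' = X'" "Cod V \<rho>' = X' \<otimes> c"
    "f \<in> Arr V" "Dom V f = X" "Cod V f = X'"
    and f: "(f \<otimes>\<^sub>a \<i> c) \<cdot> \<rho> = \<rho>' \<cdot> f"
  shows "(f \<otimes>\<^sub>a \<i> b) \<cdot> act a X c t \<rho> = act a X' c t \<rho>' \<cdot> (\<i> a \<otimes>\<^sub>a f)"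
proof -
  have "(f \<otimes>\<^sub>a \<i> b) \<cdot> act a X c t \<rho> = (\<i> X' \<otimes>\<^sub>a t) \<cdot> ((f \<otimes>\<^sub>a \<i> (a \<otimes> c)) \<cdot> braid_ext a X c) \<cdot> (\<i> a \<otimes>\<^sub>a \<rho>)"
    by (simp add: act_def)
  also have "\<dots> = (\<i> X' \<otimes>\<^sub>a t) \<cdot> braid_ext a X' c \<cdot> (\<i> a \<otimes>\<^sub>a ((f \<otimes>\<^sub>a \<i> c) \<cdot> \<rho>))"
    by (subst braid_ext_nat[of a c f X X', symmetric]) simp_all
  also have "\<dots> = act a X' c t \<rho>' \<cdot> (\<i> a \<otimes>\<^sub>a f)"
    unfolding f by (simp add: act_def)
  finally show ?thesis .
qed

end

section \<open>Iterated coactions and change of coefficients\<close>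

context monoidal_category
begin

text \<open>Mirror image of \<open>lunit_tens\<close>: pentagon and triangle are applied after
  tensoring with the unit on the right.\<close>

lemma runit_tens:
  assumes [simp]: "X \<in> Obj V" "Y \<in> Obj V"
  shows "(\<i> X \<otimes>\<^sub>a \<r> Y) \<cdot> \<a> X Y \<I> = \<r> (X \<otimes> Y)"
proof (rule unit_right_faithful)
  have "\<a> X Y \<I> \<cdot> (((\<i> X \<otimes>\<^sub>a \<r> Y) \<cdot> \<a> X Y \<I>) \<otimes>\<^sub>a \<i> \<I>)
      = (\<i> X \<otimes>\<^sub>a (\<r> Y \<otimes>\<^sub>a \<i> \<I>)) \<cdot> \<a> X (Y \<otimes> \<I>) \<I> \<cdot> (\<a> X Y \<I> \<otimes>\<^sub>a \<i> \<I>)"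
    by (subst assoc_push) simp_all
  also have "\<dots> = (\<i> X \<otimes>\<^sub>a (\<i> Y \<otimes>\<^sub>a \<l> \<I>)) \<cdot> ((\<i> X \<otimes>\<^sub>a \<a> Y \<I> \<I>) \<cdot> \<a> X (Y \<otimes> \<I>) \<I> \<cdot> (\<a> X Y \<I> \<otimes>\<^sub>a \<i> \<I>))"
    unfolding triangle[OF assms(2) unit_Obj, symmetric] by simp
  also have "\<dots> = ((\<i> X \<otimes>\<^sub>a (\<i> Y \<otimes>\<^sub>a \<l> \<I>)) \<cdot> \<a> X Y (\<I> \<otimes> \<I>)) \<cdot> \<a> (X \<otimes> Y) \<I> \<I>"
    unfolding pentagon[OF assms unit_Obj unit_Obj] by simp
  also have "\<dots> = (\<a> X Y \<I> \<cdot> ((\<i> X \<otimes>\<^sub>a \<i> Y) \<otimes>\<^sub>a \<l> \<I>)) \<cdot> \<a> (X \<otimes> Y) \<I> \<I>"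
    by (subst assoc_nat) simp_all
  also have "\<dots> = \<a> X Y \<I> \<cdot> (\<r> (X \<otimes> Y) \<otimes>\<^sub>a \<i> \<I>)"
    using triangle[of "X \<otimes> Y" \<I>] by simp
  finally show "((\<i> X \<otimes>\<^sub>a \<r> Y) \<cdot> \<a> X Y \<I>) \<otimes>\<^sub>a \<i> \<I> = \<r> (X \<otimes> Y) \<otimes>\<^sub>a \<i> \<I>"
    by (rule iso_left_cancel[of "\<a> X Y \<I>", rotated -1]) simp_all
qed simp_all

lemma runit_ext12:
  assumes [simp]: "\<rho> \<in> Arr V" "X \<in> Obj V" "C \<in> Obj V" "Dom V \<rho> = U" "Cod V \<rho> = X \<otimes> C"
  shows "(\<i> X \<otimes>\<^sub>a \<r> C) \<cdot> ext12 X C \<rho> \<I> = \<rho> \<cdot> \<r> U"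
proof -
  have [simp]: "U \<in> Obj V" using Dom_Cod_Obj[of \<rho>] by simp
  have "(\<i> X \<otimes>\<^sub>a \<r> C) \<cdot> ext12 X C \<rho> \<I> = ((\<i> X \<otimes>\<^sub>a \<r> C) \<cdot> \<a> X C \<I>) \<cdot> (\<rho> \<otimes>\<^sub>a \<i> \<I>)"
    by (simp add: ext12_def)
  then show ?thesis by (simp add: runit_tens runit_nat)
qed

lemma runit_inv_nat:
  assumes "f \<in> Arr V" "Cod V f = Y"
  shows "\<i>\<n>\<v> (\<r> Y) \<cdot> f = (f \<otimes>\<^sub>a \<i> \<I>) \<cdot> \<i>\<n>\<v> (\<r> (Dom V f))"
proof -
  have [simp]: "Y \<in> Obj V" using assms by auto
  have "\<i>\<n>\<v> (\<r> Y) \<cdot> f = \<i>\<n>\<v> (\<r> Y) \<cdot> (f \<cdot> \<r> (Dom V f)) \<cdot> \<i>\<n>\<v> (\<r> (Dom V f))" using assms by simp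
  also have "\<dots> = (f \<otimes>\<^sub>a \<i> \<I>) \<cdot> \<i>\<n>\<v> (\<r> (Dom V f))"
    unfolding runit_nat[OF assms, symmetric] using assms by simp
  finally show ?thesis .
qed

text \<open>Both sides are the threefold iterated coaction. Hence \<open>\<delta>\<close> is
  coassociative as soon as arrows out of \<open>D\<close> can be tested on coactions; the two counit
  lemmas serve the same purpose.\<close>

lemma coaction_coassoc:
  assumes [simp]: "X \<in> Obj V" "D \<in> Obj V" "\<rho> \<in> Arr V" "Dom V \<rho> = X" "Cod V \<rho> = X \<otimes> D"
    "\<delta> \<in> Arr V" "Dom V \<delta> = D" "Cod V \<delta> = D \<otimes> D"
    and coassoc: "(\<i> X \<otimes>\<^sub>a \<delta>) \<cdot> \<rho> = ext12 X D \<rho> D \<cdot> \<rho>"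
  shows "(\<i> X \<otimes>\<^sub>a (\<a> D D D \<cdot> (\<delta> \<otimes>\<^sub>a \<i> D) \<cdot> \<delta>)) \<cdot> \<rho> = (\<i> X \<otimes>\<^sub>a ((\<i> D \<otimes>\<^sub>a \<delta>) \<cdot> \<delta>)) \<cdot> \<rho>"
proof -
  have "(\<i> X \<otimes>\<^sub>a (\<a> D D D \<cdot> (\<delta> \<otimes>\<^sub>a \<i> D) \<cdot> \<delta>)) \<cdot> \<rho>
      = (\<i> X \<otimes>\<^sub>a (\<a> D D D \<cdot> (\<delta> \<otimes>\<^sub>a \<i> D))) \<cdot> (\<i> X \<otimes>\<^sub>a \<delta>) \<cdot> \<rho>"
    by simp
  also have "\<dots> = (\<i> X \<otimes>\<^sub>a \<a> D D D) \<cdot> ((\<i> X \<otimes>\<^sub>a (\<delta> \<otimes>\<^sub>a \<i> D)) \<cdot> \<a> X D D) \<cdot> (\<rho> \<otimes>\<^sub>a \<i> D) \<cdot> \<rho>"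
    unfolding coassoc by (simp add: ext12_def)
  also have "\<dots> = (\<i> X \<otimes>\<^sub>a \<a> D D D) \<cdot> \<a> X (D \<otimes> D) D \<cdot> (((\<i> X \<otimes>\<^sub>a \<delta>) \<cdot> \<rho>) \<otimes>\<^sub>a \<i> D) \<cdot> \<rho>"
    by (simp add: push)
  also have "\<dots> = \<a> X D (D \<otimes> D) \<cdot> \<a> (X \<otimes> D) D D \<cdot> (((\<rho> \<otimes>\<^sub>a \<i> D) \<cdot> \<rho>) \<otimes>\<^sub>a \<i> D) \<cdot> \<rho>"
    unfolding coassoc by (simp add: ext12_def push)
  also have "\<dots> = \<a> X D (D \<otimes> D) \<cdot> (\<rho> \<otimes>\<^sub>a \<i> (D \<otimes> D)) \<cdot> (ext12 X D \<rho> D \<cdot> \<rho>)"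
    by (simp add: ext12_def push)
  also have "\<dots> = (\<a> X D (D \<otimes> D) \<cdot> (\<i> (X \<otimes> D) \<otimes>\<^sub>a \<delta>)) \<cdot> (\<rho> \<otimes>\<^sub>a \<i> D) \<cdot> \<rho>"
    unfolding coassoc[symmetric] by simp
  also have "\<dots> = (\<i> X \<otimes>\<^sub>a (\<i> D \<otimes>\<^sub>a \<delta>)) \<cdot> (ext12 X D \<rho> D \<cdot> \<rho>)"
    using assoc_nat[of "\<i> X" "\<i> D" \<delta> X D "D \<otimes> D"] by (simp add: ext12_def)
  also have "\<dots> = (\<i> X \<otimes>\<^sub>a ((\<i> D \<otimes>\<^sub>a \<delta>) \<cdot> \<delta>)) \<cdot> \<rho>"
    unfolding coassoc[symmetric] by simp
  finally show ?thesis .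
qed

lemma coaction_counit_left:
  assumes [simp]: "X \<in> Obj V" "D \<in> Obj V" "\<rho> \<in> Arr V" "Dom V \<rho> = X" "Cod V \<rho> = X \<otimes> D"
    "\<delta> \<in> Arr V" "Dom V \<delta> = D" "Cod V \<delta> = D \<otimes> D" "\<epsilon> \<in> Arr V" "Dom V \<epsilon> = D" "Cod V \<epsilon> = \<I>"
    and coassoc: "(\<i> X \<otimes>\<^sub>a \<delta>) \<cdot> \<rho> = ext12 X D \<rho> D \<cdot> \<rho>"
    and counit: "(\<i> X \<otimes>\<^sub>a \<epsilon>) \<cdot> \<rho> = \<i>\<n>\<v> (\<r> X)"
  shows "(\<i> X \<otimes>\<^sub>a (\<l> D \<cdot> (\<epsilon> \<otimes>\<^sub>a \<i> D) \<cdot> \<delta>)) \<cdot> \<rho> = \<rho>"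
proof -
  have "(\<i> X \<otimes>\<^sub>a (\<l> D \<cdot> (\<epsilon> \<otimes>\<^sub>a \<i> D) \<cdot> \<delta>)) \<cdot> \<rho> = (\<i> X \<otimes>\<^sub>a (\<l> D \<cdot> (\<epsilon> \<otimes>\<^sub>a \<i> D))) \<cdot> (\<i> X \<otimes>\<^sub>a \<delta>) \<cdot> \<rho>"
    by simp
  also have "\<dots> = (\<i> X \<otimes>\<^sub>a \<l> D) \<cdot> ((\<i> X \<otimes>\<^sub>a (\<epsilon> \<otimes>\<^sub>a \<i> D)) \<cdot> \<a> X D D) \<cdot> (\<rho> \<otimes>\<^sub>a \<i> D) \<cdot> \<rho>"
    unfolding coassoc by (simp add: ext12_def)
  also have "\<dots> = (\<i> X \<otimes>\<^sub>a \<l> D) \<cdot> \<a> X \<I> D \<cdot> (((\<i> X \<otimes>\<^sub>a \<epsilon>) \<cdot> \<rho>) \<otimes>\<^sub>a \<i> D) \<cdot> \<rho>"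
    by (simp add: push)
  also have "\<dots> = (\<i> X \<otimes>\<^sub>a \<l> D) \<cdot> (\<a> X \<I> D \<cdot> (\<i>\<n>\<v> (\<r> X) \<otimes>\<^sub>a \<i> D)) \<cdot> \<rho>"
    unfolding counit by simp
  also have "\<dots> = \<rho>"
    by (simp add: triangle_inv)
  finally show ?thesis .
qed

lemma coaction_counit_right:
  assumes [simp]: "X \<in> Obj V" "D \<in> Obj V" "\<rho> \<in> Arr V" "Dom V \<rho> = X" "Cod V \<rho> = X \<otimes> D"
    "\<delta> \<in> Arr V" "Dom V \<delta> = D" "Cod V \<delta> = D \<otimes> D" "\<epsilon> \<in> Arr V" "Dom V \<epsilon> = D" "Cod V \<epsilon> = \<I>"
    and coassoc: "(\<i> X \<otimes>\<^sub>a \<delta>) \<cdot> \<rho> = ext12 X D \<rho> D \<cdot> \<rho>"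
    and counit: "(\<i> X \<otimes>\<^sub>a \<epsilon>) \<cdot> \<rho> = \<i>\<n>\<v> (\<r> X)"
  shows "(\<i> X \<otimes>\<^sub>a (\<r> D \<cdot> (\<i> D \<otimes>\<^sub>a \<epsilon>) \<cdot> \<delta>)) \<cdot> \<rho> = \<rho>"
proof -
  have n: "(\<i> X \<otimes>\<^sub>a (\<i> D \<otimes>\<^sub>a \<epsilon>)) \<cdot> ext12 X D \<rho> D = ext12 X D \<rho> \<I> \<cdot> (\<i> X \<otimes>\<^sub>a \<epsilon>)"
    using ext12_nat[of \<rho> \<epsilon> X D X \<I>] by simp
  have "(\<i> X \<otimes>\<^sub>a (\<r> D \<cdot> (\<i> D \<otimes>\<^sub>a \<epsilon>) \<cdot> \<delta>)) \<cdot> \<rho> = (\<i> X \<otimes>\<^sub>a (\<r> D \<cdot> (\<i> D \<otimes>\<^sub>a \<epsilon>))) \<cdot> (\<i> X \<otimes>\<^sub>a \<delta>) \<cdot> \<rho>"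
    by simp
  also have "\<dots> = (\<i> X \<otimes>\<^sub>a \<r> D) \<cdot> ((\<i> X \<otimes>\<^sub>a (\<i> D \<otimes>\<^sub>a \<epsilon>)) \<cdot> ext12 X D \<rho> D) \<cdot> \<rho>"
    unfolding coassoc by simp
  also have "\<dots> = ((\<i> X \<otimes>\<^sub>a \<r> D) \<cdot> ext12 X D \<rho> \<I>) \<cdot> ((\<i> X \<otimes>\<^sub>a \<epsilon>) \<cdot> \<rho>)"
    unfolding n by simp
  also have "\<dots> = \<rho>"
    unfolding counit by (simp add: runit_ext12)
  finally show ?thesis .
qed

text \<open>\<open>g\<close> can be applied to both coefficients after coacting twice. This shows
  that comonoid maps push comodules forward, and later that an arrow is a comonoid map because its
  pushforwards are comodules.\<close>

lemma coaction_push: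
  assumes [simp]: "X \<in> Obj V" "D \<in> Obj V" "p \<in> Obj V" "\<rho> \<in> Arr V" "Dom V \<rho> = X" "Cod V \<rho> = X \<otimes> D"
    "g \<in> Arr V" "Dom V g = D" "Cod V g = p"
  shows "ext12 X p ((\<i> X \<otimes>\<^sub>a g) \<cdot> \<rho>) p \<cdot> (\<i> X \<otimes>\<^sub>a g) \<cdot> \<rho> = (\<i> X \<otimes>\<^sub>a (g \<otimes>\<^sub>a g)) \<cdot> ext12 X D \<rho> D \<cdot> \<rho>"
proof -
  have "ext12 X p ((\<i> X \<otimes>\<^sub>a g) \<cdot> \<rho>) p \<cdot> (\<i> X \<otimes>\<^sub>a g) \<cdot> \<rho> = \<a> X p p \<cdot> (((\<i> X \<otimes>\<^sub>a g) \<cdot> \<rho>) \<otimes>\<^sub>a g) \<cdot> \<rho>"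
    by (simp add: ext12_def)
  also have "\<dots> = (\<i> X \<otimes>\<^sub>a (g \<otimes>\<^sub>a g)) \<cdot> ext12 X D \<rho> D \<cdot> \<rho>"
    by (simp add: ext12_def push)
  finally show ?thesis .
qed

lemma is_comodule_push:
  assumes C: "is_comon V C" and P: "is_comon V P" and \<rho>: "is_comodule C X \<rho>" and g: "g \<in> comon_hom V C P"
  shows "is_comodule P X ((\<i> X \<otimes>\<^sub>a g) \<cdot> \<rho>)"
proof -
  let ?c = "comon_obj C" and ?p = "comon_obj P"
  note [simp] = comon_typing[OF C] comon_typing[OF P]
  have [simp]: "X \<in> Obj V" "\<rho> \<in> Arr V" "Dom V \<rho> = X" "Cod V \<rho> = X \<otimes> ?c" "g \<in> Arr V" "Dom V g = ?c" "Cod V g = ?p"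
    and g\<delta>: "comon_comult P \<cdot> g = (g \<otimes>\<^sub>a g) \<cdot> comon_comult C" and g\<epsilon>: "comon_counit P \<cdot> g = comon_counit C"
    and coassoc: "ext12 X ?c \<rho> ?c \<cdot> \<rho> = (\<i> X \<otimes>\<^sub>a comon_comult C) \<cdot> \<rho>"
    and counit: "\<r> X \<cdot> (\<i> X \<otimes>\<^sub>a comon_counit C) \<cdot> \<rho> = \<i> X"
    using \<rho> g by (auto simp: is_comodule_def comon_hom_def)
  have "ext12 X ?p ((\<i> X \<otimes>\<^sub>a g) \<cdot> \<rho>) ?p \<cdot> (\<i> X \<otimes>\<^sub>a g) \<cdot> \<rho>
      = (\<i> X \<otimes>\<^sub>a (g \<otimes>\<^sub>a g)) \<cdot> (ext12 X ?c \<rho> ?c \<cdot> \<rho>)"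
    by (rule coaction_push) simp_all
  also have "\<dots> = (\<i> X \<otimes>\<^sub>a comon_comult P) \<cdot> (\<i> X \<otimes>\<^sub>a g) \<cdot> \<rho>"
    unfolding coassoc by (simp add: g\<delta>)
  finally show ?thesis
    using counit by (simp add: is_comodule_def g\<epsilon>)
qed

end

context braided_monoidal_category
begin

text \<open>\<open>g\<close> passes the crossing by naturality and is absorbed into
  \<open>t\<close>. This links comonoid maps into \<open>P\<close> with the measurings they
  induce.\<close>

lemma act_push:
  assumes [simp]: "a \<in> Obj V" "X \<in> Obj V" "c \<in> Obj V" "p \<in> Obj V" "t \<in> Arr V" "\<rho> \<in> Arr V" "g \<in> Arr V"
    "Dom V t = a \<otimes> p" "Dom V \<rho> = X" "Cod V \<rho> = X \<otimes> c" "Dom V g = c" "Cod V g = p"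
  shows "act a X p t ((\<i> X \<otimes>\<^sub>a g) \<cdot> \<rho>) = act a X c (t \<cdot> (\<i> a \<otimes>\<^sub>a g)) \<rho>"
proof -
  have "act a X p t ((\<i> X \<otimes>\<^sub>a g) \<cdot> \<rho>) = (\<i> X \<otimes>\<^sub>a t) \<cdot> (braid_ext a X p \<cdot> (\<i> a \<otimes>\<^sub>a (\<i> X \<otimes>\<^sub>a g))) \<cdot> (\<i> a \<otimes>\<^sub>a \<rho>)"
    by (simp add: act_def)
  also have "\<dots> = act a X c (t \<cdot> (\<i> a \<otimes>\<^sub>a g)) \<rho>"
    by (simp add: ext22_nat act_def)
  finally show ?thesis .
qed

text \<open>Brings \<open>act\<close> into the shape to which a universal coaction applies, with
  \<open>a\<close> as the parameter on the right. As \<open>\<c> a c\<close> is invertible, every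
  \<open>t\<close> has the form \<open>s \<cdot> \<c> a c\<close>.\<close>

lemma act_ext12:
  assumes [simp]: "a \<in> Obj V" "X \<in> Obj V" "c \<in> Obj V" "s \<in> Arr V" "\<rho> \<in> Arr V"
    "Dom V s = c \<otimes> a" "Dom V \<rho> = X" "Cod V \<rho> = X \<otimes> c"
  shows "act a X c (s \<cdot> \<c> a c) \<rho> = (\<i> X \<otimes>\<^sub>a s) \<cdot> ext12 X c \<rho> a \<cdot> \<c> a X"
proof -
  have "act a X c (s \<cdot> \<c> a c) \<rho> = (\<i> X \<otimes>\<^sub>a s) \<cdot> ((\<i> X \<otimes>\<^sub>a \<c> a c) \<cdot> braid_ext a X c \<cdot> (\<i> a \<otimes>\<^sub>a \<rho>))"
    by (simp add: act_def)
  then show ?thesis by (simp add: braid_ext12)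
qed

text \<open>The same device for both copies of \<open>a\<close>, which together become the parameter
  \<open>a \<otimes> a\<close>.\<close>

lemma act2_ext12:
  assumes [simp]: "a \<in> Obj V" "X \<in> Obj V" "c \<in> Obj V" "\<rho> \<in> Arr V" "Dom V \<rho> = X" "Cod V \<rho> = X \<otimes> c"
  shows "(\<i> X \<otimes>\<^sub>a (braid_ext a c a \<cdot> (\<i> a \<otimes>\<^sub>a \<c> a c))) \<cdot> act2 a X c \<rho>
    = ext12 X c \<rho> (a \<otimes> a) \<cdot> braid_ext a X a \<cdot> (\<i> a \<otimes>\<^sub>a \<c> a X)"
proof -
  have n: "(\<i> X \<otimes>\<^sub>a (\<i> a \<otimes>\<^sub>a \<c> a c)) \<cdot> braid_ext a X (a \<otimes> c)
      = braid_ext a X (c \<otimes> a) \<cdot> (\<i> a \<otimes>\<^sub>a (\<i> X \<otimes>\<^sub>a \<c> a c))"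
    by (simp add: ext22_nat)
  have "(\<i> X \<otimes>\<^sub>a (braid_ext a c a \<cdot> (\<i> a \<otimes>\<^sub>a \<c> a c))) \<cdot> act2 a X c \<rho>
      = (\<i> X \<otimes>\<^sub>a braid_ext a c a) \<cdot> ((\<i> X \<otimes>\<^sub>a (\<i> a \<otimes>\<^sub>a \<c> a c)) \<cdot> braid_ext a X (a \<otimes> c)) \<cdot>
        (\<i> a \<otimes>\<^sub>a (braid_ext a X c \<cdot> (\<i> a \<otimes>\<^sub>a \<rho>)))"
    by (simp add: act2_def)
  also have "\<dots> = (\<i> X \<otimes>\<^sub>a braid_ext a c a) \<cdot> braid_ext a X (c \<otimes> a) \<cdot>
        (\<i> a \<otimes>\<^sub>a ((\<i> X \<otimes>\<^sub>a \<c> a c) \<cdot> braid_ext a X c \<cdot> (\<i> a \<otimes>\<^sub>a \<rho>)))"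
    unfolding n by simp
  also have "\<dots> = ((\<i> X \<otimes>\<^sub>a braid_ext a c a) \<cdot> braid_ext a X (c \<otimes> a) \<cdot> (\<i> a \<otimes>\<^sub>a ext12 X c \<rho> a)) \<cdot> (\<i> a \<otimes>\<^sub>a \<c> a X)"
    by (simp add: braid_ext12)
  also have "\<dots> = ext12 X c \<rho> (a \<otimes> a) \<cdot> braid_ext a X a \<cdot> (\<i> a \<otimes>\<^sub>a \<c> a X)"
    by (subst braid_ext12_ext[where U = X]) simp_all
  finally show ?thesis .
qed

end

section \<open>Tannaka reconstruction\<close>

text \<open>\<open>D\<close> represents the functor sending \<open>Z\<close> to the families of arrows \<open>X \<rightarrow> X \<otimes> Z\<close> and \<open>X' \<rightarrow> X' \<otimes> Z\<close>
  natural in \<open>f\<close>, and continues to do so after tensoring with any \<open>R\<close>.\<close>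

locale universal_coaction = braided_monoidal_category V
  for V :: "('o, 'm, 'z) braided_closed_cat_scheme" (structure) +
  fixes X X' D :: 'o and f \<rho> \<rho>' :: 'm
  assumes objects [simp]: "X \<in> Obj V" "X' \<in> Obj V" "D \<in> Obj V"
    and arrows [simp]: "f \<in> Arr V" "Dom V f = X" "Cod V f = X'"
      "\<rho> \<in> Arr V" "Dom V \<rho> = X" "Cod V \<rho> = X \<otimes> D" "\<rho>' \<in> Arr V" "Dom V \<rho>' = X'" "Cod V \<rho>' = X' \<otimes> D"
    and compatible: "(f \<otimes>\<^sub>a \<i> D) \<cdot> \<rho> = \<rho>' \<cdot> f"
    and separating: "R \<in> Obj V \<Longrightarrow> s \<in> hom V (D \<otimes> R) Z \<Longrightarrow> s' \<in> hom V (D \<otimes> R) Z \<Longrightarrow>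
      (\<i> X \<otimes>\<^sub>a s) \<cdot> ext12 X D \<rho> R = (\<i> X \<otimes>\<^sub>a s') \<cdot> ext12 X D \<rho> R \<Longrightarrow>
      (\<i> X' \<otimes>\<^sub>a s) \<cdot> ext12 X' D \<rho>' R = (\<i> X' \<otimes>\<^sub>a s') \<cdot> ext12 X' D \<rho>' R \<Longrightarrow> s = s'"
    and factor: "R \<in> Obj V \<Longrightarrow> Z \<in> Obj V \<Longrightarrow>
      \<alpha> \<in> hom V (X \<otimes> R) (X \<otimes> Z) \<Longrightarrow> \<alpha>' \<in> hom V (X' \<otimes> R) (X' \<otimes> Z) \<Longrightarrow>
      (f \<otimes>\<^sub>a \<i> Z) \<cdot> \<alpha> = \<alpha>' \<cdot> (f \<otimes>\<^sub>a \<i> R) \<Longrightarrow>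
      \<exists>s \<in> hom V (D \<otimes> R) Z. (\<i> X \<otimes>\<^sub>a s) \<cdot> ext12 X D \<rho> R = \<alpha> \<and> (\<i> X' \<otimes>\<^sub>a s) \<cdot> ext12 X' D \<rho>' R = \<alpha>'"
begin

text \<open>The case of the unit parameter: \<open>\<r> D\<close> identifies
  \<open>D \<otimes> \<I>\<close> with \<open>D\<close>, and \<open>runit_ext12\<close> removes the
  extension.\<close>

lemma separating_plain:
  assumes [simp]: "s \<in> Arr V" "s' \<in> Arr V" "Dom V s = D" "Dom V s' = D" "Cod V s = Z" "Cod V s' = Z"
    and e: "(\<i> X \<otimes>\<^sub>a s) \<cdot> \<rho> = (\<i> X \<otimes>\<^sub>a s') \<cdot> \<rho>" "(\<i> X' \<otimes>\<^sub>a s) \<cdot> \<rho>' = (\<i> X' \<otimes>\<^sub>a s') \<cdot> \<rho>'"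
  shows "s = s'"
proof -
  have *: "(\<i> Y \<otimes>\<^sub>a (t \<cdot> \<r> D)) \<cdot> ext12 Y D \<sigma> \<I> = ((\<i> Y \<otimes>\<^sub>a t) \<cdot> \<sigma>) \<cdot> \<r> Y"
    if [simp]: "Y \<in> Obj V" "\<sigma> \<in> Arr V" "Dom V \<sigma> = Y" "Cod V \<sigma> = Y \<otimes> D" "t \<in> Arr V" "Dom V t = D" for Y \<sigma> t
  proof -
    have "(\<i> Y \<otimes>\<^sub>a (t \<cdot> \<r> D)) \<cdot> ext12 Y D \<sigma> \<I> = (\<i> Y \<otimes>\<^sub>a t) \<cdot> ((\<i> Y \<otimes>\<^sub>a \<r> D) \<cdot> ext12 Y D \<sigma> \<I>)"
      by simp
    then show ?thesis by (simp add: runit_ext12)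
  qed
  have "s \<cdot> \<r> D = s' \<cdot> \<r> D"
    by (rule separating[of \<I> _ Z]) (simp_all only: * objects arrows assms, simp_all)
  then show ?thesis by (rule iso_right_cancel[rotated -1]) simp_all
qed

lemma factor_plain:
  assumes [simp]: "Z \<in> Obj V" "\<alpha> \<in> Arr V" "Dom V \<alpha> = X" "Cod V \<alpha> = X \<otimes> Z"
    "\<alpha>' \<in> Arr V" "Dom V \<alpha>' = X'" "Cod V \<alpha>' = X' \<otimes> Z"
    and e: "(f \<otimes>\<^sub>a \<i> Z) \<cdot> \<alpha> = \<alpha>' \<cdot> f"
  obtains s where "s \<in> Arr V" "Dom V s = D" "Cod V s = Z"
    "(\<i> X \<otimes>\<^sub>a s) \<cdot> \<rho> = \<alpha>" "(\<i> X' \<otimes>\<^sub>a s) \<cdot> \<rho>' = \<alpha>'"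
proof -
  have "(f \<otimes>\<^sub>a \<i> Z) \<cdot> (\<alpha> \<cdot> \<r> X) = ((f \<otimes>\<^sub>a \<i> Z) \<cdot> \<alpha>) \<cdot> \<r> X"
    by simp
  also have "\<dots> = (\<alpha>' \<cdot> \<r> X') \<cdot> (f \<otimes>\<^sub>a \<i> \<I>)"
    unfolding e by (simp add: runit_nat)
  finally obtain s where [simp]: "s \<in> Arr V" "Dom V s = D \<otimes> \<I>" "Cod V s = Z"
    and s: "(\<i> X \<otimes>\<^sub>a s) \<cdot> ext12 X D \<rho> \<I> = \<alpha> \<cdot> \<r> X" "(\<i> X' \<otimes>\<^sub>a s) \<cdot> ext12 X' D \<rho>' \<I> = \<alpha>' \<cdot> \<r> X'"
    using factor[of \<I> Z "\<alpha> \<cdot> \<r> X" "\<alpha>' \<cdot> \<r> X'"] by auto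
  have *: "(\<i> Y \<otimes>\<^sub>a (s \<cdot> \<i>\<n>\<v> (\<r> D))) \<cdot> \<sigma> = ((\<i> Y \<otimes>\<^sub>a s) \<cdot> ext12 Y D \<sigma> \<I>) \<cdot> \<i>\<n>\<v> (\<r> Y)"
    if [simp]: "Y \<in> Obj V" "\<sigma> \<in> Arr V" "Dom V \<sigma> = Y" "Cod V \<sigma> = Y \<otimes> D" for Y \<sigma>
  proof -
    have "\<sigma> = ((\<i> Y \<otimes>\<^sub>a \<r> D) \<cdot> ext12 Y D \<sigma> \<I>) \<cdot> \<i>\<n>\<v> (\<r> Y)"
      by (simp add: runit_ext12)
    then have "(\<i> Y \<otimes>\<^sub>a (s \<cdot> \<i>\<n>\<v> (\<r> D))) \<cdot> \<sigma>
        = (\<i> Y \<otimes>\<^sub>a (s \<cdot> \<i>\<n>\<v> (\<r> D))) \<cdot> ((\<i> Y \<otimes>\<^sub>a \<r> D) \<cdot> ext12 Y D \<sigma> \<I>) \<cdot> \<i>\<n>\<v> (\<r> Y)"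
      by simp
    then show ?thesis by simp
  qed
  show ?thesis
    by (rule that[of "s \<cdot> \<i>\<n>\<v> (\<r> D)"]) (simp_all add: * s)
qed

text \<open>The braiding of \<open>a\<close> with \<open>D\<close> reduces arrows out of \<open>a \<otimes> D\<close> to arrows out of \<open>D \<otimes> a\<close>.\<close>

lemma act_separating:
  assumes [simp]: "a \<in> Obj V" "t \<in> Arr V" "t' \<in> Arr V" "Dom V t = a \<otimes> D" "Dom V t' = a \<otimes> D"
    "Cod V t = Z" "Cod V t' = Z"
    and e: "act a X D t \<rho> = act a X D t' \<rho>" "act a X' D t \<rho>' = act a X' D t' \<rho>'"
  shows "t = t'"
proof -
  have *: "act a Y D u \<sigma> = ((\<i> Y \<otimes>\<^sub>a (u \<cdot> \<i>\<n>\<v> (\<c> a D))) \<cdot> ext12 Y D \<sigma> a) \<cdot> \<c> a Y"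
    if [simp]: "Y \<in> Obj V" "\<sigma> \<in> Arr V" "Dom V \<sigma> = Y" "Cod V \<sigma> = Y \<otimes> D" "u \<in> Arr V" "Dom V u = a \<otimes> D" for Y \<sigma> u
    using act_ext12[of a Y D "u \<cdot> \<i>\<n>\<v> (\<c> a D)" \<sigma>] by simp
  have **: "(\<i> Y \<otimes>\<^sub>a (t \<cdot> \<i>\<n>\<v> (\<c> a D))) \<cdot> ext12 Y D \<sigma> a = (\<i> Y \<otimes>\<^sub>a (t' \<cdot> \<i>\<n>\<v> (\<c> a D))) \<cdot> ext12 Y D \<sigma> a"
    if "act a Y D t \<sigma> = act a Y D t' \<sigma>" and [simp]: "Y \<in> Obj V" "\<sigma> \<in> Arr V" "Dom V \<sigma> = Y" "Cod V \<sigma> = Y \<otimes> D" for Y \<sigma>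
    using that(1) unfolding *[OF that(2-5) assms(2,4)] *[OF that(2-5) assms(3,5)]
    by (rule iso_right_cancel[rotated -1]) simp_all
  have "t \<cdot> \<i>\<n>\<v> (\<c> a D) = t' \<cdot> \<i>\<n>\<v> (\<c> a D)"
    by (rule separating[of a _ Z]) (simp_all only: ** e objects arrows assms, simp_all)
  then show ?thesis by (rule iso_right_cancel[rotated -1]) simp_all
qed

lemma act_factor:
  assumes [simp]: "a \<in> Obj V" "b \<in> Obj V" "\<psi> \<in> Arr V" "Dom V \<psi> = a \<otimes> X" "Cod V \<psi> = X \<otimes> b"
    "\<psi>' \<in> Arr V" "Dom V \<psi>' = a \<otimes> X'" "Cod V \<psi>' = X' \<otimes> b"
    and e: "(f \<otimes>\<^sub>a \<i> b) \<cdot> \<psi> = \<psi>' \<cdot> (\<i> a \<otimes>\<^sub>a f)"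
  obtains t where "t \<in> Arr V" "Dom V t = a \<otimes> D" "Cod V t = b" "act a X D t \<rho> = \<psi>" "act a X' D t \<rho>' = \<psi>'"
proof -
  \<comment> \<open>Naturality of the inverse braiding. It makes \<open>\<psi>\<close> and
    \<open>\<psi>'\<close>, precomposed with inverse braidings, compatible with \<open>f\<close> as
    \<open>factor\<close> demands for the parameter \<open>a\<close>.\<close>
  have c: "\<i>\<n>\<v> (\<c> a X') \<cdot> (f \<otimes>\<^sub>a \<i> a) = (\<i> a \<otimes>\<^sub>a f) \<cdot> \<i>\<n>\<v> (\<c> a X)"
  proof -
    have "\<i>\<n>\<v> (\<c> a X') \<cdot> (f \<otimes>\<^sub>a \<i> a) = \<i>\<n>\<v> (\<c> a X') \<cdot> ((f \<otimes>\<^sub>a \<i> a) \<cdot> \<c> a X) \<cdot> \<i>\<n>\<v> (\<c> a X)"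
      by simp
    also have "(f \<otimes>\<^sub>a \<i> a) \<cdot> \<c> a X = \<c> a X' \<cdot> (\<i> a \<otimes>\<^sub>a f)"
      by (simp add: braid_nat)
    finally show ?thesis by simp
  qed
  have "(f \<otimes>\<^sub>a \<i> b) \<cdot> (\<psi> \<cdot> \<i>\<n>\<v> (\<c> a X)) = ((f \<otimes>\<^sub>a \<i> b) \<cdot> \<psi>) \<cdot> \<i>\<n>\<v> (\<c> a X)"
    by simp
  also have "\<dots> = (\<psi>' \<cdot> \<i>\<n>\<v> (\<c> a X')) \<cdot> (f \<otimes>\<^sub>a \<i> a)"
    unfolding e by (simp add: c)
  finally obtain s where [simp]: "s \<in> Arr V" "Dom V s = D \<otimes> a" "Cod V s = b"
    and s: "(\<i> X \<otimes>\<^sub>a s) \<cdot> ext12 X D \<rho> a = \<psi> \<cdot> \<i>\<n>\<v> (\<c> a X)" "(\<i> X' \<otimes>\<^sub>a s) \<cdot> ext12 X' D \<rho>' a = \<psi>' \<cdot> \<i>\<n>\<v> (\<c> a X')"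
    using factor[of a b "\<psi> \<cdot> \<i>\<n>\<v> (\<c> a X)" "\<psi>' \<cdot> \<i>\<n>\<v> (\<c> a X')"] by auto
  have *: "act a Y D (s \<cdot> \<c> a D) \<sigma> = ((\<i> Y \<otimes>\<^sub>a s) \<cdot> ext12 Y D \<sigma> a) \<cdot> \<c> a Y"
    if [simp]: "Y \<in> Obj V" "\<sigma> \<in> Arr V" "Dom V \<sigma> = Y" "Cod V \<sigma> = Y \<otimes> D" for Y \<sigma>
    using act_ext12[of a Y D s \<sigma>] by simp
  show ?thesis
    by (rule that[of "s \<cdot> \<c> a D"]) (simp_all add: * s)
qed

lemma act2_separating:
  assumes [simp]: "a \<in> Obj V" "t \<in> Arr V" "t' \<in> Arr V" "Dom V t = a \<otimes> (a \<otimes> D)" "Dom V t' = a \<otimes> (a \<otimes> D)"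
    "Cod V t = Z" "Cod V t' = Z"
    and e: "(\<i> X \<otimes>\<^sub>a t) \<cdot> act2 a X D \<rho> = (\<i> X \<otimes>\<^sub>a t') \<cdot> act2 a X D \<rho>"
      "(\<i> X' \<otimes>\<^sub>a t) \<cdot> act2 a X' D \<rho>' = (\<i> X' \<otimes>\<^sub>a t') \<cdot> act2 a X' D \<rho>'"
  shows "t = t'"
proof -
  \<comment> \<open>\<open>?z\<close> takes both copies of \<open>a\<close> past \<open>D\<close>,
    from \<open>a \<otimes> (a \<otimes> D)\<close> to \<open>D \<otimes> (a \<otimes> a)\<close>,
    where \<open>separating\<close> applies.\<close>
  let ?z = "braid_ext a D a \<cdot> (\<i> a \<otimes>\<^sub>a \<c> a D)"
  have *: "(\<i> Y \<otimes>\<^sub>a u) \<cdot> act2 a Y D \<sigma>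
      = ((\<i> Y \<otimes>\<^sub>a (u \<cdot> \<i>\<n>\<v> ?z)) \<cdot> ext12 Y D \<sigma> (a \<otimes> a)) \<cdot> braid_ext a Y a \<cdot> (\<i> a \<otimes>\<^sub>a \<c> a Y)"
    if [simp]: "Y \<in> Obj V" "\<sigma> \<in> Arr V" "Dom V \<sigma> = Y" "Cod V \<sigma> = Y \<otimes> D" "u \<in> Arr V" "Dom V u = a \<otimes> (a \<otimes> D)" for Y \<sigma> u
  proof -
    have "(\<i> Y \<otimes>\<^sub>a u) \<cdot> act2 a Y D \<sigma> = (\<i> Y \<otimes>\<^sub>a (u \<cdot> \<i>\<n>\<v> ?z \<cdot> ?z)) \<cdot> act2 a Y D \<sigma>"
      using inv_cancel(1)[of ?z] by (simp del: inv_cancel)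
    also have "\<dots> = (\<i> Y \<otimes>\<^sub>a (u \<cdot> \<i>\<n>\<v> ?z)) \<cdot> ((\<i> Y \<otimes>\<^sub>a ?z) \<cdot> act2 a Y D \<sigma>)"
      by simp
    finally show ?thesis unfolding act2_ext12[OF assms(1) that(1) objects(3) that(2-4)] by simp
  qed
  have **: "(\<i> Y \<otimes>\<^sub>a (t \<cdot> \<i>\<n>\<v> ?z)) \<cdot> ext12 Y D \<sigma> (a \<otimes> a) = (\<i> Y \<otimes>\<^sub>a (t' \<cdot> \<i>\<n>\<v> ?z)) \<cdot> ext12 Y D \<sigma> (a \<otimes> a)"
    if "(\<i> Y \<otimes>\<^sub>a t) \<cdot> act2 a Y D \<sigma> = (\<i> Y \<otimes>\<^sub>a t') \<cdot> act2 a Y D \<sigma>"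
      and [simp]: "Y \<in> Obj V" "\<sigma> \<in> Arr V" "Dom V \<sigma> = Y" "Cod V \<sigma> = Y \<otimes> D" for Y \<sigma>
    using that(1) unfolding *[OF that(2-5) assms(2,4)] *[OF that(2-5) assms(3,5)]
    by (rule iso_right_cancel[rotated -1]) simp_all
  have "t \<cdot> \<i>\<n>\<v> ?z = t' \<cdot> \<i>\<n>\<v> ?z"
    by (rule separating[of "a \<otimes> a" _ Z]) (simp_all only: ** e objects arrows assms, simp_all)
  then show ?thesis by (rule iso_right_cancel[rotated -1]) simp_all
qed

text \<open>Comultiplication and counit represent the twofold coaction and the trivial coaction
  \<open>\<i>\<n>\<v> (\<r> X)\<close>. Each comonoid axiom holds because its two sides have the
  same effect on \<open>X\<close> and on \<open>X'\<close>.\<close>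

lemma ex_comon:
  obtains C where "is_comon V C" "comon_obj C = D" "is_comodule C X \<rho>" "is_comodule C X' \<rho>'"
proof -
  \<comment> \<open>\<open>factor_plain\<close> requires the twofold coaction to be compatible with
    \<open>f\<close>, which is \<open>compatible\<close> used twice.\<close>
  have "(f \<otimes>\<^sub>a \<i> (D \<otimes> D)) \<cdot> (ext12 X D \<rho> D \<cdot> \<rho>) = ((f \<otimes>\<^sub>a (\<i> D \<otimes>\<^sub>a \<i> D)) \<cdot> \<a> X D D) \<cdot> (\<rho> \<otimes>\<^sub>a \<i> D) \<cdot> \<rho>"
    by (simp add: ext12_def)
  also have "\<dots> = \<a> X' D D \<cdot> (((f \<otimes>\<^sub>a \<i> D) \<cdot> \<rho>) \<otimes>\<^sub>a \<i> D) \<cdot> \<rho>"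
    by (simp add: push)
  also have "\<dots> = \<a> X' D D \<cdot> ((\<rho>' \<cdot> f) \<otimes>\<^sub>a \<i> D) \<cdot> \<rho>"
    unfolding compatible ..
  also have "\<dots> = \<a> X' D D \<cdot> (\<rho>' \<otimes>\<^sub>a \<i> D) \<cdot> ((f \<otimes>\<^sub>a \<i> D) \<cdot> \<rho>)"
    by simp
  also have "\<dots> = (ext12 X' D \<rho>' D \<cdot> \<rho>') \<cdot> f"
    unfolding compatible by (simp add: ext12_def)
  finally obtain \<delta> where [simp]: "\<delta> \<in> Arr V" "Dom V \<delta> = D" "Cod V \<delta> = D \<otimes> D"
    and \<delta>: "(\<i> X \<otimes>\<^sub>a \<delta>) \<cdot> \<rho> = ext12 X D \<rho> D \<cdot> \<rho>" "(\<i> X' \<otimes>\<^sub>a \<delta>) \<cdot> \<rho>' = ext12 X' D \<rho>' D \<cdot> \<rho>'"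
    by (rule factor_plain[rotated -2]) simp_all
  have "(f \<otimes>\<^sub>a \<i> \<I>) \<cdot> \<i>\<n>\<v> (\<r> X) = \<i>\<n>\<v> (\<r> X') \<cdot> f"
    by (simp add: runit_inv_nat)
  then obtain \<epsilon> where [simp]: "\<epsilon> \<in> Arr V" "Dom V \<epsilon> = D" "Cod V \<epsilon> = \<I>"
    and \<epsilon>: "(\<i> X \<otimes>\<^sub>a \<epsilon>) \<cdot> \<rho> = \<i>\<n>\<v> (\<r> X)" "(\<i> X' \<otimes>\<^sub>a \<epsilon>) \<cdot> \<rho>' = \<i>\<n>\<v> (\<r> X')"
    by (rule factor_plain[rotated -2]) simp_all
  have 1: "\<a> D D D \<cdot> (\<delta> \<otimes>\<^sub>a \<i> D) \<cdot> \<delta> = (\<i> D \<otimes>\<^sub>a \<delta>) \<cdot> \<delta>"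
    by (rule separating_plain[OF _ _ _ _ _ _ coaction_coassoc coaction_coassoc]) (simp_all add: \<delta>)
  have 2: "\<l> D \<cdot> (\<epsilon> \<otimes>\<^sub>a \<i> D) \<cdot> \<delta> = \<i> D"
    by (rule separating_plain[of _ _ D]) (simp_all add: coaction_counit_left \<delta> \<epsilon>)
  have 3: "\<r> D \<cdot> (\<i> D \<otimes>\<^sub>a \<epsilon>) \<cdot> \<delta> = \<i> D"
    by (rule separating_plain[of _ _ D]) (simp_all add: coaction_counit_right \<delta> \<epsilon>)
  show ?thesis
    by (rule that[of "\<lparr>comon_obj = D, comon_comult = \<delta>, comon_counit = \<epsilon>\<rparr>"])
      (simp_all add: is_comon_def is_comodule_def \<delta> \<epsilon> 1 2 3)
qed

end

context monoidal_category
begin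

lemma is_comoduleD:
  assumes "is_comodule C X \<rho>"
  shows "X \<in> Obj V" "\<rho> \<in> Arr V" "Dom V \<rho> = X" "Cod V \<rho> = X \<otimes> comon_obj C"
    "ext12 X (comon_obj C) \<rho> (comon_obj C) \<cdot> \<rho> = (\<i> X \<otimes>\<^sub>a comon_comult C) \<cdot> \<rho>"
    "\<r> X \<cdot> (\<i> X \<otimes>\<^sub>a comon_counit C) \<cdot> \<rho> = \<i> X"
  using assms by (auto simp: is_comodule_def)

lemma comodule_counit:
  assumes "is_comon V C" "is_comodule C X \<rho>"
  shows "(\<i> X \<otimes>\<^sub>a comon_counit C) \<cdot> \<rho> = \<i>\<n>\<v> (\<r> X)"
proof -
  note [simp] = comon_typing[OF assms(1)] is_comoduleD(1-4)[OF assms(2)]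
  show ?thesis
    by (rule iso_left_cancel[of "\<r> X", rotated -1]) (simp_all add: is_comoduleD(6)[OF assms(2)])
qed

lemma is_AV_BD:
  assumes "is_AV_B A B X \<psi>"
  shows "X \<in> Obj V" "\<psi> \<in> Arr V" "Dom V \<psi> = mon_obj A \<otimes> X" "Cod V \<psi> = X \<otimes> mon_obj B"
    "(\<i> X \<otimes>\<^sub>a mon_mult B) \<cdot> ext22 (mon_obj A) X X (mon_obj B) \<psi> (mon_obj B) \<cdot> (\<i> (mon_obj A) \<otimes>\<^sub>a \<psi>)
      = \<psi> \<cdot> ext21 (mon_obj A) (mon_obj A) (mon_mult A) X"
    "\<psi> \<cdot> (mon_unit A \<otimes>\<^sub>a \<i> X) \<cdot> \<i>\<n>\<v> (\<l> X) = (\<i> X \<otimes>\<^sub>a mon_unit B) \<cdot> \<i>\<n>\<v> (\<r> X)"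
  using assms by (auto simp: is_AV_B_def)

end

context braided_monoidal_category
begin

lemma is_measuringD:
  assumes "is_measuring A B C t"
  shows "t \<in> Arr V" "Dom V t = mon_obj A \<otimes> comon_obj C" "Cod V t = mon_obj B"
    "t \<cdot> ext21 (mon_obj A) (mon_obj A) (mon_mult A) (comon_obj C)
      = mon_mult B \<cdot> ext21 (mon_obj A) (comon_obj C) t (mon_obj B) \<cdot> (\<i> (mon_obj A) \<otimes>\<^sub>a
        ((\<i> (comon_obj C) \<otimes>\<^sub>a t) \<cdot> braid_ext (mon_obj A) (comon_obj C) (comon_obj C) \<cdot>
        (\<i> (mon_obj A) \<otimes>\<^sub>a comon_comult C)))"
    "t \<cdot> (mon_unit A \<otimes>\<^sub>a \<i> (comon_obj C)) \<cdot> \<i>\<n>\<v> (\<l> (comon_obj C)) = mon_unit B \<cdot> comon_counit C"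
  using assms by (auto simp: is_measuring_def Let_def)

text \<open>The measuring axioms, tensored with \<open>X\<close> and precomposed with
  \<open>act2\<close> for the product and with \<open>\<rho>\<close> for the unit, become the axioms
  of \<open>AV_B\<close>.\<close>

lemma is_AV_B_act:
  assumes A: "is_mon V A" and B: "is_mon V B" and C: "is_comon V C"
    and \<rho>: "is_comodule C X \<rho>" and t: "is_measuring A B C t"
  shows "is_AV_B A B X (act (mon_obj A) X (comon_obj C) t \<rho>)"
proof -
  note [simp] = mon_typing[OF A] mon_typing[OF B] comon_typing[OF C] is_comoduleD(1-4)[OF \<rho>]
    is_measuringD(1-3)[OF t]
  show ?thesis
    unfolding is_AV_B_def
    using act_mult_right[OF _ _ _ _ _ _ _ _ _ _ _ _ _ _ _ is_comoduleD(5)[OF \<rho>], of "mon_obj A" "mon_obj B" t "mon_mult B"]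
      act_mult_left[of "mon_obj A" X "comon_obj C" t \<rho> "mon_mult A"]
      act_unit[of "mon_obj A" X "comon_obj C" t \<rho> "mon_unit A"]
      is_measuringD(4,5)[OF t] comodule_counit[OF C \<rho>]
      tens_merge_left[of "\<i> X" "\<i> X" "comon_counit C" "mon_unit B" \<rho>]
    by simp
qed

text \<open>\<open>g\<close> respects comultiplication and counit and passes the crossing. Via
  \<open>mon_hom_convolution_iff\<close> this later shows that \<open>[g, B]\<close> composed with
  the universal monoid map is again a monoid map.\<close>

lemma is_measuring_push:
  assumes A: "is_mon V A" and B: "is_mon V B" and C: "is_comon V C" and P: "is_comon V P"
    and g: "g \<in> comon_hom V C P" and t: "is_measuring A B P t"
  shows "is_measuring A B C (t \<cdot> (\<i> (mon_obj A) \<otimes>\<^sub>a g))"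
proof -
  let ?a = "mon_obj A" and ?b = "mon_obj B" and ?c = "comon_obj C" and ?p = "comon_obj P"
  note [simp] = mon_typing[OF A] mon_typing[OF B] comon_typing[OF C] comon_typing[OF P]
    is_measuringD(1-3)[OF t]
  have [simp]: "g \<in> Arr V" "Dom V g = ?c" "Cod V g = ?p"
    and g\<delta>: "comon_comult P \<cdot> g = (g \<otimes>\<^sub>a g) \<cdot> comon_comult C" and g\<epsilon>: "comon_counit P \<cdot> g = comon_counit C"
    using g by (auto simp: comon_hom_def)
  have e: "ext21 ?a ?c (t \<cdot> (\<i> ?a \<otimes>\<^sub>a g)) ?b = ext21 ?a ?p t ?b \<cdot> (\<i> ?a \<otimes>\<^sub>a (g \<otimes>\<^sub>a \<i> ?b))"
    by (simp add: ext21_def pull_inv)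
  \<comment> \<open>\<open>g\<close> sits on both coefficients: the last one passes by
    \<open>ext22_nat\<close>, the one that \<open>a\<close> crosses by
    \<open>braid_ext_nat\<close>.\<close>
  have b: "braid_ext ?a ?p ?p \<cdot> (\<i> ?a \<otimes>\<^sub>a (g \<otimes>\<^sub>a g)) = (g \<otimes>\<^sub>a (\<i> ?a \<otimes>\<^sub>a g)) \<cdot> braid_ext ?a ?c ?c"
  proof -
    have "braid_ext ?a ?p ?p \<cdot> (\<i> ?a \<otimes>\<^sub>a (g \<otimes>\<^sub>a g))
        = (braid_ext ?a ?p ?p \<cdot> (\<i> ?a \<otimes>\<^sub>a (\<i> ?p \<otimes>\<^sub>a g))) \<cdot> (\<i> ?a \<otimes>\<^sub>a (g \<otimes>\<^sub>a \<i> ?c))"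
      by simp
    also have "\<dots> = (\<i> ?p \<otimes>\<^sub>a (\<i> ?a \<otimes>\<^sub>a g)) \<cdot> (braid_ext ?a ?p ?c \<cdot> (\<i> ?a \<otimes>\<^sub>a (g \<otimes>\<^sub>a \<i> ?c)))"
      by (simp add: ext22_nat)
    also have "\<dots> = (g \<otimes>\<^sub>a (\<i> ?a \<otimes>\<^sub>a g)) \<cdot> braid_ext ?a ?c ?c"
      by (subst braid_ext_nat[of ?a ?c g ?c ?p]) simp_all
    finally show ?thesis .
  qed
  have "(t \<cdot> (\<i> ?a \<otimes>\<^sub>a g)) \<cdot> ext21 ?a ?a (mon_mult A) ?c
      = (t \<cdot> ext21 ?a ?a (mon_mult A) ?p) \<cdot> (\<i> ?a \<otimes>\<^sub>a (\<i> ?a \<otimes>\<^sub>a g))"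
    using ext21_nat[of "mon_mult A" g ?a ?a ?p] by simp
  also have "\<dots> = mon_mult B \<cdot> ext21 ?a ?p t ?b \<cdot> (\<i> ?a \<otimes>\<^sub>a
      ((\<i> ?p \<otimes>\<^sub>a t) \<cdot> braid_ext ?a ?p ?p \<cdot> (\<i> ?a \<otimes>\<^sub>a (comon_comult P \<cdot> g))))"
    unfolding is_measuringD(4)[OF t] by simp
  also have "\<dots> = mon_mult B \<cdot> ext21 ?a ?p t ?b \<cdot> (\<i> ?a \<otimes>\<^sub>a
      ((\<i> ?p \<otimes>\<^sub>a t) \<cdot> (braid_ext ?a ?p ?p \<cdot> (\<i> ?a \<otimes>\<^sub>a (g \<otimes>\<^sub>a g))) \<cdot> (\<i> ?a \<otimes>\<^sub>a comon_comult C)))"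
    unfolding g\<delta> by simp
  also have "\<dots> = mon_mult B \<cdot> ext21 ?a ?c (t \<cdot> (\<i> ?a \<otimes>\<^sub>a g)) ?b \<cdot> (\<i> ?a \<otimes>\<^sub>a
      ((\<i> ?c \<otimes>\<^sub>a (t \<cdot> (\<i> ?a \<otimes>\<^sub>a g))) \<cdot> braid_ext ?a ?c ?c \<cdot> (\<i> ?a \<otimes>\<^sub>a comon_comult C)))"
    unfolding b e by simp
  finally have 1: "(t \<cdot> (\<i> ?a \<otimes>\<^sub>a g)) \<cdot> ext21 ?a ?a (mon_mult A) ?c = \<dots>" .
  have "(t \<cdot> (\<i> ?a \<otimes>\<^sub>a g)) \<cdot> (mon_unit A \<otimes>\<^sub>a \<i> ?c) \<cdot> \<i>\<n>\<v> (\<l> ?c)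
      = t \<cdot> (mon_unit A \<otimes>\<^sub>a \<i> ?p) \<cdot> ((\<i> \<I> \<otimes>\<^sub>a g) \<cdot> \<i>\<n>\<v> (\<l> ?c))"
    by simp
  also have "\<dots> = (t \<cdot> (mon_unit A \<otimes>\<^sub>a \<i> ?p) \<cdot> \<i>\<n>\<v> (\<l> ?p)) \<cdot> g"
    using lunit_inv_nat[of g ?p] by simp
  also have "\<dots> = mon_unit B \<cdot> comon_counit C"
    unfolding is_measuringD(5)[OF t] by (simp add: g\<epsilon>)
  finally show ?thesis
    using 1 by (simp add: is_measuring_def)
qed

end

context universal_coaction
begin

text \<open>\<open>act_factor\<close> yields a bare arrow \<open>t\<close>. Its axioms are read off
  those of \<open>\<psi>\<close> and \<open>\<psi>'\<close>: both sides have the same effect on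
  \<open>X\<close> and on \<open>X'\<close>, which suffices by \<open>act2_separating\<close> and
  \<open>separating_plain\<close>.\<close>

lemma ex_measuring:
  assumes A: "is_mon V A" and B: "is_mon V B" and C: "is_comon V C" "comon_obj C = D"
    and \<rho>: "is_comodule C X \<rho>" and \<rho>': "is_comodule C X' \<rho>'"
    and \<psi>: "is_AV_B A B X \<psi>" and \<psi>': "is_AV_B A B X' \<psi>'"
    and e: "(f \<otimes>\<^sub>a \<i> (mon_obj B)) \<cdot> \<psi> = \<psi>' \<cdot> (\<i> (mon_obj A) \<otimes>\<^sub>a f)"
  obtains t where "is_measuring A B C t" "act (mon_obj A) X D t \<rho> = \<psi>" "act (mon_obj A) X' D t \<rho>' = \<psi>'"
proof -
  let ?a = "mon_obj A" and ?b = "mon_obj B"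
  note [simp] = mon_typing[OF A] mon_typing[OF B] comon_typing[OF C(1), unfolded C(2)]
    is_AV_BD(1-4)[OF \<psi>] is_AV_BD(1-4)[OF \<psi>']
  obtain t where [simp]: "t \<in> Arr V" "Dom V t = ?a \<otimes> D" "Cod V t = ?b"
    and t: "act ?a X D t \<rho> = \<psi>" "act ?a X' D t \<rho>' = \<psi>'"
    by (rule act_factor[of ?a ?b \<psi> \<psi>']) (simp_all add: e)
  let ?m = "mon_mult B \<cdot> ext21 ?a D t ?b \<cdot> (\<i> ?a \<otimes>\<^sub>a
      ((\<i> D \<otimes>\<^sub>a t) \<cdot> braid_ext ?a D D \<cdot> (\<i> ?a \<otimes>\<^sub>a comon_comult C)))"
  have m: "(\<i> Y \<otimes>\<^sub>a (t \<cdot> ext21 ?a ?a (mon_mult A) D)) \<cdot> act2 ?a Y D \<sigma> = (\<i> Y \<otimes>\<^sub>a ?m) \<cdot> act2 ?a Y D \<sigma>"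
    if \<sigma>: "is_comodule C Y \<sigma>" and av: "is_AV_B A B Y (act ?a Y D t \<sigma>)" for Y \<sigma>
  proof -
    note [simp] = is_comoduleD(1-4)[OF \<sigma>, unfolded C(2)]
    show ?thesis
      using act_mult_right[OF _ _ _ _ _ _ _ _ _ _ _ _ _ _ _ is_comoduleD(5)[OF \<sigma>, unfolded C(2)], of ?a ?b t "mon_mult B"]
        act_mult_left[of ?a Y D t \<sigma> "mon_mult A"] is_AV_BD(5)[OF av] by simp
  qed
  have 1: "t \<cdot> ext21 ?a ?a (mon_mult A) D = ?m"
    by (rule act2_separating[of ?a _ _ ?b, OF _ _ _ _ _ _ _ m[OF \<rho>] m[OF \<rho>']]) (simp_all add: t \<psi> \<psi>')
  have u: "(\<i> Y \<otimes>\<^sub>a (t \<cdot> (mon_unit A \<otimes>\<^sub>a \<i> D) \<cdot> \<i>\<n>\<v> (\<l> D))) \<cdot> \<sigma> = (\<i> Y \<otimes>\<^sub>a (mon_unit B \<cdot> comon_counit C)) \<cdot> \<sigma>"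
    if \<sigma>: "is_comodule C Y \<sigma>" and av: "is_AV_B A B Y (act ?a Y D t \<sigma>)" for Y \<sigma>
  proof -
    note [simp] = is_comoduleD(1-4)[OF \<sigma>, unfolded C(2)]
    show ?thesis
      using act_unit[of ?a Y D t \<sigma> "mon_unit A"] is_AV_BD(6)[OF av] comodule_counit[OF C(1) \<sigma>]
        tens_merge_left[of "\<i> Y" "\<i> Y" "comon_counit C" "mon_unit B" \<sigma>] by simp
  qed
  have 2: "t \<cdot> (mon_unit A \<otimes>\<^sub>a \<i> D) \<cdot> \<i>\<n>\<v> (\<l> D) = mon_unit B \<cdot> comon_counit C"
    by (rule separating_plain[of _ _ ?b, OF _ _ _ _ _ _ u[OF \<rho>] u[OF \<rho>']]) (simp_all add: t \<psi> \<psi>')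
  show ?thesis
    by (rule that[OF _ t]) (simp add: is_measuring_def C(2) 1 2)
qed

text \<open>The same pattern: the comodule axioms of \<open>\<sigma>\<close> and
  \<open>\<sigma>'\<close> are the comonoid-map equations for \<open>g\<close> tested on
  \<open>\<rho>\<close> and \<open>\<rho>'\<close>.\<close>

lemma ex_comon_hom:
  assumes C: "is_comon V C" "comon_obj C = D" and P: "is_comon V P"
    and \<rho>: "is_comodule C X \<rho>" and \<rho>': "is_comodule C X' \<rho>'"
    and \<sigma>: "is_comodule P X \<sigma>" and \<sigma>': "is_comodule P X' \<sigma>'"
    and e: "(f \<otimes>\<^sub>a \<i> (comon_obj P)) \<cdot> \<sigma> = \<sigma>' \<cdot> f"
  obtains g where "g \<in> comon_hom V C P" "(\<i> X \<otimes>\<^sub>a g) \<cdot> \<rho> = \<sigma>" "(\<i> X' \<otimes>\<^sub>a g) \<cdot> \<rho>' = \<sigma>'"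
proof -
  let ?p = "comon_obj P"
  note [simp] = comon_typing[OF C(1), unfolded C(2)] comon_typing[OF P]
    is_comoduleD(1-4)[OF \<sigma>] is_comoduleD(1-4)[OF \<sigma>']
  obtain g where [simp]: "g \<in> Arr V" "Dom V g = D" "Cod V g = ?p"
    and g: "(\<i> X \<otimes>\<^sub>a g) \<cdot> \<rho> = \<sigma>" "(\<i> X' \<otimes>\<^sub>a g) \<cdot> \<rho>' = \<sigma>'"
    by (rule factor_plain[of ?p \<sigma> \<sigma>']) (simp_all add: e)
  have m: "(\<i> Y \<otimes>\<^sub>a (comon_comult P \<cdot> g)) \<cdot> \<tau> = (\<i> Y \<otimes>\<^sub>a ((g \<otimes>\<^sub>a g) \<cdot> comon_comult C)) \<cdot> \<tau>"
    and u: "(\<i> Y \<otimes>\<^sub>a (comon_counit P \<cdot> g)) \<cdot> \<tau> = (\<i> Y \<otimes>\<^sub>a comon_counit C) \<cdot> \<tau>"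
    if \<tau>: "is_comodule C Y \<tau>" and \<tau>': "is_comodule P Y ((\<i> Y \<otimes>\<^sub>a g) \<cdot> \<tau>)" for Y \<tau>
  proof -
    note [simp] = is_comoduleD(1-4)[OF \<tau>, unfolded C(2)]
    have "(\<i> Y \<otimes>\<^sub>a (comon_comult P \<cdot> g)) \<cdot> \<tau> = (\<i> Y \<otimes>\<^sub>a comon_comult P) \<cdot> ((\<i> Y \<otimes>\<^sub>a g) \<cdot> \<tau>)"
      by simp
    also have "\<dots> = (\<i> Y \<otimes>\<^sub>a (g \<otimes>\<^sub>a g)) \<cdot> (ext12 Y D \<tau> D \<cdot> \<tau>)"
      unfolding is_comoduleD(5)[OF \<tau>', symmetric] by (rule coaction_push) simp_all
    also have "\<dots> = (\<i> Y \<otimes>\<^sub>a ((g \<otimes>\<^sub>a g) \<cdot> comon_comult C)) \<cdot> \<tau>"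
      unfolding is_comoduleD(5)[OF \<tau>, unfolded C(2)] by simp
    finally show "(\<i> Y \<otimes>\<^sub>a (comon_comult P \<cdot> g)) \<cdot> \<tau> = (\<i> Y \<otimes>\<^sub>a ((g \<otimes>\<^sub>a g) \<cdot> comon_comult C)) \<cdot> \<tau>" .
    show "(\<i> Y \<otimes>\<^sub>a (comon_counit P \<cdot> g)) \<cdot> \<tau> = (\<i> Y \<otimes>\<^sub>a comon_counit C) \<cdot> \<tau>"
      using comodule_counit[OF P \<tau>'] comodule_counit[OF C(1) \<tau>] by simp
  qed
  have 1: "comon_comult P \<cdot> g = (g \<otimes>\<^sub>a g) \<cdot> comon_comult C"
    by (rule separating_plain[of _ _ "?p \<otimes> ?p", OF _ _ _ _ _ _ m[OF \<rho>] m[OF \<rho>']]) (simp_all add: g \<sigma> \<sigma>')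
  have 2: "comon_counit P \<cdot> g = comon_counit C"
    by (rule separating_plain[of _ _ \<I>, OF _ _ _ _ _ _ u[OF \<rho>] u[OF \<rho>']]) (simp_all add: g \<sigma> \<sigma>')
  show ?thesis
    by (rule that[OF _ g]) (simp add: comon_hom_def C(2) 1 2)
qed

end

section \<open>Convolution monoids\<close>

context braided_monoidal_category
begin

lemma interchange_eq:
  assumes [simp]: "W \<in> Obj V" "X \<in> Obj V" "Y \<in> Obj V" "Z \<in> Obj V"
  shows "interchange V W X Y Z = \<i>\<n>\<v> (\<a> W Y (X \<otimes> Z)) \<cdot> (\<i> W \<otimes>\<^sub>a braid_ext X Y Z) \<cdot> \<a> W X (Y \<otimes> Z)"
  by (simp add: interchange_def ext22_def)

lemma interchange_typing [simp]:
  assumes [simp]: "W \<in> Obj V" "X \<in> Obj V" "Y \<in> Obj V" "Z \<in> Obj V"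
  shows "interchange V W X Y Z \<in> Arr V" "Dom V (interchange V W X Y Z) = (W \<otimes> X) \<otimes> (Y \<otimes> Z)"
    "Cod V (interchange V W X Y Z) = (W \<otimes> Y) \<otimes> (X \<otimes> Z)"
  by (simp_all add: interchange_eq)

text \<open>Applied with both arrows equal to a map \<open>A \<rightarrow> [C, B]\<close>, so that
  it can be postponed until after the interchange and meet the evaluations.\<close>

lemma interchange_nat:
  assumes [simp]: "f \<in> Arr V" "g \<in> Arr V" "Dom V f = W" "Cod V f = W'" "Dom V g = X" "Cod V g = X'"
    "Y \<in> Obj V" "Z \<in> Obj V"
  shows "interchange V W' X' Y Z \<cdot> ((f \<otimes>\<^sub>a g) \<otimes>\<^sub>a \<i> (Y \<otimes> Z))
    = ((f \<otimes>\<^sub>a \<i> Y) \<otimes>\<^sub>a (g \<otimes>\<^sub>a \<i> Z)) \<cdot> interchange V W X Y Z"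
proof -
  have [simp]: "W \<in> Obj V" "W' \<in> Obj V" "X \<in> Obj V" "X' \<in> Obj V"
    using Dom_Cod_Obj[of f] Dom_Cod_Obj[of g] by simp_all
  have n: "(\<i> Y \<otimes>\<^sub>a (g \<otimes>\<^sub>a \<i> Z)) \<cdot> \<a> Y X Z = \<a> Y X' Z \<cdot> ((\<i> Y \<otimes>\<^sub>a g) \<otimes>\<^sub>a \<i> Z)"
    by (simp add: assoc_nat)
  have m: "\<i>\<n>\<v> (\<a> X' Y Z) \<cdot> (g \<otimes>\<^sub>a \<i> (Y \<otimes> Z)) = ((g \<otimes>\<^sub>a \<i> Y) \<otimes>\<^sub>a \<i> Z) \<cdot> \<i>\<n>\<v> (\<a> X Y Z)"
    using assoc_inv_nat[of g "\<i> Y" "\<i> Z" X' Y Z] by simp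
  have "braid_ext X' Y Z \<cdot> (g \<otimes>\<^sub>a \<i> (Y \<otimes> Z)) = (\<a> Y X' Z \<cdot> ((\<i> Y \<otimes>\<^sub>a g) \<otimes>\<^sub>a \<i> Z)) \<cdot> (\<c> X Y \<otimes>\<^sub>a \<i> Z) \<cdot> \<i>\<n>\<v> (\<a> X Y Z)"
    by (simp add: ext22_def m braid_nat)
  then have b: "braid_ext X' Y Z \<cdot> (g \<otimes>\<^sub>a \<i> (Y \<otimes> Z)) = (\<i> Y \<otimes>\<^sub>a (g \<otimes>\<^sub>a \<i> Z)) \<cdot> braid_ext X Y Z"
    unfolding n[symmetric] by (simp add: ext22_def)
  have "interchange V W' X' Y Z \<cdot> ((f \<otimes>\<^sub>a g) \<otimes>\<^sub>a \<i> (Y \<otimes> Z))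
      = \<i>\<n>\<v> (\<a> W' Y (X' \<otimes> Z)) \<cdot> (f \<otimes>\<^sub>a (braid_ext X' Y Z \<cdot> (g \<otimes>\<^sub>a \<i> (Y \<otimes> Z)))) \<cdot> \<a> W X (Y \<otimes> Z)"
    by (simp add: interchange_eq assoc_nat)
  also have "\<dots> = (\<i>\<n>\<v> (\<a> W' Y (X' \<otimes> Z)) \<cdot> (f \<otimes>\<^sub>a (\<i> Y \<otimes>\<^sub>a (g \<otimes>\<^sub>a \<i> Z)))) \<cdot> (\<i> W \<otimes>\<^sub>a braid_ext X Y Z) \<cdot> \<a> W X (Y \<otimes> Z)"
    unfolding b by simp
  also have "\<dots> = ((f \<otimes>\<^sub>a \<i> Y) \<otimes>\<^sub>a (g \<otimes>\<^sub>a \<i> Z)) \<cdot> interchange V W X Y Z"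
    by (simp add: assoc_inv_nat interchange_eq)
  finally show ?thesis .
qed

text \<open>Matches the convolution product, written with \<open>interchange\<close>, to the
  right-hand side of the measuring axiom; only a rebracketing of
  \<open>(a \<otimes> a) \<otimes> c\<close> separates them.\<close>

lemma tens_interchange:
  assumes [simp]: "a \<in> Obj V" "c \<in> Obj V" "t \<in> Arr V" "Dom V t = a \<otimes> c" "Cod V t = b"
    "\<delta> \<in> Arr V" "Dom V \<delta> = c" "Cod V \<delta> = c \<otimes> c"
  shows "(t \<otimes>\<^sub>a t) \<cdot> interchange V a a c c \<cdot> (\<i> (a \<otimes> a) \<otimes>\<^sub>a \<delta>)
    = ext21 a c t b \<cdot> (\<i> a \<otimes>\<^sub>a ((\<i> c \<otimes>\<^sub>a t) \<cdot> braid_ext a c c \<cdot> (\<i> a \<otimes>\<^sub>a \<delta>))) \<cdot> \<a> a a c"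
proof -
  have [simp]: "b \<in> Obj V" using Dom_Cod_Obj[of t] by simp
  have n: "\<a> a a (c \<otimes> c) \<cdot> (\<i> (a \<otimes> a) \<otimes>\<^sub>a \<delta>) = (\<i> a \<otimes>\<^sub>a (\<i> a \<otimes>\<^sub>a \<delta>)) \<cdot> \<a> a a c"
    using assoc_nat[of "\<i> a" "\<i> a" \<delta> a a "c \<otimes> c"] by simp
  have m: "ext21 a c t b \<cdot> (\<i> a \<otimes>\<^sub>a (\<i> c \<otimes>\<^sub>a t)) = (t \<otimes>\<^sub>a t) \<cdot> \<i>\<n>\<v> (\<a> a c (a \<otimes> c))"
    by (simp add: ext21_def pull_inv)
  have "(t \<otimes>\<^sub>a t) \<cdot> interchange V a a c c \<cdot> (\<i> (a \<otimes> a) \<otimes>\<^sub>a \<delta>)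
      = ((t \<otimes>\<^sub>a t) \<cdot> \<i>\<n>\<v> (\<a> a c (a \<otimes> c))) \<cdot> (\<i> a \<otimes>\<^sub>a braid_ext a c c) \<cdot> (\<a> a a (c \<otimes> c) \<cdot> (\<i> (a \<otimes> a) \<otimes>\<^sub>a \<delta>))"
    by (simp add: interchange_eq)
  also have "\<dots> = ext21 a c t b \<cdot> (\<i> a \<otimes>\<^sub>a ((\<i> c \<otimes>\<^sub>a t) \<cdot> braid_ext a c c \<cdot> (\<i> a \<otimes>\<^sub>a \<delta>))) \<cdot> \<a> a a c"
    unfolding n m[symmetric] by simp
  finally show ?thesis .
qed

end

context braided_monoidal_closed_category
begin

lemmas [simp] = ihom_Obj

lemma ev_typing [simp]:
  assumes "X \<in> Obj V" "Y \<in> Obj V"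
  shows "ev V X Y \<in> Arr V" "Dom V (ev V X Y) = ihom V X Y \<otimes> X" "Cod V (ev V X Y) = Y"
  using ev_hom[OF assms] by auto

lemma curry_arr:
  assumes "X \<in> Obj V" "Y \<in> Obj V" "Z \<in> Obj V" "f \<in> Arr V" "Dom V f = Z \<otimes> X" "Cod V f = Y"
  shows "curry_arr V Z X Y f \<in> Arr V" "Dom V (curry_arr V Z X Y f) = Z" "Cod V (curry_arr V Z X Y f) = ihom V X Y"
    "ev V X Y \<cdot> (curry_arr V Z X Y f \<otimes>\<^sub>a \<i> X) = f"
proof -
  have "f \<in> hom V (Z \<otimes> X) Y" using assms by simp
  from theI'[OF ev_universal[OF assms(1-3) this]]
  show "curry_arr V Z X Y f \<in> Arr V" "Dom V (curry_arr V Z X Y f) = Z" "Cod V (curry_arr V Z X Y f) = ihom V X Y"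
    "ev V X Y \<cdot> (curry_arr V Z X Y f \<otimes>\<^sub>a \<i> X) = f"
    unfolding curry_arr_def by auto
qed

lemma uncurry_inj:
  assumes [simp]: "X \<in> Obj V" "Y \<in> Obj V" "g \<in> Arr V" "g' \<in> Arr V" "Dom V g = Z" "Dom V g' = Z"
    "Cod V g = ihom V X Y" "Cod V g' = ihom V X Y"
    and "ev V X Y \<cdot> (g \<otimes>\<^sub>a \<i> X) = ev V X Y \<cdot> (g' \<otimes>\<^sub>a \<i> X)"
  shows "g = g'"
proof -
  have [simp]: "Z \<in> Obj V" using Dom_Cod_Obj[of g] by simp
  have "\<exists>!h. h \<in> hom V Z (ihom V X Y) \<and> ev V X Y \<cdot> (h \<otimes>\<^sub>a \<i> X) = ev V X Y \<cdot> (g \<otimes>\<^sub>a \<i> X)"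
    by (rule ev_universal) simp_all
  moreover have "g \<in> hom V Z (ihom V X Y)" "g' \<in> hom V Z (ihom V X Y)"
    by simp_all
  ultimately show ?thesis
    using assms(9)[symmetric] by blast
qed

text \<open>Transposition along \<open>ev\<close> is injective, so each monoid-map equation is
  equivalent to its transpose; the transposes are the measuring axioms up to an invertible
  associator or unitor.\<close>

lemma mon_hom_convolution_iff:
  assumes A: "is_mon V A" and B: "is_mon V B" and C: "is_comon V C"
    and [simp]: "f \<in> Arr V" "Dom V f = mon_obj A" "Cod V f = ihom V (comon_obj C) (mon_obj B)"
  shows "f \<in> mon_hom V A (convolution_mon V C B) \<longleftrightarrow>
    is_measuring A B C (ev V (comon_obj C) (mon_obj B) \<cdot> (f \<otimes>\<^sub>a \<i> (comon_obj C)))"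
proof -
  let ?a = "mon_obj A" and ?b = "mon_obj B" and ?c = "comon_obj C"
  let ?H = "ihom V ?c ?b" and ?ev = "ev V ?c ?b" and ?\<delta> = "comon_comult C"
  let ?t = "?ev \<cdot> (f \<otimes>\<^sub>a \<i> ?c)"
  note [simp] = mon_typing[OF A] mon_typing[OF B] comon_typing[OF C]
  let ?m = "curry_arr V (?H \<otimes> ?H) ?c ?b (mon_mult B \<cdot> (?ev \<otimes>\<^sub>a ?ev) \<cdot> interchange V ?H ?H ?c ?c \<cdot> (\<i> (?H \<otimes> ?H) \<otimes>\<^sub>a ?\<delta>))"
  let ?u = "curry_arr V \<I> ?c ?b (mon_unit B \<cdot> comon_counit C \<cdot> \<l> ?c)"
  note m = curry_arr[of ?c ?b "?H \<otimes> ?H" "mon_mult B \<cdot> (?ev \<otimes>\<^sub>a ?ev) \<cdot> interchange V ?H ?H ?c ?c \<cdot> (\<i> (?H \<otimes> ?H) \<otimes>\<^sub>a ?\<delta>)", simplified]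
  note u = curry_arr[of ?c ?b \<I> "mon_unit B \<cdot> comon_counit C \<cdot> \<l> ?c", simplified]
  note [simp] = m(1-3) u(1-3)
  let ?r = "mon_mult B \<cdot> ext21 ?a ?c ?t ?b \<cdot> (\<i> ?a \<otimes>\<^sub>a ((\<i> ?c \<otimes>\<^sub>a ?t) \<cdot> braid_ext ?a ?c ?c \<cdot> (\<i> ?a \<otimes>\<^sub>a ?\<delta>)))"
  have 1: "?ev \<cdot> ((f \<cdot> mon_mult A) \<otimes>\<^sub>a \<i> ?c) = (?t \<cdot> ext21 ?a ?a (mon_mult A) ?c) \<cdot> \<a> ?a ?a ?c"
    by (simp add: ext21_def)
  have "?ev \<cdot> ((?m \<cdot> (f \<otimes>\<^sub>a f)) \<otimes>\<^sub>a \<i> ?c) = (?ev \<cdot> (?m \<otimes>\<^sub>a \<i> ?c)) \<cdot> ((f \<otimes>\<^sub>a f) \<otimes>\<^sub>a \<i> ?c)"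
    by simp
  also have "\<dots> = mon_mult B \<cdot> (?ev \<otimes>\<^sub>a ?ev) \<cdot> (interchange V ?H ?H ?c ?c \<cdot> ((f \<otimes>\<^sub>a f) \<otimes>\<^sub>a \<i> (?c \<otimes> ?c))) \<cdot> (\<i> (?a \<otimes> ?a) \<otimes>\<^sub>a ?\<delta>)"
    unfolding m(4) by simp
  also have "\<dots> = mon_mult B \<cdot> ((?t \<otimes>\<^sub>a ?t) \<cdot> interchange V ?a ?a ?c ?c \<cdot> (\<i> (?a \<otimes> ?a) \<otimes>\<^sub>a ?\<delta>))"
    by (simp add: interchange_nat)
  also have "\<dots> = ?r \<cdot> \<a> ?a ?a ?c"
    by (subst tens_interchange[where b = ?b]) simp_all
  finally have 2: "?ev \<cdot> ((?m \<cdot> (f \<otimes>\<^sub>a f)) \<otimes>\<^sub>a \<i> ?c) = ?r \<cdot> \<a> ?a ?a ?c" .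
  have mult: "f \<cdot> mon_mult A = ?m \<cdot> (f \<otimes>\<^sub>a f) \<longleftrightarrow> ?t \<cdot> ext21 ?a ?a (mon_mult A) ?c = ?r"
  proof
    assume "f \<cdot> mon_mult A = ?m \<cdot> (f \<otimes>\<^sub>a f)"
    then have "(?t \<cdot> ext21 ?a ?a (mon_mult A) ?c) \<cdot> \<a> ?a ?a ?c = ?r \<cdot> \<a> ?a ?a ?c"
      unfolding 1[symmetric] 2[symmetric] by simp
    then show "?t \<cdot> ext21 ?a ?a (mon_mult A) ?c = ?r"
      by (rule iso_right_cancel[rotated -1]) simp_all
  next
    assume e: "?t \<cdot> ext21 ?a ?a (mon_mult A) ?c = ?r"
    show "f \<cdot> mon_mult A = ?m \<cdot> (f \<otimes>\<^sub>a f)"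
      by (rule uncurry_inj[of ?c ?b]) (simp_all only: 1 2 e, simp_all)
  qed
  have 3: "?ev \<cdot> ((f \<cdot> mon_unit A) \<otimes>\<^sub>a \<i> ?c) = (?t \<cdot> (mon_unit A \<otimes>\<^sub>a \<i> ?c) \<cdot> \<i>\<n>\<v> (\<l> ?c)) \<cdot> \<l> ?c"
    by simp
  have 4: "?ev \<cdot> (?u \<otimes>\<^sub>a \<i> ?c) = (mon_unit B \<cdot> comon_counit C) \<cdot> \<l> ?c"
    using u(4) by simp
  have unit: "f \<cdot> mon_unit A = ?u \<longleftrightarrow> ?t \<cdot> (mon_unit A \<otimes>\<^sub>a \<i> ?c) \<cdot> \<i>\<n>\<v> (\<l> ?c) = mon_unit B \<cdot> comon_counit C"
  proof
    assume "f \<cdot> mon_unit A = ?u"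
    then have "(?t \<cdot> (mon_unit A \<otimes>\<^sub>a \<i> ?c) \<cdot> \<i>\<n>\<v> (\<l> ?c)) \<cdot> \<l> ?c = (mon_unit B \<cdot> comon_counit C) \<cdot> \<l> ?c"
      unfolding 3[symmetric] 4[symmetric] by simp
    then show "?t \<cdot> (mon_unit A \<otimes>\<^sub>a \<i> ?c) \<cdot> \<i>\<n>\<v> (\<l> ?c) = mon_unit B \<cdot> comon_counit C"
      by (rule iso_right_cancel[rotated -1]) simp_all
  next
    assume e: "?t \<cdot> (mon_unit A \<otimes>\<^sub>a \<i> ?c) \<cdot> \<i>\<n>\<v> (\<l> ?c) = mon_unit B \<cdot> comon_counit C"
    show "f \<cdot> mon_unit A = ?u"
      by (rule uncurry_inj[of ?c ?b]) (simp_all only: 3 4 e, simp_all)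
  qed
  have "f \<in> mon_hom V A (convolution_mon V C B) \<longleftrightarrow> f \<cdot> mon_mult A = ?m \<cdot> (f \<otimes>\<^sub>a f) \<and> f \<cdot> mon_unit A = ?u"
    by (simp add: mon_hom_def convolution_mon_def Let_def)
  then show ?thesis
    unfolding mult unit by (simp add: is_measuring_def Let_def)
qed

lemma ihom_precomp:
  assumes [simp]: "B \<in> Obj V" "g \<in> Arr V" "Dom V g = X" "Cod V g = Y"
  shows "ihom_precomp V B g \<in> Arr V" "Dom V (ihom_precomp V B g) = ihom V Y B" "Cod V (ihom_precomp V B g) = ihom V X B"
    "ev V X B \<cdot> (ihom_precomp V B g \<otimes>\<^sub>a \<i> X) = ev V Y B \<cdot> (\<i> (ihom V Y B) \<otimes>\<^sub>a g)"
proof -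
  have [simp]: "X \<in> Obj V" "Y \<in> Obj V" using Dom_Cod_Obj[of g] by simp_all
  have e: "ihom_precomp V B g = curry_arr V (ihom V Y B) X B (ev V Y B \<cdot> (\<i> (ihom V Y B) \<otimes>\<^sub>a g))"
    by (simp add: ihom_precomp_def Let_def)
  show "ihom_precomp V B g \<in> Arr V" "Dom V (ihom_precomp V B g) = ihom V Y B" "Cod V (ihom_precomp V B g) = ihom V X B"
    "ev V X B \<cdot> (ihom_precomp V B g \<otimes>\<^sub>a \<i> X) = ev V Y B \<cdot> (\<i> (ihom V Y B) \<otimes>\<^sub>a g)"
    unfolding e by (simp_all add: curry_arr)
qed

text \<open>Yoneda: \<open>t\<close> is the transpose of the monoid map that
  \<open>\<Theta> P\<close> sends to the identity of \<open>P\<close>, and naturality expresses all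
  other values of \<open>\<Theta>\<close> through it.\<close>

lemma universal_measuring:
  assumes A: "is_mon V A" and B: "is_mon V B" and u: "universal_measuring_comon V A B P"
  obtains t where "is_measuring A B P t"
    and "\<And>C s. is_comon V C \<Longrightarrow> is_measuring A B C s \<Longrightarrow> \<exists>g \<in> comon_hom V C P. s = t \<cdot> (\<i> (mon_obj A) \<otimes>\<^sub>a g)"
    and "\<And>C g g'. is_comon V C \<Longrightarrow> g \<in> comon_hom V C P \<Longrightarrow> g' \<in> comon_hom V C P \<Longrightarrow>
      t \<cdot> (\<i> (mon_obj A) \<otimes>\<^sub>a g) = t \<cdot> (\<i> (mon_obj A) \<otimes>\<^sub>a g') \<Longrightarrow> g = g'"
proof -
  let ?a = "mon_obj A" and ?b = "mon_obj B" and ?p = "comon_obj P"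
  obtain \<Theta> where P: "is_comon V P"
    and bij: "\<And>C. is_comon V C \<Longrightarrow> bij_betw (\<Theta> C) (mon_hom V A (convolution_mon V C B)) (comon_hom V C P)"
    and nat: "\<And>C C' g f. is_comon V C \<Longrightarrow> is_comon V C' \<Longrightarrow> g \<in> comon_hom V C' C \<Longrightarrow>
      f \<in> mon_hom V A (convolution_mon V C B) \<Longrightarrow> \<Theta> C' (ihom_precomp V ?b g \<cdot> f) = \<Theta> C f \<cdot> g"
    using u unfolding universal_measuring_comon_def by blast
  note [simp] = mon_typing[OF A] mon_typing[OF B] comon_typing[OF P]
  have "\<i> ?p \<in> comon_hom V P P"
    by (simp add: comon_hom_def)
  then obtain f where f: "f \<in> mon_hom V A (convolution_mon V P B)" and f1: "\<Theta> P f = \<i> ?p"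
    using bij[OF P] by (metis bij_betw_imp_surj_on imageE)
  have [simp]: "f \<in> Arr V" "Dom V f = ?a" "Cod V f = ihom V ?p ?b"
    using f by (auto simp: mon_hom_def convolution_mon_def Let_def)
  let ?t = "ev V ?p ?b \<cdot> (f \<otimes>\<^sub>a \<i> ?p)"
  have t: "is_measuring A B P ?t"
    using f by (simp add: mon_hom_convolution_iff[OF A B P])
  \<comment> \<open>Naturality at \<open>g\<close>, applied to the universal element:
    \<open>\<Theta> C\<close> sends \<open>[g, B] \<cdot> f\<close> to \<open>g\<close>, and the
    transpose of the same arrow is \<open>?t\<close> precomposed with \<open>g\<close>.\<close>
  have pre: "ihom_precomp V ?b g \<cdot> f \<in> Arr V" "Dom V (ihom_precomp V ?b g \<cdot> f) = ?a"
      "Cod V (ihom_precomp V ?b g \<cdot> f) = ihom V (comon_obj C) ?b"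
      "ev V (comon_obj C) ?b \<cdot> ((ihom_precomp V ?b g \<cdot> f) \<otimes>\<^sub>a \<i> (comon_obj C)) = ?t \<cdot> (\<i> ?a \<otimes>\<^sub>a g)"
      "\<Theta> C (ihom_precomp V ?b g \<cdot> f) = g"
    if C: "is_comon V C" and g: "g \<in> comon_hom V C P" for C g
  proof -
    note [simp] = comon_typing[OF C]
    have [simp]: "g \<in> Arr V" "Dom V g = comon_obj C" "Cod V g = ?p"
      using g by (auto simp: comon_hom_def)
    note i = ihom_precomp[of ?b g "comon_obj C" ?p, simplified]
    note [simp] = i(1-3)
    show "ihom_precomp V ?b g \<cdot> f \<in> Arr V" "Dom V (ihom_precomp V ?b g \<cdot> f) = ?a"
      "Cod V (ihom_precomp V ?b g \<cdot> f) = ihom V (comon_obj C) ?b"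
      by simp_all
    have "ev V (comon_obj C) ?b \<cdot> ((ihom_precomp V ?b g \<cdot> f) \<otimes>\<^sub>a \<i> (comon_obj C))
        = (ev V (comon_obj C) ?b \<cdot> (ihom_precomp V ?b g \<otimes>\<^sub>a \<i> (comon_obj C))) \<cdot> (f \<otimes>\<^sub>a \<i> (comon_obj C))"
      by simp
    then show "ev V (comon_obj C) ?b \<cdot> ((ihom_precomp V ?b g \<cdot> f) \<otimes>\<^sub>a \<i> (comon_obj C)) = ?t \<cdot> (\<i> ?a \<otimes>\<^sub>a g)"
      unfolding i(4) by simp
    show "\<Theta> C (ihom_precomp V ?b g \<cdot> f) = g"
      using nat[OF P C g f] by (simp add: f1)
  qed
  show ?thesis
  proof (rule that[OF t])
    fix C s assume C: "is_comon V C" and s: "is_measuring A B C s"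
    note [simp] = comon_typing[OF C] is_measuringD(1-3)[OF s]
    let ?h = "curry_arr V ?a (comon_obj C) ?b s"
    note h = curry_arr[of "comon_obj C" ?b ?a s, simplified]
    have hm: "?h \<in> mon_hom V A (convolution_mon V C B)"
      using s by (simp add: mon_hom_convolution_iff[OF A B C] h)
    define g where "g = \<Theta> C ?h"
    have g: "g \<in> comon_hom V C P"
      using bij[OF C] hm unfolding g_def by (auto simp: bij_betw_def)
    \<comment> \<open>Injectivity of \<open>\<Theta> C\<close> holds on monoid maps, so membership
      must be checked first.\<close>
    have "ihom_precomp V ?b g \<cdot> f \<in> mon_hom V A (convolution_mon V C B)"
      unfolding mon_hom_convolution_iff[OF A B C pre(1-3)[OF C g]] pre(4)[OF C g]
      by (rule is_measuring_push[OF A B C P g t])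
    then have "ihom_precomp V ?b g \<cdot> f = ?h"
      using bij[OF C] hm pre(5)[OF C g] unfolding bij_betw_def inj_on_def by (simp add: g_def)
    then have "s = ?t \<cdot> (\<i> ?a \<otimes>\<^sub>a g)"
      using pre(4)[OF C g] h(4) by simp
    then show "\<exists>g \<in> comon_hom V C P. s = ?t \<cdot> (\<i> ?a \<otimes>\<^sub>a g)"
      using g by blast
  next
    fix C g g' assume C: "is_comon V C" and g: "g \<in> comon_hom V C P" "g' \<in> comon_hom V C P"
      and e: "?t \<cdot> (\<i> ?a \<otimes>\<^sub>a g) = ?t \<cdot> (\<i> ?a \<otimes>\<^sub>a g')"
    \<comment> \<open>Equal transposes come from equal arrows into \<open>[C, B]\<close>; applying
      \<open>\<Theta> C\<close> to these recovers \<open>g\<close> and \<open>g'\<close>.\<close>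
    have "ihom_precomp V ?b g \<cdot> f = ihom_precomp V ?b g' \<cdot> f"
      by (rule uncurry_inj[of "comon_obj C" ?b])
        (simp_all only: pre[OF C g(1)] pre[OF C g(2)] e comon_typing[OF C] mon_typing[OF B])
    then show "g = g'"
      using pre(5)[OF C g(1)] pre(5)[OF C g(2)] by argo
  qed
qed

end

section \<open>Duals and pushouts\<close>

context monoidal_category
begin

definition is_dual :: "'o \<Rightarrow> 'o \<Rightarrow> 'm \<Rightarrow> 'm \<Rightarrow> bool"
  where "is_dual X Y e n \<longleftrightarrow> X \<in> Obj V \<and> Y \<in> Obj V \<and> e \<in> hom V (Y \<otimes> X) \<I> \<and> n \<in> hom V \<I> (X \<otimes> Y) \<and>
      \<r> X \<cdot> (\<i> X \<otimes>\<^sub>a e) \<cdot> \<a> X Y X \<cdot> (n \<otimes>\<^sub>a \<i> X) \<cdot> \<i>\<n>\<v> (\<l> X) = \<i> X \<and>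
      \<l> Y \<cdot> (e \<otimes>\<^sub>a \<i> Y) \<cdot> \<i>\<n>\<v> (\<a> Y X Y) \<cdot> (\<i> Y \<otimes>\<^sub>a n) \<cdot> \<i>\<n>\<v> (\<r> Y) = \<i> Y"

lemma is_dualD:
  assumes "is_dual X Y e n"
  shows "X \<in> Obj V" "Y \<in> Obj V" "e \<in> Arr V" "Dom V e = Y \<otimes> X" "Cod V e = \<I>"
    "n \<in> Arr V" "Dom V n = \<I>" "Cod V n = X \<otimes> Y"
    "\<r> X \<cdot> (\<i> X \<otimes>\<^sub>a e) \<cdot> \<a> X Y X \<cdot> (n \<otimes>\<^sub>a \<i> X) \<cdot> \<i>\<n>\<v> (\<l> X) = \<i> X"
    "\<l> Y \<cdot> (e \<otimes>\<^sub>a \<i> Y) \<cdot> \<i>\<n>\<v> (\<a> Y X Y) \<cdot> (\<i> Y \<otimes>\<^sub>a n) \<cdot> \<i>\<n>\<v> (\<r> Y) = \<i> Y"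
  using assms by (auto simp: is_dual_def)

text \<open>The counit of the adjunction in which \<open>Y \<otimes> -\<close> is left adjoint to
  \<open>X \<otimes> -\<close>; \<open>dual_coev\<close> is the unit. Arrows
  \<open>Q \<rightarrow> X \<otimes> Z\<close> thus transpose to arrows
  \<open>Y \<otimes> Q \<rightarrow> Z\<close>.\<close>

definition dual_ev :: "'o \<Rightarrow> 'o \<Rightarrow> 'm \<Rightarrow> 'o \<Rightarrow> 'm"
  where "dual_ev X Y e Q = \<l> Q \<cdot> (e \<otimes>\<^sub>a \<i> Q) \<cdot> \<i>\<n>\<v> (\<a> Y X Q)"

definition dual_coev :: "'o \<Rightarrow> 'o \<Rightarrow> 'm \<Rightarrow> 'o \<Rightarrow> 'm"
  where "dual_coev X Y n Q = \<a> X Y Q \<cdot> (n \<otimes>\<^sub>a \<i> Q) \<cdot> \<i>\<n>\<v> (\<l> Q)"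

context
  fixes X Y e n
  assumes dual: "is_dual X Y e n"
begin

lemmas [simp] = is_dualD(1-8)[OF dual]

lemma dual_typing [simp]:
  assumes [simp]: "Q \<in> Obj V"
  shows "dual_ev X Y e Q \<in> Arr V" "Dom V (dual_ev X Y e Q) = Y \<otimes> (X \<otimes> Q)" "Cod V (dual_ev X Y e Q) = Q"
    "dual_coev X Y n Q \<in> Arr V" "Dom V (dual_coev X Y n Q) = Q" "Cod V (dual_coev X Y n Q) = X \<otimes> (Y \<otimes> Q)"
  by (simp_all add: dual_ev_def dual_coev_def)

lemma dual_ev_nat:
  assumes [simp]: "g \<in> Arr V" "Dom V g = Q" "Cod V g = Q'"
  shows "dual_ev X Y e Q' \<cdot> (\<i> Y \<otimes>\<^sub>a (\<i> X \<otimes>\<^sub>a g)) = g \<cdot> dual_ev X Y e Q"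
proof -
  have [simp]: "Q \<in> Obj V" "Q' \<in> Obj V" using Dom_Cod_Obj[of g] by simp_all
  have "dual_ev X Y e Q' \<cdot> (\<i> Y \<otimes>\<^sub>a (\<i> X \<otimes>\<^sub>a g)) = (\<l> Q' \<cdot> (\<i> \<I> \<otimes>\<^sub>a g)) \<cdot> (e \<otimes>\<^sub>a \<i> Q) \<cdot> \<i>\<n>\<v> (\<a> Y X Q)"
    by (simp add: dual_ev_def pull_inv)
  then show ?thesis by (simp add: lunit_nat dual_ev_def)
qed

lemma dual_coev_nat:
  assumes [simp]: "g \<in> Arr V" "Dom V g = Q" "Cod V g = Q'"
  shows "dual_coev X Y n Q' \<cdot> g = (\<i> X \<otimes>\<^sub>a (\<i> Y \<otimes>\<^sub>a g)) \<cdot> dual_coev X Y n Q"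
proof -
  have [simp]: "Q \<in> Obj V" "Q' \<in> Obj V" using Dom_Cod_Obj[of g] by simp_all
  have m: "\<a> X Y Q' \<cdot> (\<i> (X \<otimes> Y) \<otimes>\<^sub>a g) = (\<i> X \<otimes>\<^sub>a (\<i> Y \<otimes>\<^sub>a g)) \<cdot> \<a> X Y Q"
    using assoc_nat[of "\<i> X" "\<i> Y" g X Y Q'] by simp
  have "dual_coev X Y n Q' \<cdot> g = (\<a> X Y Q' \<cdot> (\<i> (X \<otimes> Y) \<otimes>\<^sub>a g)) \<cdot> (n \<otimes>\<^sub>a \<i> Q) \<cdot> \<i>\<n>\<v> (\<l> Q)"
    by (simp add: dual_coev_def lunit_inv_nat)
  then show ?thesis unfolding m by (simp add: dual_coev_def)
qed

text \<open>Unit coherence makes the unit of the adjunction compatible with a further factor on the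
  right, which the parameter of universal coactions requires. The next lemma is the version for the
  counit.\<close>

lemma dual_coev_tens:
  assumes [simp]: "Q \<in> Obj V" "R \<in> Obj V"
  shows "\<a> X (Y \<otimes> Q) R \<cdot> (dual_coev X Y n Q \<otimes>\<^sub>a \<i> R) = (\<i> X \<otimes>\<^sub>a \<i>\<n>\<v> (\<a> Y Q R)) \<cdot> dual_coev X Y n (Q \<otimes> R)"
  by (simp add: dual_coev_def push lunit_inv_tens)

lemma dual_ev_tens:
  assumes [simp]: "Q \<in> Obj V" "R \<in> Obj V"
  shows "dual_ev X Y e Q \<otimes>\<^sub>a \<i> R = dual_ev X Y e (Q \<otimes> R) \<cdot> (\<i> Y \<otimes>\<^sub>a \<a> X Q R) \<cdot> \<a> Y (X \<otimes> Q) R"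
proof -
  have "dual_ev X Y e Q \<otimes>\<^sub>a \<i> R = (\<l> Q \<otimes>\<^sub>a \<i> R) \<cdot> (((e \<otimes>\<^sub>a \<i> Q) \<cdot> \<i>\<n>\<v> (\<a> Y X Q)) \<otimes>\<^sub>a \<i> R)"
    by (simp add: dual_ev_def)
  also have "\<dots> = \<l> (Q \<otimes> R) \<cdot> (\<a> \<I> Q R \<cdot> (((e \<otimes>\<^sub>a \<i> Q) \<cdot> \<i>\<n>\<v> (\<a> Y X Q)) \<otimes>\<^sub>a \<i> R))"
    unfolding lunit_tens[OF assms, symmetric] by simp
  also have "\<dots> = dual_ev X Y e (Q \<otimes> R) \<cdot> (\<i> Y \<otimes>\<^sub>a \<a> X Q R) \<cdot> \<a> Y (X \<otimes> Q) R"
    by (simp add: push dual_ev_def)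
  finally show ?thesis .
qed

text \<open>A triangle identity of the adjunction: the first zigzag equation of the dual, tensored
  with \<open>Q\<close>. The second one is \<open>dual_snake2\<close>.\<close>

lemma dual_snake1:
  assumes [simp]: "Q \<in> Obj V"
  shows "(\<i> X \<otimes>\<^sub>a dual_ev X Y e Q) \<cdot> dual_coev X Y n (X \<otimes> Q) = \<i> (X \<otimes> Q)"
proof -
  have "\<i> (X \<otimes> Q) = (\<r> X \<cdot> (\<i> X \<otimes>\<^sub>a e) \<cdot> \<a> X Y X \<cdot> (n \<otimes>\<^sub>a \<i> X) \<cdot> \<i>\<n>\<v> (\<l> X)) \<otimes>\<^sub>a \<i> Q"
    unfolding is_dualD(9)[OF dual] by simp
  also have "\<dots> = (\<r> X \<otimes>\<^sub>a \<i> Q) \<cdot> (((\<i> X \<otimes>\<^sub>a e) \<cdot> \<a> X Y X \<cdot> (n \<otimes>\<^sub>a \<i> X) \<cdot> \<i>\<n>\<v> (\<l> X)) \<otimes>\<^sub>a \<i> Q)"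
    by simp
  also have "\<dots> = (\<i> X \<otimes>\<^sub>a \<l> Q) \<cdot> (\<a> X \<I> Q \<cdot> (((\<i> X \<otimes>\<^sub>a e) \<cdot> \<a> X Y X \<cdot> (n \<otimes>\<^sub>a \<i> X) \<cdot> \<i>\<n>\<v> (\<l> X)) \<otimes>\<^sub>a \<i> Q))"
    unfolding triangle[OF is_dualD(1)[OF dual] assms, symmetric] by simp
  also have "\<dots> = (\<i> X \<otimes>\<^sub>a dual_ev X Y e Q) \<cdot> dual_coev X Y n (X \<otimes> Q)"
    by (simp add: push dual_ev_def dual_coev_def lunit_inv_tens)
  finally show ?thesis ..
qed

lemma dual_snake2:
  assumes [simp]: "Q \<in> Obj V"
  shows "dual_ev X Y e (Y \<otimes> Q) \<cdot> (\<i> Y \<otimes>\<^sub>a dual_coev X Y n Q) = \<i> (Y \<otimes> Q)"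
proof -
  have "\<i> (Y \<otimes> Q) = (\<l> Y \<cdot> (e \<otimes>\<^sub>a \<i> Y) \<cdot> \<i>\<n>\<v> (\<a> Y X Y) \<cdot> (\<i> Y \<otimes>\<^sub>a n) \<cdot> \<i>\<n>\<v> (\<r> Y)) \<otimes>\<^sub>a \<i> Q"
    unfolding is_dualD(10)[OF dual] by simp
  also have "\<dots> = (\<l> Y \<otimes>\<^sub>a \<i> Q) \<cdot> (((e \<otimes>\<^sub>a \<i> Y) \<cdot> \<i>\<n>\<v> (\<a> Y X Y) \<cdot> (\<i> Y \<otimes>\<^sub>a n) \<cdot> \<i>\<n>\<v> (\<r> Y)) \<otimes>\<^sub>a \<i> Q)"
    by simp
  also have "\<dots> = \<l> (Y \<otimes> Q) \<cdot> (\<a> \<I> Y Q \<cdot> (((e \<otimes>\<^sub>a \<i> Y) \<cdot> \<i>\<n>\<v> (\<a> Y X Y) \<cdot> (\<i> Y \<otimes>\<^sub>a n) \<cdot> \<i>\<n>\<v> (\<r> Y)) \<otimes>\<^sub>a \<i> Q))"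
    unfolding lunit_tens[OF is_dualD(2)[OF dual] assms, symmetric] by simp
  also have "\<dots> = dual_ev X Y e (Y \<otimes> Q) \<cdot> (\<i> Y \<otimes>\<^sub>a dual_coev X Y n Q)"
    by (simp add: push dual_ev_def dual_coev_def triangle_inv)
  finally show ?thesis ..
qed

text \<open>\<open>\<rho>\<close> is the transpose of an arbitrary arrow \<open>i\<close> out of
  \<open>Y \<otimes> X\<close>, later a leg of the pushout.\<close>

context
  fixes D i \<rho>
  assumes D [simp]: "D \<in> Obj V" and i [simp]: "i \<in> Arr V" "Dom V i = Y \<otimes> X" "Cod V i = D"
  defines "\<rho> \<equiv> (\<i> X \<otimes>\<^sub>a i) \<cdot> dual_coev X Y n X"
begin

lemma ext12_dual_coaction:
  assumes [simp]: "R \<in> Obj V"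
  shows "ext12 X D \<rho> R = (\<i> X \<otimes>\<^sub>a ((i \<otimes>\<^sub>a \<i> R) \<cdot> \<i>\<n>\<v> (\<a> Y X R))) \<cdot> dual_coev X Y n (X \<otimes> R)"
proof -
  have "ext12 X D \<rho> R = (\<i> X \<otimes>\<^sub>a (i \<otimes>\<^sub>a \<i> R)) \<cdot> (\<a> X (Y \<otimes> X) R \<cdot> (dual_coev X Y n X \<otimes>\<^sub>a \<i> R))"
    by (simp add: ext12_def \<rho>_def push)
  then show ?thesis by (simp add: dual_coev_tens)
qed

text \<open>By a triangle identity, testing arrows out of \<open>D \<otimes> R\<close> on the
  coaction amounts to testing them on \<open>i \<otimes>\<^sub>a \<i> R\<close>.\<close>

lemma dual_coaction_mate:
  assumes [simp]: "R \<in> Obj V" "u \<in> Arr V" "Dom V u = D \<otimes> R" "Cod V u = Z"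
  shows "dual_ev X Y e Z \<cdot> (\<i> Y \<otimes>\<^sub>a ((\<i> X \<otimes>\<^sub>a u) \<cdot> ext12 X D \<rho> R)) \<cdot> \<a> Y X R = u \<cdot> (i \<otimes>\<^sub>a \<i> R)"
proof -
  let ?v = "u \<cdot> (i \<otimes>\<^sub>a \<i> R) \<cdot> \<i>\<n>\<v> (\<a> Y X R)"
  have [simp]: "Z \<in> Obj V" using Dom_Cod_Obj[of u] by simp
  have "dual_ev X Y e Z \<cdot> (\<i> Y \<otimes>\<^sub>a ((\<i> X \<otimes>\<^sub>a u) \<cdot> ext12 X D \<rho> R)) \<cdot> \<a> Y X R
      = (dual_ev X Y e Z \<cdot> (\<i> Y \<otimes>\<^sub>a (\<i> X \<otimes>\<^sub>a ?v))) \<cdot> (\<i> Y \<otimes>\<^sub>a dual_coev X Y n (X \<otimes> R)) \<cdot> \<a> Y X R"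
    by (simp add: ext12_dual_coaction)
  also have "\<dots> = ?v \<cdot> (dual_ev X Y e (Y \<otimes> (X \<otimes> R)) \<cdot> (\<i> Y \<otimes>\<^sub>a dual_coev X Y n (X \<otimes> R))) \<cdot> \<a> Y X R"
    by (subst dual_ev_nat[of _ "Y \<otimes> (X \<otimes> R)"]) simp_all
  also have "\<dots> = u \<cdot> (i \<otimes>\<^sub>a \<i> R)"
    by (simp add: dual_snake2)
  finally show ?thesis .
qed

end

text \<open>Transposing there and back, by the other triangle identity; it recovers a prescribed
  \<open>\<alpha>\<close> from its transpose.\<close>

lemma dual_mate:
  assumes [simp]: "R \<in> Obj V" "Z \<in> Obj V" "\<alpha> \<in> Arr V" "Dom V \<alpha> = X \<otimes> R" "Cod V \<alpha> = X \<otimes> Z"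
  shows "(\<i> X \<otimes>\<^sub>a (dual_ev X Y e Z \<cdot> (\<i> Y \<otimes>\<^sub>a \<alpha>))) \<cdot> dual_coev X Y n (X \<otimes> R) = \<alpha>"
proof -
  have "(\<i> X \<otimes>\<^sub>a (dual_ev X Y e Z \<cdot> (\<i> Y \<otimes>\<^sub>a \<alpha>))) \<cdot> dual_coev X Y n (X \<otimes> R)
      = (\<i> X \<otimes>\<^sub>a dual_ev X Y e Z) \<cdot> ((\<i> X \<otimes>\<^sub>a (\<i> Y \<otimes>\<^sub>a \<alpha>)) \<cdot> dual_coev X Y n (X \<otimes> R))"
    by simp
  also have "\<dots> = ((\<i> X \<otimes>\<^sub>a dual_ev X Y e Z) \<cdot> dual_coev X Y n (X \<otimes> Z)) \<cdot> \<alpha>"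
    by (subst dual_coev_nat[symmetric]) simp_all
  finally show ?thesis by (simp add: dual_snake1)
qed

end

end

section \<open>Pushouts from cocompleteness, and their preservation by tensoring\<close>

definition is_pushout :: "('o, 'm, 'z) cat_scheme \<Rightarrow> 'm \<Rightarrow> 'm \<Rightarrow> 'm \<Rightarrow> 'm \<Rightarrow> bool"
  where "is_pushout C k h i j \<longleftrightarrow> k \<in> Arr C \<and> h \<in> Arr C \<and> i \<in> Arr C \<and> j \<in> Arr C \<and> Dom C k = Dom C h \<and>
    Dom C i = Cod C k \<and> Dom C j = Cod C h \<and> Cod C i = Cod C j \<and> i \<cdot>\<^bsub>C\<^esub> k = j \<cdot>\<^bsub>C\<^esub> h \<and>
    (\<forall>Z. \<forall>s \<in> hom C (Cod C k) Z. \<forall>s' \<in> hom C (Cod C h) Z. s \<cdot>\<^bsub>C\<^esub> k = s' \<cdot>\<^bsub>C\<^esub> h \<longrightarrow>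
      (\<exists>!u. u \<in> hom C (Cod C i) Z \<and> u \<cdot>\<^bsub>C\<^esub> i = s \<and> u \<cdot>\<^bsub>C\<^esub> j = s'))"

text \<open>Diagrams are indexed by categories inside the universe type, so even a span needs enough
  elements there; an infinite cardinal below the universe guarantees them.\<close>

lemma infinite_universe:
  assumes "small_regular_cardinal (r :: 'u rel)"
  shows "infinite (UNIV :: 'u set)"
proof -
  have "cinfinite r" "r \<le>o |UNIV :: 'u set|"
    using assms by (auto simp: small_regular_cardinal_def intro: ordLess_imp_ordLeq)
  then have "cinfinite |UNIV :: 'u set|"
    by (rule cinfinite_mono[rotated])
  then show ?thesis
    by (simp add: cinfinite_def Field_card_of)
qed

lemma (in category) ex_pushout:
  assumes coc: "cocomplete TYPE('u) C" and inf: "infinite (UNIV :: 'u set)"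
    and [simp]: "k \<in> Arr C" "h \<in> Arr C" "Dom C h = Dom C k"
  obtains i j where "is_pushout C k h i j"
proof -
  obtain \<phi> :: "nat \<Rightarrow> 'u" where \<phi>: "inj \<phi>"
    using inf by (auto simp: infinite_iff_countable_subset)
  \<comment> \<open>The span category inside \<open>'u\<close>: objects \<open>p\<close>,
    \<open>q\<close>, \<open>r\<close>, each its own identity, and arrows \<open>u\<close> from
    \<open>p\<close> to \<open>q\<close> and \<open>v\<close> from \<open>p\<close> to
    \<open>r\<close>.\<close>
  define p q r u v where "p = \<phi> 0" and "q = \<phi> 1" and "r = \<phi> 2" and "u = \<phi> 3" and "v = \<phi> 4"
  have ne [simp]: "p \<noteq> q" "p \<noteq> r" "p \<noteq> u" "p \<noteq> v" "q \<noteq> r" "q \<noteq> u" "q \<noteq> v" "r \<noteq> u" "r \<noteq> v" "u \<noteq> v"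
    by (simp_all add: p_def q_def r_def u_def v_def inj_eq[OF \<phi>])
  note [simp] = ne[symmetric]
  \<comment> \<open>If \<open>g\<close> is \<open>u\<close> or \<open>v\<close>, a composable
    \<open>f\<close> is the identity \<open>p\<close>; so \<open>Comp\<close> returns the factor
    that is not an identity, if there is one.\<close>
  define J :: "('u, 'u) cat" where "J = \<lparr>Obj = {p, q, r}, Arr = {p, q, r, u, v},
    Dom = (\<lambda>x. if x = q then q else if x = r then r else p),
    Cod = (\<lambda>x. if x = q \<or> x = u then q else if x = r \<or> x = v then r else p),
    id_arr = (\<lambda>x. x), Comp = (\<lambda>g f. if g \<in> {p, q, r} then f else g)\<rparr>"
  define F where "F = \<lparr>fobj = (\<lambda>x. if x = q then Cod C k else if x = r then Cod C h else Dom C k),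
    farr = (\<lambda>x. if x = u then k else if x = v then h else if x = q then \<i> (Cod C k)
      else if x = r then \<i> (Cod C h) else \<i> (Dom C k))\<rparr>"
  have J: "category J"
    by unfold_locales (auto simp: J_def split: if_splits)
  have F: "is_functor J C F"
    unfolding is_functor_def using J category_axioms by (auto simp: J_def F_def split: if_splits)
  have "small TYPE('u) S" if "finite S" for S :: "'u set"
    unfolding small_def using that inf
    by (intro Cfinite_ordLess_Cinfinite conjI card_of_Card_order)
      (auto simp: cfinite_def cinfinite_def Field_card_of)
  then have "small_category J"
    using J unfolding small_category_def by (simp add: J_def)
  then obtain L \<kappa> where L: "colimit J C F L \<kappa>"
    using coc F unfolding cocomplete_def by blast
  then have co: "cocone J C F L \<kappa>" by (simp add: colimit_def)
  have [simp]: "L \<in> Obj C" "\<kappa> p \<in> Arr C" "\<kappa> q \<in> Arr C" "\<kappa> r \<in> Arr C" "Dom C (\<kappa> p) = Dom C k"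
    "Dom C (\<kappa> q) = Cod C k" "Dom C (\<kappa> r) = Cod C h" "Cod C (\<kappa> p) = L" "Cod C (\<kappa> q) = L" "Cod C (\<kappa> r) = L"
    and k: "\<kappa> q \<cdot> k = \<kappa> p" and h: "\<kappa> r \<cdot> h = \<kappa> p"
    using co by (auto simp: cocone_def J_def F_def)
  have univ: "\<exists>!w. w \<in> hom C L Z \<and> w \<cdot> \<kappa> q = s \<and> w \<cdot> \<kappa> r = s'"
    if s: "s \<in> hom C (Cod C k) Z" and s': "s' \<in> hom C (Cod C h) Z" and e: "s \<cdot> k = s' \<cdot> h" for Z s s'
  proof -
    define \<tau> where "\<tau> x = (if x = q then s else if x = r then s' else s \<cdot> k)" for x
    have "Z \<in> Obj C" using s by auto
    then have "cocone J C F Z \<tau>"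
      using s s' e by (auto simp: cocone_def J_def F_def \<tau>_def)
    then have "\<exists>!w. w \<in> hom C L Z \<and> (\<forall>x \<in> Obj J. w \<cdot> \<kappa> x = \<tau> x)"
      using L by (simp add: colimit_def)
    \<comment> \<open>The component at \<open>p\<close> is forced by the one at \<open>q\<close>, so
      a cocone on the span is a pair of arrows.\<close>
    moreover have "(\<forall>x \<in> Obj J. w \<cdot> \<kappa> x = \<tau> x) \<longleftrightarrow> w \<cdot> \<kappa> q = s \<and> w \<cdot> \<kappa> r = s'" if "w \<in> hom C L Z" for w
    proof -
      have "w \<cdot> \<kappa> p = (w \<cdot> \<kappa> q) \<cdot> k"
        using that by (simp add: k)
      then show ?thesis
        by (auto simp: J_def \<tau>_def)
    qed
    ultimately show ?thesis by (metis (no_types, lifting))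
  qed
  have "is_pushout C k h (\<kappa> q) (\<kappa> r)"
    unfolding is_pushout_def
    by (intro conjI allI ballI impI) (use univ in \<open>simp_all del: in_hom_iff add: k h\<close>)
  then show ?thesis by (rule that)
qed

context braided_monoidal_closed_category
begin

text \<open>\<open>- \<otimes> R\<close> is a left adjoint and preserves pushouts: transpose to
  \<open>ihom V R Z\<close>, use the universal property there, and transpose back.\<close>

lemma pushout_tens:
  assumes po: "is_pushout V k h i j" and [simp]: "R \<in> Obj V" "Z \<in> Obj V"
  shows "s \<in> hom V (Cod V k \<otimes> R) Z \<Longrightarrow> s' \<in> hom V (Cod V h \<otimes> R) Z \<Longrightarrow>
      s \<cdot> (k \<otimes>\<^sub>a \<i> R) = s' \<cdot> (h \<otimes>\<^sub>a \<i> R) \<Longrightarrow>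
      \<exists>w \<in> hom V (Cod V i \<otimes> R) Z. w \<cdot> (i \<otimes>\<^sub>a \<i> R) = s \<and> w \<cdot> (j \<otimes>\<^sub>a \<i> R) = s'"
    and "w \<in> hom V (Cod V i \<otimes> R) Z \<Longrightarrow> w' \<in> hom V (Cod V i \<otimes> R) Z \<Longrightarrow>
      w \<cdot> (i \<otimes>\<^sub>a \<i> R) = w' \<cdot> (i \<otimes>\<^sub>a \<i> R) \<Longrightarrow> w \<cdot> (j \<otimes>\<^sub>a \<i> R) = w' \<cdot> (j \<otimes>\<^sub>a \<i> R) \<Longrightarrow> w = w'"
proof -
  have [simp]: "k \<in> Arr V" "h \<in> Arr V" "i \<in> Arr V" "j \<in> Arr V" "Dom V k = Dom V h"
    "Dom V i = Cod V k" "Dom V j = Cod V h" "Cod V j = Cod V i"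
    using po by (simp_all add: is_pushout_def)
  have univ: "\<And>Z s s'. s \<in> hom V (Cod V k) Z \<Longrightarrow> s' \<in> hom V (Cod V h) Z \<Longrightarrow> s \<cdot> k = s' \<cdot> h \<Longrightarrow>
      \<exists>!u. u \<in> hom V (Cod V i) Z \<and> u \<cdot> i = s \<and> u \<cdot> j = s'"
    and comm: "i \<cdot> k = j \<cdot> h"
    using po unfolding is_pushout_def by blast+
  let ?ev = "ev V R Z" and ?H = "ihom V R Z"
  have ev: "?ev \<cdot> ((g \<cdot> g') \<otimes>\<^sub>a \<i> R) = (?ev \<cdot> (g \<otimes>\<^sub>a \<i> R)) \<cdot> (g' \<otimes>\<^sub>a \<i> R)"
    if "g \<in> Arr V" "g' \<in> Arr V" "Cod V g' = Dom V g" "Cod V g = ?H" for g g'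
    using that by simp
  show "\<exists>w \<in> hom V (Cod V i \<otimes> R) Z. w \<cdot> (i \<otimes>\<^sub>a \<i> R) = s \<and> w \<cdot> (j \<otimes>\<^sub>a \<i> R) = s'"
    if s: "s \<in> hom V (Cod V k \<otimes> R) Z" and s': "s' \<in> hom V (Cod V h \<otimes> R) Z"
      and e: "s \<cdot> (k \<otimes>\<^sub>a \<i> R) = s' \<cdot> (h \<otimes>\<^sub>a \<i> R)"
  proof -
    let ?s = "curry_arr V (Cod V k) R Z s" and ?s' = "curry_arr V (Cod V h) R Z s'"
    have [simp]: "s \<in> Arr V" "Dom V s = Cod V k \<otimes> R" "Cod V s = Z" "s' \<in> Arr V" "Dom V s' = Cod V h \<otimes> R" "Cod V s' = Z"
      using s s' by auto
    note c = curry_arr[of R Z "Cod V k" s, simplified] and c' = curry_arr[of R Z "Cod V h" s', simplified]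
    note [simp] = c(1-3) c'(1-3)
    have "?s \<cdot> k = ?s' \<cdot> h"
      by (rule uncurry_inj[of R Z]) (simp_all only: ev c c' e \<open>k \<in> Arr V\<close> \<open>h \<in> Arr V\<close>, simp_all)
    then obtain w where "w \<in> hom V (Cod V i) ?H" and w: "w \<cdot> i = ?s" "w \<cdot> j = ?s'"
      using univ[of ?s ?H ?s'] by auto
    then have [simp]: "w \<in> Arr V" "Dom V w = Cod V i" "Cod V w = ?H" by auto
    have "(?ev \<cdot> (w \<otimes>\<^sub>a \<i> R)) \<cdot> (i \<otimes>\<^sub>a \<i> R) = s" "(?ev \<cdot> (w \<otimes>\<^sub>a \<i> R)) \<cdot> (j \<otimes>\<^sub>a \<i> R) = s'"
      using w c(4) c'(4) by simp_all
    then show ?thesis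
      by (intro bexI[of _ "?ev \<cdot> (w \<otimes>\<^sub>a \<i> R)"]) simp_all
  qed
  show "w = w'"
    if w: "w \<in> hom V (Cod V i \<otimes> R) Z" and w': "w' \<in> hom V (Cod V i \<otimes> R) Z"
      and e: "w \<cdot> (i \<otimes>\<^sub>a \<i> R) = w' \<cdot> (i \<otimes>\<^sub>a \<i> R)" "w \<cdot> (j \<otimes>\<^sub>a \<i> R) = w' \<cdot> (j \<otimes>\<^sub>a \<i> R)"
  proof -
    let ?w = "curry_arr V (Cod V i) R Z w" and ?w' = "curry_arr V (Cod V i) R Z w'"
    have [simp]: "w \<in> Arr V" "Dom V w = Cod V i \<otimes> R" "Cod V w = Z" "w' \<in> Arr V" "Dom V w' = Cod V i \<otimes> R" "Cod V w' = Z"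
      using w w' by auto
    note c = curry_arr[of R Z "Cod V i" w, simplified] and c' = curry_arr[of R Z "Cod V i" w', simplified]
    note [simp] = c(1-3) c'(1-3)
    have i: "?w' \<cdot> i = ?w \<cdot> i"
      by (rule uncurry_inj[of R Z]) (simp_all only: ev c c' e \<open>i \<in> Arr V\<close>, simp_all)
    have j: "?w' \<cdot> j = ?w \<cdot> j"
      by (rule uncurry_inj[of R Z]) (simp_all only: ev c c' e \<open>j \<in> Arr V\<close> \<open>Cod V j = Cod V i\<close>, simp_all)
    \<comment> \<open>\<open>?w\<close> and \<open>?w'\<close> both mediate the cocone that
      \<open>?w\<close> induces on the two legs.\<close>
    have "(?w \<cdot> i) \<cdot> k = (?w \<cdot> j) \<cdot> h"
      using comm by simp
    then have "\<exists>!u. u \<in> hom V (Cod V i) ?H \<and> u \<cdot> i = ?w \<cdot> i \<and> u \<cdot> j = ?w \<cdot> j"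
      by (intro univ) simp_all
    moreover have "?w \<in> hom V (Cod V i) ?H" "?w' \<in> hom V (Cod V i) ?H"
      by simp_all
    ultimately have "?w = ?w'"
      using i j by blast
    then show ?thesis
      using c(4) c'(4) by argo
  qed
qed


text \<open>Over the dual, an arrow \<open>X \<otimes> R \<rightarrow> X \<otimes> Z\<close>
  transposes to \<open>(Y \<otimes> X) \<otimes> R \<rightarrow> Z\<close>, and compatibility of two
  such arrows with \<open>f\<close> becomes agreement on \<open>(Y' \<otimes> X) \<otimes> R\<close>
  along \<open>k\<close> and \<open>h\<close>. Compatible pairs are therefore cocones on the span
  tensored with \<open>R\<close>.\<close>

lemma ex_universal_coaction:
  assumes coc: "cocomplete TYPE('u) V" and inf: "infinite (UNIV :: 'u set)"
    and X: "is_dual X Y e n" and X': "is_dual X' Y' e' n'"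
    and [simp]: "f \<in> Arr V" "Dom V f = X" "Cod V f = X'"
  obtains D \<rho> \<rho>' where "universal_coaction V X X' D f \<rho> \<rho>'"
proof -
  note [simp] = is_dualD(1-8)[OF X] is_dualD(1-8)[OF X'] dual_typing[OF X] dual_typing[OF X']
  \<comment> \<open>\<open>w\<close> expands \<open>X\<close> to
    \<open>X \<otimes> (Y \<otimes> X)\<close> and applies \<open>f\<close> to the first factor; its
    transpose over the dual of \<open>X'\<close> is the leg \<open>k\<close>.\<close>
  define w where "w = (f \<otimes>\<^sub>a \<i> (Y \<otimes> X)) \<cdot> dual_coev X Y n X"
  have w [simp]: "w \<in> Arr V" "Dom V w = X" "Cod V w = X' \<otimes> (Y \<otimes> X)"
    by (simp_all add: w_def)
  \<comment> \<open>\<open>k\<close> is the mate of \<open>f\<close>, tensored with \<open>X\<close>.\<close>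
  define k where "k = dual_ev X' Y' e' (Y \<otimes> X) \<cdot> (\<i> Y' \<otimes>\<^sub>a w)"
  have [simp]: "k \<in> Arr V" "Dom V k = Y' \<otimes> X" "Cod V k = Y \<otimes> X"
    by (simp_all add: k_def)
  define h where "h = \<i> Y' \<otimes>\<^sub>a f"
  have [simp]: "h \<in> Arr V" "Dom V h = Y' \<otimes> X" "Cod V h = Y' \<otimes> X'"
    by (simp_all add: h_def)
  obtain i j where po: "is_pushout V k h i j"
    by (rule ex_pushout[OF coc inf, of k h]) simp_all
  define D where "D = Cod V i"
  have [simp]: "i \<in> Arr V" "j \<in> Arr V" "Dom V i = Y \<otimes> X" "Dom V j = Y' \<otimes> X'" "Cod V i = D" "Cod V j = D"
    and comm: "i \<cdot> k = j \<cdot> h"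
    using po by (simp_all add: is_pushout_def D_def)
  have [simp]: "D \<in> Obj V" by (simp add: D_def del: \<open>Cod V i = D\<close>)
  define \<rho> where "\<rho> = (\<i> X \<otimes>\<^sub>a i) \<cdot> dual_coev X Y n X"
  define \<rho>' where "\<rho>' = (\<i> X' \<otimes>\<^sub>a j) \<cdot> dual_coev X' Y' n' X'"
  note ext = ext12_dual_coaction[OF X, of D i, folded \<rho>_def, simplified]
    ext12_dual_coaction[OF X', of D j, folded \<rho>'_def, simplified]
  note mate = dual_coaction_mate[OF X, of D i, folded \<rho>_def, simplified]
    dual_coaction_mate[OF X', of D j, folded \<rho>'_def, simplified]
  have [simp]: "\<rho> \<in> Arr V" "Dom V \<rho> = X" "Cod V \<rho> = X \<otimes> D" "\<rho>' \<in> Arr V" "Dom V \<rho>' = X'" "Cod V \<rho>' = X' \<otimes> D"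
    by (simp_all add: \<rho>_def \<rho>'_def)
  have "universal_coaction V X X' D f \<rho> \<rho>'"
  proof unfold_locales
    \<comment> \<open>Compatibility of the coactions is the transposed pushout square:
      \<open>j \<cdot> h\<close> gives \<open>\<rho>' \<cdot> f\<close>, and
      \<open>i \<cdot> k\<close> gives the other side once a zigzag for \<open>X'\<close> is
      removed.\<close>
    have n: "(\<i> X' \<otimes>\<^sub>a (\<i> Y' \<otimes>\<^sub>a w)) \<cdot> dual_coev X' Y' n' X = dual_coev X' Y' n' (X' \<otimes> (Y \<otimes> X)) \<cdot> w"
      by (simp add: dual_coev_nat[OF X'])
    have "\<rho>' \<cdot> f = (\<i> X' \<otimes>\<^sub>a j) \<cdot> (dual_coev X' Y' n' X' \<cdot> f)"
      by (simp add: \<rho>'_def)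
    also have "\<dots> = (\<i> X' \<otimes>\<^sub>a (j \<cdot> h)) \<cdot> dual_coev X' Y' n' X"
      by (simp add: dual_coev_nat[OF X'] h_def)
    also have "\<dots> = (\<i> X' \<otimes>\<^sub>a i) \<cdot> ((\<i> X' \<otimes>\<^sub>a dual_ev X' Y' e' (Y \<otimes> X)) \<cdot> ((\<i> X' \<otimes>\<^sub>a (\<i> Y' \<otimes>\<^sub>a w)) \<cdot> dual_coev X' Y' n' X))"
      unfolding comm[symmetric] by (simp add: k_def)
    also have "\<dots> = (\<i> X' \<otimes>\<^sub>a i) \<cdot> ((\<i> X' \<otimes>\<^sub>a dual_ev X' Y' e' (Y \<otimes> X)) \<cdot> dual_coev X' Y' n' (X' \<otimes> (Y \<otimes> X))) \<cdot> w"
      unfolding n by simp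
    also have "\<dots> = (f \<otimes>\<^sub>a \<i> D) \<cdot> \<rho>"
      by (simp add: dual_snake1[OF X']) (simp add: w_def \<rho>_def)
    finally show "(f \<otimes>\<^sub>a \<i> D) \<cdot> \<rho> = \<rho>' \<cdot> f" ..
  next
    fix R s Z s'
    assume R: "R \<in> Obj V" and s: "s \<in> hom V (D \<otimes> R) Z" "s' \<in> hom V (D \<otimes> R) Z"
      and e: "(\<i> X \<otimes>\<^sub>a s) \<cdot> ext12 X D \<rho> R = (\<i> X \<otimes>\<^sub>a s') \<cdot> ext12 X D \<rho> R"
        "(\<i> X' \<otimes>\<^sub>a s) \<cdot> ext12 X' D \<rho>' R = (\<i> X' \<otimes>\<^sub>a s') \<cdot> ext12 X' D \<rho>' R"
    have Z: "Z \<in> Obj V" using s(1) by auto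
    have s': "s \<in> Arr V" "Dom V s = D \<otimes> R" "Cod V s = Z" "s' \<in> Arr V" "Dom V s' = D \<otimes> R" "Cod V s' = Z"
      using s by auto
    \<comment> \<open>Transposed, the hypotheses say that \<open>s\<close> and \<open>s'\<close>
      agree on both legs of the tensored pushout.\<close>
    have "s \<cdot> (i \<otimes>\<^sub>a \<i> R) = s' \<cdot> (i \<otimes>\<^sub>a \<i> R)"
      using mate(1)[OF R s'(1-3)] mate(1)[OF R s'(4-6)] e(1) by argo
    moreover have "s \<cdot> (j \<otimes>\<^sub>a \<i> R) = s' \<cdot> (j \<otimes>\<^sub>a \<i> R)"
      using mate(2)[OF R s'(1-3)] mate(2)[OF R s'(4-6)] e(2) by argo
    ultimately show "s = s'"
      using pushout_tens(2)[OF po R Z, of s s'] s by simp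
  next
    fix R Z \<alpha> \<alpha>'
    assume [simp]: "R \<in> Obj V" "Z \<in> Obj V" and \<alpha>: "\<alpha> \<in> hom V (X \<otimes> R) (X \<otimes> Z)" "\<alpha>' \<in> hom V (X' \<otimes> R) (X' \<otimes> Z)"
      and e: "(f \<otimes>\<^sub>a \<i> Z) \<cdot> \<alpha> = \<alpha>' \<cdot> (f \<otimes>\<^sub>a \<i> R)"
    have [simp]: "\<alpha> \<in> Arr V" "Dom V \<alpha> = X \<otimes> R" "Cod V \<alpha> = X \<otimes> Z" "\<alpha>' \<in> Arr V" "Dom V \<alpha>' = X' \<otimes> R" "Cod V \<alpha>' = X' \<otimes> Z"
      using \<alpha> by auto
    \<comment> \<open>The transposes of \<open>\<alpha>\<close> and \<open>\<alpha>'\<close>,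
      rebracketed; they are to form a cocone on the tensored span.\<close>
    define s where "s = dual_ev X Y e Z \<cdot> (\<i> Y \<otimes>\<^sub>a \<alpha>) \<cdot> \<a> Y X R"
    define s' where "s' = dual_ev X' Y' e' Z \<cdot> (\<i> Y' \<otimes>\<^sub>a \<alpha>') \<cdot> \<a> Y' X' R"
    have [simp]: "s \<in> Arr V" "Dom V s = (Y \<otimes> X) \<otimes> R" "Cod V s = Z"
      "s' \<in> Arr V" "Dom V s' = (Y' \<otimes> X') \<otimes> R" "Cod V s' = Z"
      by (simp_all add: s_def s'_def)
    have s\<alpha>: "(\<i> X \<otimes>\<^sub>a (s \<cdot> \<i>\<n>\<v> (\<a> Y X R))) \<cdot> dual_coev X Y n (X \<otimes> R) = \<alpha>"
      "(\<i> X' \<otimes>\<^sub>a (s' \<cdot> \<i>\<n>\<v> (\<a> Y' X' R))) \<cdot> dual_coev X' Y' n' (X' \<otimes> R) = \<alpha>'"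
      using dual_mate[OF X, of R Z \<alpha>] dual_mate[OF X', of R Z \<alpha>'] by (simp_all add: s_def s'_def)
    \<comment> \<open>This leads to \<open>sw\<close>, which carries the hypothesis on
      \<open>f\<close> and whose transpose over the dual of \<open>X'\<close> is the cocone
      equation.\<close>
    have "(\<i> X' \<otimes>\<^sub>a s) \<cdot> \<a> X' (Y \<otimes> X) R \<cdot> (w \<otimes>\<^sub>a \<i> R)
        = (f \<otimes>\<^sub>a s) \<cdot> (\<a> X (Y \<otimes> X) R \<cdot> (dual_coev X Y n X \<otimes>\<^sub>a \<i> R))"
      by (simp add: w_def push)
    also have "\<dots> = (f \<otimes>\<^sub>a \<i> Z) \<cdot> ((\<i> X \<otimes>\<^sub>a (s \<cdot> \<i>\<n>\<v> (\<a> Y X R))) \<cdot> dual_coev X Y n (X \<otimes> R))"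
      by (simp add: dual_coev_tens[OF X])
    also have "\<dots> = \<alpha>' \<cdot> (f \<otimes>\<^sub>a \<i> R)"
      unfolding s\<alpha> e ..
    finally have sw: "(\<i> X' \<otimes>\<^sub>a s) \<cdot> \<a> X' (Y \<otimes> X) R \<cdot> (w \<otimes>\<^sub>a \<i> R) = \<alpha>' \<cdot> (f \<otimes>\<^sub>a \<i> R)" .
    have "k \<otimes>\<^sub>a \<i> R = (dual_ev X' Y' e' (Y \<otimes> X) \<otimes>\<^sub>a \<i> R) \<cdot> ((\<i> Y' \<otimes>\<^sub>a w) \<otimes>\<^sub>a \<i> R)"
      by (simp add: k_def)
    also have "\<dots> = dual_ev X' Y' e' ((Y \<otimes> X) \<otimes> R) \<cdot> (\<i> Y' \<otimes>\<^sub>a (\<a> X' (Y \<otimes> X) R \<cdot> (w \<otimes>\<^sub>a \<i> R))) \<cdot> \<a> Y' X R"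
      by (simp add: dual_ev_tens[OF X'] push)
    finally have "s \<cdot> (k \<otimes>\<^sub>a \<i> R)
        = (s \<cdot> dual_ev X' Y' e' ((Y \<otimes> X) \<otimes> R)) \<cdot> (\<i> Y' \<otimes>\<^sub>a (\<a> X' (Y \<otimes> X) R \<cdot> (w \<otimes>\<^sub>a \<i> R))) \<cdot> \<a> Y' X R"
      by simp
    also have "\<dots> = dual_ev X' Y' e' Z \<cdot> (\<i> Y' \<otimes>\<^sub>a ((\<i> X' \<otimes>\<^sub>a s) \<cdot> \<a> X' (Y \<otimes> X) R \<cdot> (w \<otimes>\<^sub>a \<i> R))) \<cdot> \<a> Y' X R"
      by (subst dual_ev_nat[OF X', symmetric, of s _ Z]) simp_all
    also have "\<dots> = s' \<cdot> (h \<otimes>\<^sub>a \<i> R)"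
      unfolding sw by (simp add: s'_def h_def push)
    finally obtain u where "u \<in> hom V (D \<otimes> R) Z" and ui: "u \<cdot> (i \<otimes>\<^sub>a \<i> R) = s" and uj: "u \<cdot> (j \<otimes>\<^sub>a \<i> R) = s'"
      using pushout_tens(1)[OF po, of R Z s s'] by auto
    then have [simp]: "u \<in> Arr V" "Dom V u = D \<otimes> R" "Cod V u = Z" by auto
    have "(\<i> X \<otimes>\<^sub>a u) \<cdot> ext12 X D \<rho> R = (\<i> X \<otimes>\<^sub>a ((u \<cdot> (i \<otimes>\<^sub>a \<i> R)) \<cdot> \<i>\<n>\<v> (\<a> Y X R))) \<cdot> dual_coev X Y n (X \<otimes> R)"
      by (simp add: ext)
    also have "\<dots> = \<alpha>" unfolding ui by (rule s\<alpha>)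
    finally have 1: "(\<i> X \<otimes>\<^sub>a u) \<cdot> ext12 X D \<rho> R = \<alpha>" .
    have "(\<i> X' \<otimes>\<^sub>a u) \<cdot> ext12 X' D \<rho>' R = (\<i> X' \<otimes>\<^sub>a ((u \<cdot> (j \<otimes>\<^sub>a \<i> R)) \<cdot> \<i>\<n>\<v> (\<a> Y' X' R))) \<cdot> dual_coev X' Y' n' (X' \<otimes> R)"
      by (simp add: ext)
    also have "\<dots> = \<alpha>'" unfolding uj by (rule s\<alpha>)
    finally have 2: "(\<i> X' \<otimes>\<^sub>a u) \<cdot> ext12 X' D \<rho>' R = \<alpha>'" .
    show "\<exists>s \<in> hom V (D \<otimes> R) Z. (\<i> X \<otimes>\<^sub>a s) \<cdot> ext12 X D \<rho> R = \<alpha> \<and> (\<i> X' \<otimes>\<^sub>a s) \<cdot> ext12 X' D \<rho>' R = \<alpha>'"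
      using 1 2 by (intro bexI[of _ u]) simp_all
  qed simp_all
  then show ?thesis by (rule that)
qed

end

section \<open>The isomorphism of categories\<close>

text \<open>Passing to dualizable objects only shrinks the set \<open>S\<close>, so the general
  lemmas on \<open>category_over\<close> apply to both subcategories.\<close>

lemma dualizable_objects_category_over:
  "dualizable_objects V (category_over V S M) = category_over V {x \<in> S. has_dual V (fst x)} M"
  by (auto simp: dualizable_objects_def full_subcategory_def category_over_def forgetful_def)

lemma category_category_over:
  assumes "category V" and S: "\<And>x. x \<in> S \<Longrightarrow> fst x \<in> Obj V"
    and M_id: "\<And>x. x \<in> S \<Longrightarrow> M x (id_arr V (fst x)) x"
    and M_comp: "\<And>x f y g z. x \<in> S \<Longrightarrow> y \<in> S \<Longrightarrow> z \<in> S \<Longrightarrow> f \<in> hom V (fst x) (fst y) \<Longrightarrow>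
      g \<in> hom V (fst y) (fst z) \<Longrightarrow> M x f y \<Longrightarrow> M y g z \<Longrightarrow> M x (Comp V g f) z"
  shows "category (category_over V S M)"
proof -
  interpret category V by fact
  show ?thesis
  proof unfold_locales
    fix f g x y z
    assume "f \<in> hom (category_over V S M) x y" "g \<in> hom (category_over V S M) y z"
    then show "Comp (category_over V S M) g f \<in> hom (category_over V S M) x z"
      using M_comp by (auto simp: category_over_def)
  qed (auto simp: category_over_def S M_id)
qed

text \<open>An arrow over \<open>V\<close> is an arrow of \<open>V\<close> with a property, so an
  object bijection preserving underlying objects and this property extends by the identity on
  underlying arrows, and the forgetful functors agree strictly.\<close>

lemma isomorphism_category_over:
  assumes C: "category (category_over V S M)" "category (category_over V S' M')"
    and T: "bij_betw T S S'" "\<And>x. x \<in> S \<Longrightarrow> fst (T x) = fst x"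
    and M: "\<And>x f y. x \<in> S \<Longrightarrow> y \<in> S \<Longrightarrow> f \<in> hom V (fst x) (fst y) \<Longrightarrow> M x f y \<longleftrightarrow> M' (T x) f (T y)"
  shows "\<exists>F. isomorphism_of_categories (category_over V S M) (category_over V S' M') F \<and>
    functor_eq (category_over V S M) (comp_functor forgetful F) forgetful"
proof -
  define U where "U = inv_into S T"
  have T': "T x \<in> S'" "U (T x) = x" if "x \<in> S" for x
    using T(1) that by (auto simp: U_def bij_betw_def)
  have U: "U y \<in> S" "T (U y) = y" "fst (U y) = fst y" if "y \<in> S'" for y
  proof -
    show *: "U y \<in> S" "T (U y) = y"
      using T(1) that by (auto simp: U_def bij_betw_def inv_into_into f_inv_into_f)
    show "fst (U y) = fst y"
      using T(2)[OF *(1)] *(2) by simp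
  qed
  have M': "M (U x) f (U y) \<longleftrightarrow> M' x f y" if "x \<in> S'" "y \<in> S'" "f \<in> hom V (fst x) (fst y)" for x f y
    using M[of "U x" "U y" f] that U by simp
  let ?F = "\<lambda>T. \<lparr>fobj = T, farr = (\<lambda>(x, f, y). (T x, f, T y))\<rparr>"
  have 1: "is_functor (category_over V S M) (category_over V S' M') (?F T)"
    unfolding is_functor_def using C M T(2) T' by (auto simp: category_over_def)
  have 2: "is_functor (category_over V S' M') (category_over V S M) (?F U)"
    unfolding is_functor_def using C M' U by (auto simp: category_over_def)
  have "isomorphism_of_categories (category_over V S M) (category_over V S' M') (?F T)"
    unfolding isomorphism_of_categories_def
    by (intro conjI exI[of _ "?F U"] 1 2)
      (auto simp: functor_eq_def comp_functor_def id_functor_def category_over_def T' U)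
  moreover have "functor_eq (category_over V S M) (comp_functor forgetful (?F T)) forgetful"
    by (auto simp: functor_eq_def comp_functor_def forgetful_def category_over_def T(2))
  ultimately show ?thesis by blast
qed

context monoidal_category
begin

lemma has_dual_iff: "has_dual V X \<longleftrightarrow> (\<exists>Y e n. is_dual X Y e n)"
  unfolding has_dual_def is_dual_def by blast

lemma right_comodules_eq:
  assumes "is_comon V C"
  shows "right_comodules V C = category_over V {(X, \<rho>). is_comodule C X \<rho>}
    (\<lambda>(X, \<rho>) f (X', \<rho>'). (f \<otimes>\<^sub>a \<i> (comon_obj C)) \<cdot> \<rho> = \<rho>' \<cdot> f)"
  using Obj_right_comodules[OF assms]
  by (simp add: right_comodules_def category_over_def Let_def)

lemma AV_B_eq:
  assumes "is_mon V A" "is_mon V B"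
  shows "AV_B V A B = category_over V {(X, \<psi>). is_AV_B A B X \<psi>}
    (\<lambda>(X, \<psi>) f (X', \<psi>'). (f \<otimes>\<^sub>a \<i> (mon_obj B)) \<cdot> \<psi> = \<psi>' \<cdot> (\<i> (mon_obj A) \<otimes>\<^sub>a f))"
  using Obj_AV_B[OF assms]
  by (simp add: AV_B_def category_over_def Let_def)

lemma category_comodules:
  assumes "is_comon V C" "S \<subseteq> {(X, \<rho>). is_comodule C X \<rho>}"
  shows "category (category_over V S (\<lambda>(X, \<rho>) f (X', \<rho>'). (f \<otimes>\<^sub>a \<i> (comon_obj C)) \<cdot> \<rho> = \<rho>' \<cdot> f))"
proof -
  let ?c = "comon_obj C"
  note [simp] = comon_typing[OF assms(1)]
  have S: "fst x \<in> Obj V" "snd x \<in> Arr V" "Dom V (snd x) = fst x" "Cod V (snd x) = fst x \<otimes> ?c" if "x \<in> S" for x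
    using that assms(2) is_comoduleD(1-4)[of C "fst x" "snd x"] by auto
  have comp: "((g \<cdot> f) \<otimes>\<^sub>a \<i> ?c) \<cdot> snd x = snd z \<cdot> (g \<cdot> f)"
    if x: "x \<in> S" "y \<in> S" "z \<in> S" and f: "f \<in> hom V (fst x) (fst y)" and g: "g \<in> hom V (fst y) (fst z)"
      and e: "(f \<otimes>\<^sub>a \<i> ?c) \<cdot> snd x = snd y \<cdot> f" "(g \<otimes>\<^sub>a \<i> ?c) \<cdot> snd y = snd z \<cdot> g" for x f y g z
  proof -
    note [simp] = S[OF x(1)] S[OF x(2)] S[OF x(3)]
    have [simp]: "f \<in> Arr V" "Dom V f = fst x" "Cod V f = fst y" "g \<in> Arr V" "Dom V g = fst y" "Cod V g = fst z"
      using f g by auto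
    have "((g \<cdot> f) \<otimes>\<^sub>a \<i> ?c) \<cdot> snd x = (g \<otimes>\<^sub>a \<i> ?c) \<cdot> ((f \<otimes>\<^sub>a \<i> ?c) \<cdot> snd x)"
      by simp
    also have "\<dots> = ((g \<otimes>\<^sub>a \<i> ?c) \<cdot> snd y) \<cdot> f"
      unfolding e(1) by simp
    also have "\<dots> = snd z \<cdot> (g \<cdot> f)"
      unfolding e(2) by simp
    finally show ?thesis .
  qed
  show ?thesis
    by (rule category_category_over[OF category_axioms])
      (use S comp in \<open>auto simp: split_beta simp del: in_hom_iff\<close>)
qed

lemma category_AV_B:
  assumes "is_mon V A" "is_mon V B" "S \<subseteq> {(X, \<psi>). is_AV_B A B X \<psi>}"
  shows "category (category_over V S
    (\<lambda>(X, \<psi>) f (X', \<psi>'). (f \<otimes>\<^sub>a \<i> (mon_obj B)) \<cdot> \<psi> = \<psi>' \<cdot> (\<i> (mon_obj A) \<otimes>\<^sub>a f)))"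
proof -
  let ?a = "mon_obj A" and ?b = "mon_obj B"
  note [simp] = mon_typing[OF assms(1)] mon_typing[OF assms(2)]
  have S: "fst x \<in> Obj V" "snd x \<in> Arr V" "Dom V (snd x) = ?a \<otimes> fst x" "Cod V (snd x) = fst x \<otimes> ?b" if "x \<in> S" for x
    using that assms(3) is_AV_BD(1-4)[of A B "fst x" "snd x"] by auto
  have comp: "((g \<cdot> f) \<otimes>\<^sub>a \<i> ?b) \<cdot> snd x = snd z \<cdot> (\<i> ?a \<otimes>\<^sub>a (g \<cdot> f))"
    if x: "x \<in> S" "y \<in> S" "z \<in> S" and f: "f \<in> hom V (fst x) (fst y)" and g: "g \<in> hom V (fst y) (fst z)"
      and e: "(f \<otimes>\<^sub>a \<i> ?b) \<cdot> snd x = snd y \<cdot> (\<i> ?a \<otimes>\<^sub>a f)" "(g \<otimes>\<^sub>a \<i> ?b) \<cdot> snd y = snd z \<cdot> (\<i> ?a \<otimes>\<^sub>a g)" for x f y g z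
  proof -
    note [simp] = S[OF x(1)] S[OF x(2)] S[OF x(3)]
    have [simp]: "f \<in> Arr V" "Dom V f = fst x" "Cod V f = fst y" "g \<in> Arr V" "Dom V g = fst y" "Cod V g = fst z"
      using f g by auto
    have "((g \<cdot> f) \<otimes>\<^sub>a \<i> ?b) \<cdot> snd x = (g \<otimes>\<^sub>a \<i> ?b) \<cdot> ((f \<otimes>\<^sub>a \<i> ?b) \<cdot> snd x)"
      by simp
    also have "\<dots> = ((g \<otimes>\<^sub>a \<i> ?b) \<cdot> snd y) \<cdot> (\<i> ?a \<otimes>\<^sub>a f)"
      unfolding e(1) by simp
    also have "\<dots> = snd z \<cdot> (\<i> ?a \<otimes>\<^sub>a (g \<cdot> f))"
      unfolding e(2) by simp
    finally show ?thesis .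
  qed
  show ?thesis
    by (rule category_category_over[OF category_axioms])
      (use S comp in \<open>auto simp: split_beta simp del: in_hom_iff\<close>)
qed

end

context braided_monoidal_closed_category
begin

text \<open>The form in which \<open>universal_measuring\<close> delivers the universal property of
  \<open>P\<close>; it can be compared directly with arrows out of
  \<open>A \<otimes> D\<close>.\<close>

context
  fixes A B :: "('o, 'm) mon" and P :: "('o, 'm) comon" and t :: 'm
  assumes coc: "cocomplete TYPE('u) V" and inf: "infinite (UNIV :: 'u set)"
    and A: "is_mon V A" and B: "is_mon V B" and P: "is_comon V P" and t: "is_measuring A B P t"
    and measuring_factor: "\<And>C s. is_comon V C \<Longrightarrow> is_measuring A B C s \<Longrightarrow>
      \<exists>g \<in> comon_hom V C P. s = t \<cdot> (\<i> (mon_obj A) \<otimes>\<^sub>a g)"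
    and measuring_unique: "\<And>C g g'. is_comon V C \<Longrightarrow> g \<in> comon_hom V C P \<Longrightarrow> g' \<in> comon_hom V C P \<Longrightarrow>
      t \<cdot> (\<i> (mon_obj A) \<otimes>\<^sub>a g) = t \<cdot> (\<i> (mon_obj A) \<otimes>\<^sub>a g') \<Longrightarrow> g = g'"
begin

abbreviation (input) \<Phi> where "\<Phi> X \<rho> \<equiv> act (mon_obj A) X (comon_obj P) t \<rho>"

text \<open>Reconstruction for the identity of \<open>X\<close>: both coactions are pushed forward
  from a universal one along comonoid maps \<open>g\<close>, \<open>g'\<close> into
  \<open>P\<close>. Equal images under \<open>\<Phi>\<close> mean equal induced measurings by
  \<open>act_separating\<close>, hence \<open>g = g'\<close>.\<close>

lemma comodule_unique:
  assumes X: "has_dual V X" and \<sigma>: "is_comodule P X \<sigma>" and \<sigma>': "is_comodule P X \<sigma>'"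
    and e: "\<Phi> X \<sigma> = \<Phi> X \<sigma>'"
  shows "\<sigma> = \<sigma>'"
proof -
  let ?a = "mon_obj A" and ?p = "comon_obj P"
  note [simp] = mon_typing[OF A] mon_typing[OF B] comon_typing[OF P] is_measuringD(1-3)[OF t]
    is_comoduleD(1-4)[OF \<sigma>] is_comoduleD(1-4)[OF \<sigma>']
  obtain Y d n where Y: "is_dual X Y d n"
    using X by (auto simp: has_dual_iff)
  obtain D \<rho> \<rho>' where "universal_coaction V X X D (\<i> X) \<rho> \<rho>'"
    by (rule ex_universal_coaction[OF coc inf Y Y, of "\<i> X"]) simp_all
  then interpret U: universal_coaction V X X D "\<i> X" \<rho> \<rho>' .
  obtain C where C: "is_comon V C" "comon_obj C = D" and \<rho>: "is_comodule C X \<rho>" "is_comodule C X \<rho>'"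
    by (rule U.ex_comon)
  obtain g where g: "g \<in> comon_hom V C P" "(\<i> X \<otimes>\<^sub>a g) \<cdot> \<rho> = \<sigma>" "(\<i> X \<otimes>\<^sub>a g) \<cdot> \<rho>' = \<sigma>"
    by (rule U.ex_comon_hom[OF C P \<rho> \<sigma> \<sigma>]) simp_all
  obtain g' where g': "g' \<in> comon_hom V C P" "(\<i> X \<otimes>\<^sub>a g') \<cdot> \<rho> = \<sigma>'" "(\<i> X \<otimes>\<^sub>a g') \<cdot> \<rho>' = \<sigma>'"
    by (rule U.ex_comon_hom[OF C P \<rho> \<sigma>' \<sigma>']) simp_all
  have [simp]: "g \<in> Arr V" "Dom V g = D" "Cod V g = ?p" "g' \<in> Arr V" "Dom V g' = D" "Cod V g' = ?p"
    using g(1) g'(1) C(2) by (auto simp: comon_hom_def)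
  have \<Phi>: "act ?a X D (t \<cdot> (\<i> ?a \<otimes>\<^sub>a h)) \<tau> = \<Phi> X ((\<i> X \<otimes>\<^sub>a h) \<cdot> \<tau>)"
    if "h \<in> Arr V" "Dom V h = D" "Cod V h = ?p" "\<tau> \<in> Arr V" "Dom V \<tau> = X" "Cod V \<tau> = X \<otimes> D" for h \<tau>
    using that by (simp add: act_push[where c = D])
  have "t \<cdot> (\<i> ?a \<otimes>\<^sub>a g) = t \<cdot> (\<i> ?a \<otimes>\<^sub>a g')"
    by (rule U.act_separating[of ?a _ _ "mon_obj B"]) (simp_all add: \<Phi> g g' e)
  then have "g = g'"
    by (rule measuring_unique[OF C(1) g(1) g'(1)])
  then show ?thesis using g g' by simp
qed

text \<open>Surjectivity and fullness at once: both structures come from one measuring on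
  \<open>D\<close>, hence from one comonoid map \<open>g\<close> into \<open>P\<close>, and the
  pushed-forward coactions inherit compatibility with \<open>f\<close> from the universal
  ones.\<close>

lemma ex_comodules:
  assumes X: "has_dual V X" and X': "has_dual V X'"
    and \<psi>: "is_AV_B A B X \<psi>" and \<psi>': "is_AV_B A B X' \<psi>'" and f: "f \<in> hom V X X'"
    and e: "(f \<otimes>\<^sub>a \<i> (mon_obj B)) \<cdot> \<psi> = \<psi>' \<cdot> (\<i> (mon_obj A) \<otimes>\<^sub>a f)"
  obtains \<sigma> \<sigma>' where "is_comodule P X \<sigma>" "is_comodule P X' \<sigma>'" "\<Phi> X \<sigma> = \<psi>" "\<Phi> X' \<sigma>' = \<psi>'"
    "(f \<otimes>\<^sub>a \<i> (comon_obj P)) \<cdot> \<sigma> = \<sigma>' \<cdot> f"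
proof -
  let ?a = "mon_obj A" and ?p = "comon_obj P"
  note [simp] = mon_typing[OF A] mon_typing[OF B] comon_typing[OF P] is_measuringD(1-3)[OF t]
  have [simp]: "f \<in> Arr V" "Dom V f = X" "Cod V f = X'" using f by auto
  obtain Y d n Y' d' n' where Y: "is_dual X Y d n" and Y': "is_dual X' Y' d' n'"
    using X X' by (auto simp: has_dual_iff)
  obtain D \<rho> \<rho>' where "universal_coaction V X X' D f \<rho> \<rho>'"
    by (rule ex_universal_coaction[OF coc inf Y Y', of f]) simp_all
  then interpret U: universal_coaction V X X' D f \<rho> \<rho>' .
  obtain C where C: "is_comon V C" "comon_obj C = D" and \<rho>: "is_comodule C X \<rho>" "is_comodule C X' \<rho>'"
    by (rule U.ex_comon)
  obtain s where s: "is_measuring A B C s" "act ?a X D s \<rho> = \<psi>" "act ?a X' D s \<rho>' = \<psi>'"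
    by (rule U.ex_measuring[OF A B C \<rho> \<psi> \<psi>' e])
  obtain g where g: "g \<in> comon_hom V C P" and sg: "s = t \<cdot> (\<i> ?a \<otimes>\<^sub>a g)"
    using measuring_factor[OF C(1) s(1)] by blast
  have [simp]: "g \<in> Arr V" "Dom V g = D" "Cod V g = ?p"
    using g C(2) by (auto simp: comon_hom_def)
  have "(f \<otimes>\<^sub>a \<i> ?p) \<cdot> (\<i> X \<otimes>\<^sub>a g) \<cdot> \<rho> = (\<i> X' \<otimes>\<^sub>a g) \<cdot> ((f \<otimes>\<^sub>a \<i> D) \<cdot> \<rho>)"
    by simp
  also have "\<dots> = ((\<i> X' \<otimes>\<^sub>a g) \<cdot> \<rho>') \<cdot> f"
    unfolding U.compatible by simp
  finally show ?thesis
    using s(2,3) unfolding sg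
    by (intro that[OF is_comodule_push[OF C(1) P \<rho>(1) g] is_comodule_push[OF C(1) P \<rho>(2) g]])
      (simp_all add: act_push[where c = D])
qed

lemma dualizable_comodules_iso:
  "\<exists>F. isomorphism_of_categories
         (dualizable_objects V (right_comodules V P)) (dualizable_objects V (AV_B V A B)) F \<and>
       functor_eq (dualizable_objects V (right_comodules V P)) (comp_functor forgetful F) forgetful"
proof -
  let ?S = "{x \<in> {(X, \<rho>). is_comodule P X \<rho>}. has_dual V (fst x)}"
  let ?S' = "{x \<in> {(X, \<psi>). is_AV_B A B X \<psi>}. has_dual V (fst x)}"
  define T where "T = (\<lambda>(X, \<rho>). (X, \<Phi> X \<rho>))"
  note [simp] = mon_typing[OF A] mon_typing[OF B] comon_typing[OF P] is_measuringD(1-3)[OF t]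
  have into: "is_AV_B A B X (\<Phi> X \<rho>)" if "is_comodule P X \<rho>" for X \<rho>
    using is_AV_B_act[OF A B P that t] .
  have surj: "\<exists>\<rho>. is_comodule P X \<rho> \<and> \<Phi> X \<rho> = \<psi>" if "has_dual V X" "is_AV_B A B X \<psi>" for X \<psi>
  proof -
    note [simp] = is_AV_BD(1-4)[OF that(2)]
    \<comment> \<open>Surjectivity on objects is the case of the identity arrow.\<close>
    show ?thesis
      by (rule ex_comodules[OF that(1) that(1) that(2) that(2), of "\<i> X"]) auto
  qed
  have "bij_betw T ?S ?S'"
    unfolding bij_betw_def
  proof
    show "inj_on T ?S"
      using comodule_unique by (auto simp: inj_on_def T_def)
    show "T ` ?S = ?S'"
      using into surj by (force simp: T_def image_iff)
  qed
  moreover have "(f \<otimes>\<^sub>a \<i> (comon_obj P)) \<cdot> \<rho> = \<rho>' \<cdot> f \<longleftrightarrow>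
      (f \<otimes>\<^sub>a \<i> (mon_obj B)) \<cdot> \<Phi> X \<rho> = \<Phi> X' \<rho>' \<cdot> (\<i> (mon_obj A) \<otimes>\<^sub>a f)"
    if \<rho>: "is_comodule P X \<rho>" "is_comodule P X' \<rho>'" and d: "has_dual V X" "has_dual V X'"
      and f: "f \<in> hom V X X'" for X \<rho> X' \<rho>' f
  proof
    assume "(f \<otimes>\<^sub>a \<i> (comon_obj P)) \<cdot> \<rho> = \<rho>' \<cdot> f"
    then show "(f \<otimes>\<^sub>a \<i> (mon_obj B)) \<cdot> \<Phi> X \<rho> = \<Phi> X' \<rho>' \<cdot> (\<i> (mon_obj A) \<otimes>\<^sub>a f)"
      using is_comoduleD(1-4)[OF \<rho>(1)] is_comoduleD(1-4)[OF \<rho>(2)] f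
      by (intro act_morphism) simp_all
  next
    assume "(f \<otimes>\<^sub>a \<i> (mon_obj B)) \<cdot> \<Phi> X \<rho> = \<Phi> X' \<rho>' \<cdot> (\<i> (mon_obj A) \<otimes>\<^sub>a f)"
    \<comment> \<open>The lift may bring new coactions \<open>\<sigma>\<close>,
      \<open>\<sigma>'\<close>, but they have the same images as \<open>\<rho>\<close>,
      \<open>\<rho>'\<close>, so uniqueness identifies them.\<close>
    from ex_comodules[OF d into[OF \<rho>(1)] into[OF \<rho>(2)] f this]
    obtain \<sigma> \<sigma>' where \<sigma>: "is_comodule P X \<sigma>" "is_comodule P X' \<sigma>'" "\<Phi> X \<sigma> = \<Phi> X \<rho>" "\<Phi> X' \<sigma>' = \<Phi> X' \<rho>'"
      and e: "(f \<otimes>\<^sub>a \<i> (comon_obj P)) \<cdot> \<sigma> = \<sigma>' \<cdot> f" .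
    have "\<sigma> = \<rho>" "\<sigma>' = \<rho>'"
      using comodule_unique[OF d(1) \<sigma>(1) \<rho>(1)] comodule_unique[OF d(2) \<sigma>(2) \<rho>(2)] \<sigma> by auto
    then show "(f \<otimes>\<^sub>a \<i> (comon_obj P)) \<cdot> \<rho> = \<rho>' \<cdot> f"
      using e by simp
  qed
  ultimately show ?thesis
    unfolding right_comodules_eq[OF P] AV_B_eq[OF A B] dualizable_objects_category_over
    by (intro isomorphism_category_over[of _ _ _ _ _ T] category_comodules[OF P] category_AV_B[OF A B])
      (auto simp: T_def simp del: in_hom_iff)
qed

end

end

theorem corollary6p5:
  fixes V :: "('o, 'm) braided_closed_cat"
    and A B :: "('o, 'm) mon"
    and P :: "('o, 'm) comon"
  assumes "braided_monoidal_closed_category V"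
    and "locally_presentable TYPE('u) V"
    and "is_mon V A"
    and "is_mon V B"
    and "universal_measuring_comon V A B P"
  shows "\<exists>F. isomorphism_of_categories
               (dualizable_objects V (right_comodules V P))
               (dualizable_objects V (AV_B V A B)) F \<and>
             functor_eq (dualizable_objects V (right_comodules V P))
               (comp_functor forgetful F) forgetful"
proof -
  interpret braided_monoidal_closed_category V by fact
  obtain t where t: "is_measuring A B P t"
    "\<And>C s. is_comon V C \<Longrightarrow> is_measuring A B C s \<Longrightarrow>
      \<exists>g \<in> comon_hom V C P. s = Comp V t (tens_arr V (id_arr V (mon_obj A)) g)"
    "\<And>C g g'. is_comon V C \<Longrightarrow> g \<in> comon_hom V C P \<Longrightarrow> g' \<in> comon_hom V C P \<Longrightarrow>
      Comp V t (tens_arr V (id_arr V (mon_obj A)) g) = Comp V t (tens_arr V (id_arr V (mon_obj A)) g') \<Longrightarrow> g = g'"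
    using universal_measuring[OF assms(3-5)] by blast
  \<comment> \<open>Local presentability includes an infinite regular cardinal below the universe,
    which makes room for the span that indexes pushouts.\<close>
  obtain r :: "'u rel" where "small_regular_cardinal r"
    using assms(2) by (auto simp: locally_presentable_def)
  then have inf: "infinite (UNIV :: 'u set)"
    by (rule infinite_universe)
  have coc: "cocomplete TYPE('u) V"
    using assms(2) by (simp add: locally_presentable_def)
  have P: "is_comon V P"
    using assms(5) by (simp add: universal_measuring_comon_def)
  show ?thesis
    by (rule dualizable_comodules_iso[OF coc inf assms(3,4) P t])
qed

end
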